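(* Let $M$ be a nonsingular complex algebraic variety and $D=\bigcup_{i\in I}D_i$ a divisor with simple normal crossings, with associated line bundles $L_i$ and sections $s_i$. The sections $(s_i)_{i\in I}$ induce (by the formulae given in the context) bijections $$(M,D)^{\mathrm{mot}}\simeq(M,D)^{\mathrm{alog}},\qquad (M,D)^{\mathrm{top}}\simeq(M,D)^{\mathrm{log}},\qquad (M,D)^{\mathrm{cpl}}\simeq(M,D)^{\mathrm{clog}}.$$
   Context: **Set-up.** $I$ is finite and the $D_i$ are nonsingular hypersurfaces meeting transversally. For $i\in I$, $L_i\to M$ is the algebraic line bundle associated with $D_i$ and $s_i$ is a regular section of $L_i$, transverse to the zero section, with zero locus $D_i$. For $x\in M$, $J(x)=\{i\in I:x\in D_i\}$. For a line bundle $L$, $L^*$ is $L$ minus its zero section, $\mathbb S(L)=L^*/\mathbb R_{>0}$, $\theta(v)=v\bmod\mathbb R_{>0}$. ($D$ is the zero locus of a regular function $f$ on $M$ in the paper's set-up.) **Log-spaces.** $\mathcal M$ is the sheaf of multiplicative monoids $\mathcal M(U)=\{g\in\mathcal O_M(U):g_{|U\setminus D}\text{ invertible}\}$. $(M,D)^{\mathrm{log}}=\{(x,\varphi):x\in M,\ \varphi\in\mathrm{Hom}_{\mathrm{mon}}(\mathcal M_x,S^1),\ \varphi(g)=g(x)/|g(x)|\ \forall g\in\mathcal O_x^*\}$; $(M,D)^{\mathrm{clog}}=\{(x,\varphi,\psi):(x,\varphi)\in(M,D)^{\mathrm{log}},\ \psi\in\mathrm{Hom}_{\mathrm{mon}}(\mathcal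 M_x,((0,\infty],\cdot)),\ \psi(g)=|g(x)|\ \forall g\in\mathcal O_x^*\}$; $(M,D)^{\mathrm{alog}}=\{(x,\Phi):x\in M,\ \Phi\in\mathrm{Hom}_{\mathrm{mon}}(\mathcal M_x,\mathbb C^* ),\ \Phi(g)=g(x)\ \forall g\in\mathcal O_x^*\}$. **Geometric spaces.** $\mathbb S(L_i\oplus\mathbf 1_{\ge0})=L_i\sqcup\mathbb S(L_i)$ is the fibrewise compactification of $L_i$ by a circle at infinity, with fibre $((L_{i,x}\times\mathbb R_{\ge0})\setminus\{(0,0)\})/\mathbb R_{>0}$. Inside it: $(M,D_i)^{\mathrm{top}}=\widehat M_i=\{(x,\theta):\theta\in\mathbb S(L_i)_x,\ \theta=\theta(s_i(x))\text{ if }x\notin D_i\}$ (real oriented blowing-up of $M$ along $D_i$); $(M,D_i)^{\mathrm{cpl}}=\widehat M_i\sqcup L^*_{i|D_i}$; $(M,D_i)^{\mathrm{mot}}=(M,D_i)^{\mathrm{cpl}}\setminus\mathbb S(L_{i|D_i})$, i.e. $L^*_{i|D_i}$ together with the copy $x\mapsto\theta(s_i(x))$ of $M\setminus D_i$ at infinity. $(M,D)^{\mathrm{top}}$, $(M,D)^{\mathrm{cpl}}$, $(M,D)^{\mathrm{mot}}$ are the fibre products over $M$, $i\in I$, of $(M,D_i)^{\mathrm{top}}$, $(M,D_i)^{\mathrm{cpl}}$, $(M,D_i)^{\mathrm{mot}}$. **Induced maps.** Let $\ell_i$ be a nonvanishing local section of $L_i$ near $x$ (the formulae do not depend on it). All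 maps cover the identity of $M$, and for $i\notin J(x)$ the $i$-th component of the image is $\theta(s_i(x))$. For $i\in J(x)$ the $i$-th component is: $\Phi(s_i/\ell_i)\,\ell_i(x)\in L^*_{i,x}$ for $(x,\Phi)\in(M,D)^{\mathrm{alog}}$; $\varphi(s_i/\ell_i)\,\theta(\ell_i(x))\in\mathbb S(L_i)_x$ for $(x,\varphi)\in(M,D)^{\mathrm{log}}$; and for $(x,\varphi,\psi)\in(M,D)^{\mathrm{clog}}$, $\psi(s_i/\ell_i)\varphi(s_i/\ell_i)\,\ell_i(x)\in L_{i,x}^*$ if $\psi(s_i/\ell_i)<\infty$, and $\varphi(s_i/\ell_i)\,\theta(\ell_i(x))\in\mathbb S(L_i)_x$ if $\psi(s_i/\ell_i)=\infty$. *)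

theory Defs
  imports "HOL-Analysis.Analysis" "HOL-Algebra.Group"
begin

section \<open>Complex algebraic varieties as spaces with functions\<close>

text \<open>
  A space with functions is a topological space with a sheaf of complex valued functions.
  Functions are total in HOL: membership in \<open>reg X U\<close> only depends on the restriction to \<open>U\<close>
  (first clause of \<open>function_sheaf\<close>), so elements of \<open>reg X U\<close> stand for functions on \<open>U\<close>.
\<close>

record 'a fspace =
  ztop :: "'a topology"
  reg :: "'a set \<Rightarrow> ('a \<Rightarrow> complex) set"

abbreviation points :: "('a, 'z) fspace_scheme \<Rightarrow> 'a set" where
  "points X \<equiv> topspace (ztop X)"

definition function_sheaf :: "'a fspace \<Rightarrow> bool" where
  "function_sheaf X \<longleftrightarrow>
     (\<forall>U f g. openin (ztop X) U \<and> f \<in> reg X U \<and> (\<forall>y\<in>U. f y = g y) \<longrightarrow> g \<in> reg X U) \<and>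
     (\<forall>U V f. openin (ztop X) U \<and> openin (ztop X) V \<and> V \<subseteq> U \<and> f \<in> reg X U \<longrightarrow> f \<in> reg X V) \<and>
     (\<forall>\<U> f. (\<forall>U\<in>\<U>. openin (ztop X) U \<and> f \<in> reg X U) \<longrightarrow> f \<in> reg X (\<Union>\<U>))"

definition open_subspace :: "'a fspace \<Rightarrow> 'a set \<Rightarrow> 'a fspace" where
  "open_subspace X U = \<lparr>ztop = subtopology (ztop X) U, reg = reg X\<rparr>"

definition fspace_iso :: "'a fspace \<Rightarrow> 'b fspace \<Rightarrow> ('a \<Rightarrow> 'b) \<Rightarrow> bool" where
  "fspace_iso X Y \<phi> \<longleftrightarrow>
     homeomorphic_map (ztop X) (ztop Y) \<phi> \<and>
     (\<forall>V f. openin (ztop Y) V \<longrightarrow>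
        (f \<in> reg Y V \<longleftrightarrow> f \<circ> \<phi> \<in> reg X {x \<in> points X. \<phi> x \<in> V}))"

text \<open>Affine space \<open>\<complex>\<^sup>N\<close>, realised as the sequences vanishing from index \<open>N\<close> on.\<close>

definition cspace :: "nat \<Rightarrow> (nat \<Rightarrow> complex) set" where
  "cspace N = {z. \<forall>k\<ge>N. z k = 0}"

inductive_set poly_fun :: "nat \<Rightarrow> ((nat \<Rightarrow> complex) \<Rightarrow> complex) set" for N :: nat where
  const: "(\<lambda>z. c) \<in> poly_fun N"
| coord: "k < N \<Longrightarrow> (\<lambda>z. z k) \<in> poly_fun N"
| add: "f \<in> poly_fun N \<Longrightarrow> g \<in> poly_fun N \<Longrightarrow> (\<lambda>z. f z + g z) \<in> poly_fun N"
| mult: "f \<in> poly_fun N \<Longrightarrow> g \<in> poly_fun N \<Longrightarrow> (\<lambda>z. f z * g z) \<in> poly_fun N"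

text \<open>
  The generating sets \<open>{f \<noteq> 0}\<close> are stable under finite intersections, so the closed sets
  of this topology are exactly the common zero loci in \<open>\<complex>\<^sup>N\<close> of families of polynomials.
\<close>

definition zariski :: "nat \<Rightarrow> (nat \<Rightarrow> complex) topology" where
  "zariski N = topology_generated_by {{z \<in> cspace N. f z \<noteq> 0} | f. f \<in> poly_fun N}"

definition affine_fspace :: "nat \<Rightarrow> (nat \<Rightarrow> complex) set \<Rightarrow> (nat \<Rightarrow> complex) fspace" where
  "affine_fspace N Z =
     \<lparr>ztop = subtopology (zariski N) Z,
      reg = (\<lambda>W. {f. \<forall>p\<in>W. \<exists>V. openin (zariski N) V \<and> p \<in> V \<and>
               (\<exists>P\<in>poly_fun N. \<exists>Q\<in>poly_fun N. \<forall>q\<in>V \<inter> W. Q q \<noteq> 0 \<and> f q = P q / Q q)})\<rparr>"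

definition affine_chart ::
    "'a fspace \<Rightarrow> 'a set \<Rightarrow> nat \<Rightarrow> (nat \<Rightarrow> complex) set \<Rightarrow> ('a \<Rightarrow> nat \<Rightarrow> complex) \<Rightarrow> bool" where
  "affine_chart X U N Z \<phi> \<longleftrightarrow>
     openin (ztop X) U \<and> closedin (zariski N) Z \<and>
     fspace_iso (open_subspace X U) (affine_fspace N Z) \<phi>"

text \<open>The point \<open>(z, w)\<close> of \<open>\<complex>\<^sup>N \<times> \<complex>\<^sup>N\<^sup>' = \<complex>\<^sup>N\<^sup>+\<^sup>N\<^sup>'\<close>.\<close>

definition join_pt :: "nat \<Rightarrow> (nat \<Rightarrow> complex) \<Rightarrow> (nat \<Rightarrow> complex) \<Rightarrow> nat \<Rightarrow> complex" where
  "join_pt N z w = (\<lambda>k. if k < N then z k else w (k - N))"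

text \<open>
  The last clause says that the diagonal is closed in \<open>X \<times> X\<close>, tested on the affine open
  sets \<open>U \<times> U'\<close> with their embeddings in affine space. Irreducibility is not required.
\<close>

definition variety :: "'a fspace \<Rightarrow> bool" where
  "variety X \<longleftrightarrow>
     function_sheaf X \<and>
     (\<exists>\<U>. finite \<U> \<and> \<Union>\<U> = points X \<and> (\<forall>U\<in>\<U>. \<exists>N Z \<phi>. affine_chart X U N Z \<phi>)) \<and>
     (\<forall>U N Z \<phi> U' N' Z' \<phi>'. affine_chart X U N Z \<phi> \<and> affine_chart X U' N' Z' \<phi>' \<longrightarrow>
        closedin (zariski (N + N')) {join_pt N (\<phi> y) (\<phi>' y) | y. y \<in> U \<inter> U'})"

definition pderivative :: "nat \<Rightarrow> ((nat \<Rightarrow> complex) \<Rightarrow> complex) \<Rightarrow> (nat \<Rightarrow> complex) \<Rightarrow> complex" where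
  "pderivative k f p = deriv (\<lambda>w. f (p(k := w))) (p k)"

text \<open>
  Nonsingular (smooth): near each point \<open>X\<close> is isomorphic to the locus in some \<open>\<complex>\<^sup>N\<close> of
  \<open>c\<close> polynomial equations whose Jacobian matrix has rank \<open>c\<close> at that point.
\<close>

definition nonsingular_variety :: "'a fspace \<Rightarrow> bool" where
  "nonsingular_variety X \<longleftrightarrow> variety X \<and>
     (\<forall>x\<in>points X. \<exists>U N Z \<phi> c F. x \<in> U \<and> affine_chart X U N Z \<phi> \<and>
        (\<forall>j<c. F j \<in> poly_fun N) \<and>
        Z = {z \<in> cspace N. \<forall>j<(c::nat). F j z = 0} \<and>
        (\<forall>a :: nat \<Rightarrow> complex.
           (\<forall>k<N. (\<Sum>j<c. a j * pderivative k (F j) (\<phi> x)) = 0) \<longrightarrow> (\<forall>j<c. a j = 0)))"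


section \<open>Tangent vectors and simple normal crossings\<close>

definition local_reg :: "'a fspace \<Rightarrow> 'a \<Rightarrow> ('a \<Rightarrow> complex) set" where
  "local_reg X x = {f. \<exists>U. openin (ztop X) U \<and> x \<in> U \<and> f \<in> reg X U}"

text \<open>
  The Zariski tangent space: derivations at \<open>x\<close> of the local ring. The first clause says
  that \<open>v\<close> is a function of the germ.
\<close>

definition tangent_space :: "'a fspace \<Rightarrow> 'a \<Rightarrow> (('a \<Rightarrow> complex) \<Rightarrow> complex) set" where
  "tangent_space X x = {v.
     (\<forall>f\<in>local_reg X x. \<forall>g\<in>local_reg X x.
        (\<exists>U. openin (ztop X) U \<and> x \<in> U \<and> (\<forall>y\<in>U. f y = g y)) \<longrightarrow> v f = v g) \<and>
     (\<forall>f\<in>local_reg X x. \<forall>g\<in>local_reg X x. v (\<lambda>y. f y + g y) = v f + v g) \<and>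
     (\<forall>c. \<forall>f\<in>local_reg X x. v (\<lambda>y. c * f y) = c * v f) \<and>
     (\<forall>f\<in>local_reg X x. \<forall>g\<in>local_reg X x. v (\<lambda>y. f y * g y) = f x * v g + g x * v f)}"

definition nonsingular_hypersurface :: "'a fspace \<Rightarrow> 'a set \<Rightarrow> bool" where
  "nonsingular_hypersurface X H \<longleftrightarrow> closedin (ztop X) H \<and>
     (\<forall>x\<in>H. \<exists>U t. openin (ztop X) U \<and> x \<in> U \<and> t \<in> reg X U \<and>
        H \<inter> U = {y \<in> U. t y = 0} \<and> (\<exists>v\<in>tangent_space X x. v t \<noteq> 0))"

definition sub_tangent_space :: "'a fspace \<Rightarrow> 'a set \<Rightarrow> 'a \<Rightarrow> (('a \<Rightarrow> complex) \<Rightarrow> complex) set" where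
  "sub_tangent_space X H x = {v \<in> tangent_space X x.
     \<forall>U g. openin (ztop X) U \<and> x \<in> U \<and> g \<in> reg X U \<and> (\<forall>y\<in>H \<inter> U. g y = 0) \<longrightarrow> v g = 0}"

text \<open>
  Transversality at \<open>x\<close>: the map from \<open>T\<^sub>xX\<close> to the direct sum of the normal spaces
  \<open>T\<^sub>xX / T\<^sub>xD\<^sub>i\<close>, over the \<open>i\<close> with \<open>x \<in> D\<^sub>i\<close>, is surjective.
\<close>

definition meet_transversally :: "'a fspace \<Rightarrow> 'i set \<Rightarrow> ('i \<Rightarrow> 'a set) \<Rightarrow> bool" where
  "meet_transversally X I D \<longleftrightarrow>
     (\<forall>x\<in>points X. \<forall>w. (\<forall>i\<in>I. w i \<in> tangent_space X x) \<longrightarrow>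
        (\<exists>v\<in>tangent_space X x. \<forall>i\<in>I. x \<in> D i \<longrightarrow>
           (\<lambda>f. v f - w i f) \<in> sub_tangent_space X (D i) x))"

definition snc_divisor :: "'a fspace \<Rightarrow> 'i set \<Rightarrow> ('i \<Rightarrow> 'a set) \<Rightarrow> bool" where
  "snc_divisor X I D \<longleftrightarrow>
     finite I \<and> (\<forall>i\<in>I. nonsingular_hypersurface X (D i)) \<and> meet_transversally X I D"


section \<open>Line bundles\<close>

text \<open>
  The fibres are one-dimensional linear subspaces of an ambient complex vector space (which
  is no restriction: take the direct sum of all fibres); the total space is the set of
  pairs \<open>(x, v)\<close> with \<open>v \<in> fibre L x\<close>. The algebraic structure is given by an atlas of local
  frames \<open>(U, l)\<close>, i.e. of local trivialisations, with regular transition functions.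
\<close>

record ('a, 'e) lbundle =
  scal :: "complex \<Rightarrow> 'e \<Rightarrow> 'e"
  fibre :: "'a \<Rightarrow> 'e set"
  frames :: "('a set \<times> ('a \<Rightarrow> 'e)) set"

text \<open>The quotient \<open>s / l\<close> of two sections, meaningful where \<open>l\<close> does not vanish.\<close>

definition sec_quot :: "('a, 'e) lbundle \<Rightarrow> ('a \<Rightarrow> 'e) \<Rightarrow> ('a \<Rightarrow> 'e) \<Rightarrow> 'a \<Rightarrow> complex" where
  "sec_quot L s l = (\<lambda>y. THE c. s y = scal L c (l y))"

definition line_bundle :: "'a fspace \<Rightarrow> ('a, 'e::ab_group_add) lbundle \<Rightarrow> bool" where
  "line_bundle X L \<longleftrightarrow>
     vector_space (scal L) \<and>
     (\<forall>x\<in>points X. module.subspace (scal L) (fibre L x) \<and>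
        vector_space.dim (scal L) (fibre L x) = 1) \<and>
     (\<forall>(U, l)\<in>frames L. openin (ztop X) U \<and> (\<forall>y\<in>U. l y \<in> fibre L y \<and> l y \<noteq> 0)) \<and>
     (\<Union>(U, l)\<in>frames L. U) = points X \<and>
     (\<forall>(U, l)\<in>frames L. \<forall>(V, m)\<in>frames L. sec_quot L m l \<in> reg X (U \<inter> V))"

definition regular_section ::
    "'a fspace \<Rightarrow> ('a, 'e::ab_group_add) lbundle \<Rightarrow> 'a set \<Rightarrow> ('a \<Rightarrow> 'e) \<Rightarrow> bool" where
  "regular_section X L U s \<longleftrightarrow>
     (\<forall>y\<in>U. s y \<in> fibre L y) \<and> (\<forall>(V, l)\<in>frames L. sec_quot L s l \<in> reg X (U \<inter> V))"

definition nonvanishing_near ::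
    "'a fspace \<Rightarrow> ('a, 'e::ab_group_add) lbundle \<Rightarrow> 'a \<Rightarrow> ('a \<Rightarrow> 'e) set" where
  "nonvanishing_near X L x = {l. \<exists>U. openin (ztop X) U \<and> x \<in> U \<and>
     regular_section X L U l \<and> (\<forall>y\<in>U. l y \<noteq> 0)}"

text \<open>
  Transversality of \<open>s\<close> to the zero section: in local trivialisations, the derivative of
  \<open>s\<close> at each zero is a surjective linear form on the tangent space.
\<close>

definition transverse_to_zero ::
    "'a fspace \<Rightarrow> ('a, 'e::ab_group_add) lbundle \<Rightarrow> ('a \<Rightarrow> 'e) \<Rightarrow> bool" where
  "transverse_to_zero X L s \<longleftrightarrow>
     (\<forall>x\<in>points X. s x = 0 \<longrightarrow>
        (\<forall>l\<in>nonvanishing_near X L x. \<exists>v\<in>tangent_space X x. v (sec_quot L s l) \<noteq> 0))"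


section \<open>Stalks and log-spaces\<close>

definition germ :: "'a fspace \<Rightarrow> 'a \<Rightarrow> ('a \<Rightarrow> complex) \<Rightarrow> ('a \<Rightarrow> complex) set" where
  "germ X x f = {g. \<exists>U. openin (ztop X) U \<and> x \<in> U \<and> (\<forall>y\<in>U. g y = f y)}"

definition germ_mult ::
    "'a fspace \<Rightarrow> 'a \<Rightarrow> ('a \<Rightarrow> complex) set \<Rightarrow> ('a \<Rightarrow> complex) set \<Rightarrow> ('a \<Rightarrow> complex) set" where
  "germ_mult X x a b = (\<Union>f\<in>a. \<Union>g\<in>b. germ X x (\<lambda>y. f y * g y))"

text \<open>The stalk of the structure sheaf as a multiplicative monoid.\<close>

definition stalk :: "'a fspace \<Rightarrow> 'a \<Rightarrow> ('a \<Rightarrow> complex) set monoid" where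
  "stalk X x =
     \<lparr>carrier = germ X x ` local_reg X x,
      monoid.mult = germ_mult X x,
      one = germ X x (\<lambda>_. 1)\<rparr>"

definition log_sheaf :: "'a fspace \<Rightarrow> 'a set \<Rightarrow> 'a set \<Rightarrow> ('a \<Rightarrow> complex) set" where
  "log_sheaf X D U = {g \<in> reg X U. \<exists>h\<in>reg X (U - D). \<forall>y\<in>U - D. g y * h y = 1}"

definition log_stalk :: "'a fspace \<Rightarrow> 'a set \<Rightarrow> 'a \<Rightarrow> ('a \<Rightarrow> complex) set monoid" where
  "log_stalk X D x =
     \<lparr>carrier = {germ X x g | U g. openin (ztop X) U \<and> x \<in> U \<and> g \<in> log_sheaf X D U},
      monoid.mult = germ_mult X x,
      one = germ X x (\<lambda>_. 1)\<rparr>"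

text \<open>Monoid homomorphisms, normalised outside the carrier so that equality is extensional.\<close>

definition mon_hom :: "'m monoid \<Rightarrow> 'n monoid \<Rightarrow> ('m \<Rightarrow> 'n) set" where
  "mon_hom A B = {h \<in> hom A B. h \<one>\<^bsub>A\<^esub> = \<one>\<^bsub>B\<^esub>} \<inter> extensional (carrier A)"

definition circle_monoid :: "complex monoid" where
  "circle_monoid = \<lparr>carrier = {z. cmod z = 1}, monoid.mult = (*), one = 1\<rparr>"

definition cstar_monoid :: "complex monoid" where
  "cstar_monoid = \<lparr>carrier = - {0}, monoid.mult = (*), one = 1\<rparr>"

definition pos_infinity_monoid :: "ennreal monoid" where
  "pos_infinity_monoid = \<lparr>carrier = {0<..}, monoid.mult = (*), one = 1\<rparr>"

definition log_space :: "'a fspace \<Rightarrow> 'a set \<Rightarrow> ('a \<times> (('a \<Rightarrow> complex) set \<Rightarrow> complex)) set" where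
  "log_space X D = {(x, \<phi>). x \<in> points X \<and> \<phi> \<in> mon_hom (log_stalk X D x) circle_monoid \<and>
     (\<forall>g. germ X x g \<in> Units (stalk X x) \<longrightarrow> \<phi> (germ X x g) = g x / complex_of_real (cmod (g x)))}"

definition clog_space :: "'a fspace \<Rightarrow> 'a set \<Rightarrow>
    ('a \<times> (('a \<Rightarrow> complex) set \<Rightarrow> complex) \<times> (('a \<Rightarrow> complex) set \<Rightarrow> ennreal)) set" where
  "clog_space X D = {(x, \<phi>, \<psi>). (x, \<phi>) \<in> log_space X D \<and>
     \<psi> \<in> mon_hom (log_stalk X D x) pos_infinity_monoid \<and>
     (\<forall>g. germ X x g \<in> Units (stalk X x) \<longrightarrow> \<psi> (germ X x g) = ennreal (cmod (g x)))}"

definition alog_space :: "'a fspace \<Rightarrow> 'a set \<Rightarrow> ('a \<times> (('a \<Rightarrow> complex) set \<Rightarrow> complex)) set" where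
  "alog_space X D = {(x, \<Phi>). x \<in> points X \<and> \<Phi> \<in> mon_hom (log_stalk X D x) cstar_monoid \<and>
     (\<forall>g. germ X x g \<in> Units (stalk X x) \<longrightarrow> \<Phi> (germ X x g) = g x)}"


section \<open>Geometric spaces\<close>

text \<open>
  \<open>ray L v r\<close> is the class of \<open>(v, r)\<close> modulo positive reals. The points of the fibre of
  \<open>S(L \<oplus> 1\<^sub>\<ge>\<^sub>0)\<close> at \<open>x\<close> are the classes with \<open>v \<in> fibre L x\<close>, \<open>r \<ge> 0\<close>, \<open>(v, r) \<noteq> (0, 0)\<close>.
  It contains \<open>L\<close>, via \<open>v \<mapsto> [(v, 1)]\<close> (\<open>fin_pt\<close>), and the circle bundle \<open>S(L)\<close> at infinity,
  via \<open>\<theta>(v) \<mapsto> [(v, 0)]\<close> (\<open>theta\<close>).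
\<close>

definition ray :: "('a, 'e) lbundle \<Rightarrow> 'e \<Rightarrow> real \<Rightarrow> ('e \<times> real) set" where
  "ray L v r = {(scal L (complex_of_real c) v, c * r) | c. 0 < c}"

definition fin_pt :: "('a, 'e) lbundle \<Rightarrow> 'e \<Rightarrow> ('e \<times> real) set" where
  "fin_pt L v = ray L v 1"

definition theta :: "('a, 'e) lbundle \<Rightarrow> 'e \<Rightarrow> ('e \<times> real) set" where
  "theta L v = ray L v 0"

definition lstar :: "('a, 'e::ab_group_add) lbundle \<Rightarrow> 'a \<Rightarrow> ('e \<times> real) set set" where
  "lstar L x = fin_pt L ` (fibre L x - {0})"

definition circle_bundle :: "('a, 'e::ab_group_add) lbundle \<Rightarrow> 'a \<Rightarrow> ('e \<times> real) set set" where
  "circle_bundle L x = theta L ` (fibre L x - {0})"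

definition top1 :: "'a fspace \<Rightarrow> ('a, 'e::ab_group_add) lbundle \<Rightarrow> ('a \<Rightarrow> 'e) \<Rightarrow> 'a set \<Rightarrow>
    ('a \<times> ('e \<times> real) set) set" where
  "top1 X L s H = {(x, q). x \<in> points X \<and> q \<in> circle_bundle L x \<and> (x \<notin> H \<longrightarrow> q = theta L (s x))}"

definition cpl1 :: "'a fspace \<Rightarrow> ('a, 'e::ab_group_add) lbundle \<Rightarrow> ('a \<Rightarrow> 'e) \<Rightarrow> 'a set \<Rightarrow>
    ('a \<times> ('e \<times> real) set) set" where
  "cpl1 X L s H = top1 X L s H \<union> (SIGMA x:H. lstar L x)"

definition mot1 :: "'a fspace \<Rightarrow> ('a, 'e::ab_group_add) lbundle \<Rightarrow> ('a \<Rightarrow> 'e) \<Rightarrow> 'a set \<Rightarrow>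
    ('a \<times> ('e \<times> real) set) set" where
  "mot1 X L s H = cpl1 X L s H - (SIGMA x:H. circle_bundle L x)"

definition fibre_product :: "'a fspace \<Rightarrow> 'i set \<Rightarrow> ('i \<Rightarrow> ('a \<times> 'q) set) \<Rightarrow> ('a \<times> ('i \<Rightarrow> 'q)) set" where
  "fibre_product X I E =
     {(x, \<eta>). x \<in> points X \<and> \<eta> \<in> extensional I \<and> (\<forall>i\<in>I. (x, \<eta> i) \<in> E i)}"

definition top_space where
  "top_space X I D L s = fibre_product X I (\<lambda>i. top1 X (L i) (s i) (D i))"

definition cpl_space where
  "cpl_space X I D L s = fibre_product X I (\<lambda>i. cpl1 X (L i) (s i) (D i))"

definition mot_space where
  "mot_space X I D L s = fibre_product X I (\<lambda>i. mot1 X (L i) (s i) (D i))"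


section \<open>The maps induced by the sections\<close>

text \<open>
  The component at \<open>i\<close> with \<open>x \<in> D\<^sub>i\<close> is described through a nonvanishing local section \<open>l\<close>
  of \<open>L\<^sub>i\<close> near \<open>x\<close>, but does not depend on it: \<open>indep_value\<close> picks the common value for all \<open>l\<close>.
\<close>

definition indep_value :: "'l set \<Rightarrow> ('l \<Rightarrow> 'q) \<Rightarrow> 'q" where
  "indep_value A F = (THE q. \<forall>l\<in>A. F l = q)"

definition induced_family :: "'a fspace \<Rightarrow> 'i set \<Rightarrow> ('i \<Rightarrow> 'a set) \<Rightarrow>
    ('i \<Rightarrow> ('a, 'e::ab_group_add) lbundle) \<Rightarrow> ('i \<Rightarrow> 'a \<Rightarrow> 'e) \<Rightarrow> 'a \<Rightarrow>
    ('i \<Rightarrow> ('a \<Rightarrow> 'e) \<Rightarrow> ('e \<times> real) set) \<Rightarrow> 'i \<Rightarrow> ('e \<times> real) set" where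
  "induced_family X I D L s x F =
     (\<lambda>i\<in>I. if x \<in> D i then indep_value (nonvanishing_near X (L i) x) (F i)
             else theta (L i) (s i x))"

definition alog_to_mot where
  "alog_to_mot X I D L s = (\<lambda>(x, \<Phi>). (x, induced_family X I D L s x
     (\<lambda>i l. fin_pt (L i) (scal (L i) (\<Phi> (germ X x (sec_quot (L i) (s i) l))) (l x)))))"

definition log_to_top where
  "log_to_top X I D L s = (\<lambda>(x, \<phi>). (x, induced_family X I D L s x
     (\<lambda>i l. theta (L i) (scal (L i) (\<phi> (germ X x (sec_quot (L i) (s i) l))) (l x)))))"

definition clog_to_cpl where
  "clog_to_cpl X I D L s = (\<lambda>(x, \<phi>, \<psi>). (x, induced_family X I D L s x
     (\<lambda>i l. let t = germ X x (sec_quot (L i) (s i) l) in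
        if \<psi> t < \<infinity>
        then fin_pt (L i) (scal (L i) (complex_of_real (enn2real (\<psi> t)) * \<phi> t) (l x))
        else theta (L i) (scal (L i) (\<phi> t) (l x)))))"

end

theory Submission
  imports Defs "HOL-Library.Function_Algebras" "HOL-Computational_Algebra.Fundamental_Theorem_Algebra"
begin

text \<open>
  Near a point \<open>x\<close> the quotients \<open>t\<^sub>i = s\<^sub>i / l\<^sub>i\<close> for \<open>i \<in> J(x)\<close> are pairwise non-associated prime
  elements of the local ring, because the tangent cone of a locus with independent
  differentials is a linear space. A germ \<open>g\<close> that is invertible off \<open>D\<close> divides a power of
  \<open>\<Prod> t\<^sub>i\<close> by the Nullstellensatz, so it is a unit times a unique monomial in the \<open>t\<^sub>i\<close>: the stalk of the
  log sheaf is the product of the units and the free commutative monoid on the \<open>t\<^sub>i\<close>. Hence a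
  homomorphism prescribed on the units amounts to an arbitrary choice of the values at the \<open>t\<^sub>i\<close>,
  and these values are the fibre coordinates on the geometric side.
\<close>

section \<open>Noetherian rings of functions\<close>

text \<open>Regular functions are functions on points, so an identity of germs only says that some
  polynomial vanishes at the points of \<open>X\<close> near \<open>x\<close>. The Nullstellensatz
  turns this into membership in the localised ideal of the equations \<open>F\<close> of
  \<open>X\<close>, provided that ideal is radical, and radicality comes from primeness. That
  \<open>t i\<close> is prime and that the local ring has no zero divisors are instances of one
  theorem, \<open>local_gen_ideal_prime\<close>: if \<open>P\<close> is a numerator of
  \<open>t i\<close>, the list \<open>F\<close> extended by \<open>P\<close> again has independent
  differentials.

  In that theorem every element outside the localised ideal needs an initial form, so it must not
  have arbitrarily high order modulo the ideal; this is Krull's intersection theorem. In place of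
  power series solutions, Newton iteration gives polynomial arcs that satisfy the equations to an
  order beyond the sum of the degrees of two initial forms. The Nullstellensatz rests on the
  uncountability of the complex numbers, Krull's theorem on Hilbert's basis theorem.\<close>

definition is_ideal :: "'r::comm_ring_1 set \<Rightarrow> 'r set \<Rightarrow> bool" where
  "is_ideal R K \<longleftrightarrow> K \<subseteq> R \<and> 0 \<in> K \<and> (\<forall>a\<in>K. \<forall>b\<in>K. a + b \<in> K) \<and> (\<forall>r\<in>R. \<forall>a\<in>K. r * a \<in> K)"

text \<open>Rings are subsets of an ambient commutative ring, later the ring of all functions
  \<open>(nat \<Rightarrow> complex) \<Rightarrow> complex\<close> with pointwise
  operations.\<close>

definition is_subring :: "'r::comm_ring_1 set \<Rightarrow> bool" where
  "is_subring R \<longleftrightarrow> 1 \<in> R \<and> (\<forall>a\<in>R. \<forall>b\<in>R. a - b \<in> R \<and> a * b \<in> R)"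

text \<open>Finite generation is expressed through minimality, without linear combinations.
  \<open>hilbert_basis\<close> profits from this form: it compares \<open>K\<close> with an
  arbitrary ideal that contains the candidate generators.\<close>

definition noetherian :: "'r::comm_ring_1 set \<Rightarrow> bool" where
  "noetherian R \<longleftrightarrow> is_subring R \<and>
     (\<forall>K. is_ideal R K \<longrightarrow> (\<exists>G\<subseteq>K. finite G \<and> (\<forall>J. is_ideal R J \<and> G \<subseteq> J \<longrightarrow> K \<subseteq> J)))"

lemma is_subringD:
  assumes "is_subring R"
  shows "1 \<in> R" "0 \<in> R" "a \<in> R \<Longrightarrow> - a \<in> R"
    "a \<in> R \<Longrightarrow> b \<in> R \<Longrightarrow> a + b \<in> R" "a \<in> R \<Longrightarrow> b \<in> R \<Longrightarrow> a - b \<in> R"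
    "a \<in> R \<Longrightarrow> b \<in> R \<Longrightarrow> a * b \<in> R" "a \<in> R \<Longrightarrow> a ^ n \<in> R"
proof -
  show 1: "1 \<in> R" using assms by (auto simp: is_subring_def)
  show D: "a \<in> R \<Longrightarrow> b \<in> R \<Longrightarrow> a - b \<in> R" for a b
    using assms by (auto simp: is_subring_def)
  show M: "a \<in> R \<Longrightarrow> b \<in> R \<Longrightarrow> a * b \<in> R" for a b
    using assms by (auto simp: is_subring_def)
  show 0: "0 \<in> R" using D[OF 1 1] by simp
  show N: "a \<in> R \<Longrightarrow> - a \<in> R" for a using D[OF 0, of a] by simp
  show "a \<in> R \<Longrightarrow> b \<in> R \<Longrightarrow> a + b \<in> R" using D[OF _ N, of a b] by simp
  show "a \<in> R \<Longrightarrow> a ^ n \<in> R" by (induction n) (auto intro: 1 M)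
qed

lemma is_idealD:
  assumes "is_ideal R K"
  shows "a \<in> K \<Longrightarrow> a \<in> R" "0 \<in> K" "a \<in> K \<Longrightarrow> b \<in> K \<Longrightarrow> a + b \<in> K"
    "r \<in> R \<Longrightarrow> a \<in> K \<Longrightarrow> r * a \<in> K" "r \<in> R \<Longrightarrow> a \<in> K \<Longrightarrow> a * r \<in> K"
  using assms by (auto simp: is_ideal_def mult.commute)

lemma is_ideal_minus:
  assumes "is_subring R" "is_ideal R K"
  shows "a \<in> K \<Longrightarrow> - a \<in> K" "a \<in> K \<Longrightarrow> b \<in> K \<Longrightarrow> a - b \<in> K"
proof -
  show *: "a \<in> K \<Longrightarrow> - a \<in> K" for a
    using is_idealD(4)[OF assms(2), of "-1" a] is_subringD(1,3)[OF assms(1)] by simp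
  show "a \<in> K \<Longrightarrow> b \<in> K \<Longrightarrow> a - b \<in> K"
    using is_idealD(3)[OF assms(2), of a "-b"] * by simp
qed

lemma is_ideal_sum:
  assumes "is_ideal R K" "\<And>i. i \<in> S \<Longrightarrow> f i \<in> K"
  shows "sum f S \<in> K"
  using assms(2) by (induction S rule: infinite_finite_induct) (auto intro: is_idealD[OF assms(1)])

lemma is_subring_sum:
  assumes "is_subring R" "\<And>i. i \<in> S \<Longrightarrow> f i \<in> R"
  shows "sum f S \<in> R"
  using assms(2) by (induction S rule: infinite_finite_induct) (auto intro: is_subringD[OF assms(1)])

lemma is_ideal_add_principal:
  assumes "is_subring R" "is_ideal R K" "a \<in> R"
  shows "is_ideal R {k + r * a |k r. k \<in> K \<and> r \<in> R}" (is "is_ideal R ?L")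
proof -
  note R = is_subringD[OF assms(1)] and K = is_idealD[OF assms(2)]
  have I: "k + r * a \<in> ?L" if "k \<in> K" "r \<in> R" for k r using that by blast
  show ?thesis unfolding is_ideal_def
  proof (intro conjI ballI subsetI)
    show "u \<in> R" if "u \<in> ?L" for u using that assms(3) by (auto intro!: R(4,6) intro: K(1))
    show "0 \<in> ?L" using I[OF K(2) R(2)] by simp
    show "u + v \<in> ?L" if uv: "u \<in> ?L" "v \<in> ?L" for u v
    proof -
      obtain k r k' r' where *: "u = k + r * a" "k \<in> K" "r \<in> R" "v = k' + r' * a" "k' \<in> K" "r' \<in> R"
        using uv by blast
      have "u + v = (k + k') + (r + r') * a" by (simp add: * algebra_simps)
      then show ?thesis using I[OF K(3)[OF *(2,5)] R(4)[OF *(3,6)]] by simp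
    qed
    show "w * u \<in> ?L" if wu: "w \<in> R" "u \<in> ?L" for w u
    proof -
      obtain k r where *: "u = k + r * a" "k \<in> K" "r \<in> R" using wu by blast
      have "w * u = w * k + (w * r) * a" by (simp add: * algebra_simps)
      then show ?thesis using I[OF K(4)[OF wu(1) *(2)] R(6)[OF wu(1) *(3)]] by simp
    qed
  qed
qed

lemma is_ideal_Union_chain:
  assumes "\<C> \<noteq> {}" "\<And>K. K \<in> \<C> \<Longrightarrow> is_ideal R K"
    and "\<And>K L. K \<in> \<C> \<Longrightarrow> L \<in> \<C> \<Longrightarrow> K \<subseteq> L \<or> L \<subseteq> K"
  shows "is_ideal R (\<Union>\<C>)"
  unfolding is_ideal_def
proof (intro conjI ballI)
  show "\<Union>\<C> \<subseteq> R" using assms(2) unfolding is_ideal_def by blast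
  show "0 \<in> \<Union>\<C>" using assms(1,2) by (auto simp: is_ideal_def)
  show "a + b \<in> \<Union>\<C>" if ab: "a \<in> \<Union>\<C>" "b \<in> \<Union>\<C>" for a b
  proof -
    obtain K L where KL: "a \<in> K" "K \<in> \<C>" "b \<in> L" "L \<in> \<C>" using ab by blast
    then obtain M where "a \<in> M" "b \<in> M" "M \<in> \<C>" using assms(3)[of K L] by blast
    then show ?thesis using assms(2)[of M] by (auto simp: is_ideal_def)
  qed
  show "r * a \<in> \<Union>\<C>" if "r \<in> R" "a \<in> \<Union>\<C>" for r a
    using that assms(2) by (fastforce simp: is_ideal_def)
qed

text \<open>Zorn's lemma, for two choices of \<open>S\<close>. In \<open>nullstellensatz\<close> it
  consists of the powers of a polynomial, and \<open>M\<close> turns out to be prime; in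
  \<open>krull_intersection\<close> it is a single element, and \<open>M\<close> turns out to
  contain a power of the maximal ideal of the point.\<close>

lemma maximal_ideal_avoiding:
  assumes K: "is_ideal R K" "K \<inter> S = {}"
  obtains M where "is_ideal R M" "K \<subseteq> M" "M \<inter> S = {}"
    and "\<And>L. is_ideal R L \<Longrightarrow> M \<subseteq> L \<Longrightarrow> L \<inter> S = {} \<Longrightarrow> L = M"
proof -
  let ?A = "{L. is_ideal R L \<and> K \<subseteq> L \<and> L \<inter> S = {}}"
  have "\<exists>M\<in>?A. \<forall>X\<in>?A. M \<subseteq> X \<longrightarrow> X = M"
  proof (rule subset_Zorn_nonempty)
    show "?A \<noteq> {}" using K by auto
    fix \<C> assume \<C>: "\<C> \<noteq> {}" "subset.chain ?A \<C>"
    have "is_ideal R (\<Union>\<C>)"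
      by (rule is_ideal_Union_chain) (use \<C> in \<open>auto simp: subset_chain_def\<close>)
    moreover have "K \<subseteq> \<Union>\<C>" "\<Union>\<C> \<inter> S = {}"
      using \<C> unfolding subset_chain_def by blast+
    ultimately show "\<Union>\<C> \<in> ?A" by simp
  qed
  then obtain M where M: "M \<in> ?A" and max: "\<forall>X\<in>?A. M \<subseteq> X \<longrightarrow> X = M" by (rule bexE)
  show thesis
  proof (rule that[of M])
    show "is_ideal R M" "K \<subseteq> M" "M \<inter> S = {}" using M by simp_all
    fix L assume L: "is_ideal R L" "M \<subseteq> L" "L \<inter> S = {}"
    then have "L \<in> ?A" using M by auto
    then show "L = M" using max L(2) by simp
  qed
qed

lemma noetherian_chain_stable:
  assumes "noetherian R" and K: "\<And>n. is_ideal R (K n)" "\<And>n. K n \<subseteq> K (Suc n)"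
  obtains d :: nat where "\<And>n. K n \<subseteq> K d"
proof -
  have mono: "K m \<subseteq> K n" if "m \<le> n" for m n
    using lift_Suc_mono_le[of K, OF K(2) that] .
  have "is_ideal R (\<Union>(range K))"
    by (rule is_ideal_Union_chain) (use K mono nat_le_linear in \<open>auto, blast\<close>)
  then obtain G where G: "G \<subseteq> \<Union>(range K)" "finite G"
    "\<And>J. is_ideal R J \<Longrightarrow> G \<subseteq> J \<Longrightarrow> \<Union>(range K) \<subseteq> J"
    using assms(1) unfolding noetherian_def by metis
  obtain f where f: "\<And>g. g \<in> G \<Longrightarrow> g \<in> K (f g)" using G(1) by (metis UN_E subsetD)
  \<comment> \<open>The inserted \<open>0\<close> keeps the maximum defined when \<open>G\<close> is
    empty.\<close>
  have "G \<subseteq> K (Max (insert 0 (f ` G)))"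
  proof
    fix g assume g: "g \<in> G"
    then have "f g \<le> Max (insert 0 (f ` G))" using G(2) by (intro Max_ge) auto
    then show "g \<in> K (Max (insert 0 (f ` G)))" using f[OF g] mono by blast
  qed
  then have "\<Union>(range K) \<subseteq> K (Max (insert 0 (f ` G)))" using G(3) K(1) by blast
  then show thesis using that by blast
qed

text \<open>Here \<open>x\<close> is an element of the ambient ring and not an indeterminate, so an
  element may have several expressions as a polynomial in \<open>x\<close>. The bound
  \<open>d\<close> takes the place of a degree.\<close>

primrec polys_below :: "'r::comm_ring_1 set \<Rightarrow> 'r \<Rightarrow> nat \<Rightarrow> 'r set" where
  "polys_below A x 0 = {0}"
| "polys_below A x (Suc d) = {a * x ^ d + b |a b. a \<in> A \<and> b \<in> polys_below A x d}"

lemma polys_below_Suc_mono: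
  assumes "is_subring A" "b \<in> polys_below A x d"
  shows "b \<in> polys_below A x (Suc d)"
proof -
  have "0 * x ^ d + b \<in> polys_below A x (Suc d)"
    unfolding polys_below.simps(2)
    by (intro CollectI exI[of _ 0] exI[of _ b] conjI refl assms(2) is_subringD(2)[OF assms(1)])
  then show ?thesis by (simp only: mult_zero_left add_0_left)
qed

lemma polys_below_mono:
  assumes "is_subring A" "d \<le> e"
  shows "polys_below A x d \<subseteq> polys_below A x e"
  by (rule lift_Suc_mono_le[OF _ assms(2)]) (use polys_below_Suc_mono[OF assms(1)] in blast)

lemma polys_below_add:
  assumes A: "is_subring A"
  shows "b \<in> polys_below A x d \<Longrightarrow> c \<in> polys_below A x d \<Longrightarrow> b + c \<in> polys_below A x d"
proof (induction d arbitrary: b c)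
  case (Suc d)
  then obtain a b' a' c' where *: "b = a * x ^ d + b'" "c = a' * x ^ d + c'" "a \<in> A" "a' \<in> A"
    "b' \<in> polys_below A x d" "c' \<in> polys_below A x d" by auto
  have "b + c = (a + a') * x ^ d + (b' + c')" by (simp add: * algebra_simps)
  then show ?case using Suc.IH[OF *(5,6)] is_subringD(4)[OF A *(3,4)] by auto
qed simp

lemma polys_below_scale:
  assumes A: "is_subring A" and "r \<in> A"
  shows "b \<in> polys_below A x d \<Longrightarrow> r * b \<in> polys_below A x d"
proof (induction d arbitrary: b)
  case (Suc d)
  then obtain a b' where *: "b = a * x ^ d + b'" "a \<in> A" "b' \<in> polys_below A x d" by auto
  have "r * b = (r * a) * x ^ d + r * b'" by (simp add: * algebra_simps)
  then show ?case using Suc.IH[OF *(3)] is_subringD(6)[OF A assms(2) *(2)] by auto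
qed simp

lemma polys_below_shift:
  assumes A: "is_subring A"
  shows "b \<in> polys_below A x d \<Longrightarrow> x * b \<in> polys_below A x (Suc d)"
proof (induction d arbitrary: b)
  case 0
  then show ?case using is_subringD(2)[OF A] by auto
next
  case (Suc d)
  then obtain a b' where *: "b = a * x ^ d + b'" "a \<in> A" "b' \<in> polys_below A x d" by auto
  have "x * b = a * x ^ Suc d + x * b'" by (simp add: * algebra_simps)
  then show ?case using Suc.IH[OF *(3)] *(2) by (simp del: power_Suc) blast
qed

lemma polys_below_gen: "is_subring A \<Longrightarrow> x \<in> polys_below A x (Suc (Suc 0))"
proof -
  assume A: "is_subring A"
  have "1 * x ^ 0 + 0 \<in> polys_below A x (Suc 0)"
    unfolding polys_below.simps
    by (intro CollectI exI[of _ 1] exI[of _ 0] conjI refl singletonI is_subringD(1)[OF A])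
  then have "x * (1 * x ^ 0 + 0) \<in> polys_below A x (Suc (Suc 0))" by (rule polys_below_shift[OF A])
  then show ?thesis by (simp only: power_0 mult_1 add_0_right mult_1_right)
qed

lemma polys_below_shift_pow:
  assumes A: "is_subring A" and "b \<in> polys_below A x d"
  shows "x ^ n * b \<in> polys_below A x (d + n)"
  by (induction n) (use assms polys_below_shift[OF A] in \<open>auto simp: mult.assoc simp del: polys_below.simps\<close>)

lemma polys_below_mult:
  assumes A: "is_subring A" 
  shows "b \<in> polys_below A x d \<Longrightarrow> c \<in> polys_below A x e \<Longrightarrow> \<exists>k. b * c \<in> polys_below A x k"
proof (induction d arbitrary: b)
  case 0
  then show ?case by (auto intro!: exI[of _ 0])
next
  case (Suc d)
  then obtain a b' where *: "b = a * x ^ d + b'" "a \<in> A" "b' \<in> polys_below A x d" by auto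
  obtain k where k: "b' * c \<in> polys_below A x k" using Suc.IH[OF *(3) Suc.prems(2)] by blast
  have "a * (x ^ d * c) \<in> polys_below A x (e + d)"
    by (rule polys_below_scale[OF A *(2)], rule polys_below_shift_pow[OF A Suc.prems(2)])
  then have "a * (x ^ d * c) + b' * c \<in> polys_below A x (max (e + d) k)"
    using polys_below_add[OF A] polys_below_mono[OF A] k max.cobounded1 max.cobounded2 by blast
  moreover have "b * c = a * (x ^ d * c) + b' * c" by (simp add: * algebra_simps)
  ultimately show ?case by auto
qed

text \<open>Hilbert's argument with leading coefficients. As expressions are not unique,
  \<open>lead J d\<close> collects every \<open>a\<close> that is the coefficient of
  \<open>x ^ d\<close> in some expression of an element of \<open>J\<close>. The ideals
  \<open>lead K d\<close> of \<open>A\<close> grow with \<open>d\<close> and are stationary from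
  some \<open>D\<close> on; finitely many elements of \<open>K\<close> that realise generators of
  \<open>lead K d\<close> for \<open>d \<le> D\<close> generate \<open>K\<close>.\<close>

lemma hilbert_basis:
  fixes A :: "'r::comm_ring_1 set"
  assumes A: "noetherian A"
  shows "noetherian (\<Union>d. polys_below A x d)" (is "noetherian ?B")
proof -
  have sA: "is_subring A" using A by (simp add: noetherian_def)
  note AR = is_subringD[OF sA]
  note mono = subsetD[OF polys_below_mono[OF sA]]
  have AB: "A \<subseteq> ?B"
  proof
    fix a assume "a \<in> A"
    then have "a \<in> polys_below A x (Suc 0)" by auto
    then show "a \<in> ?B" by blast
  qed
  have xB: "x \<in> ?B" by (rule UN_I, rule UNIV_I, rule polys_below_gen[OF sA])
  have sB: "is_subring ?B" unfolding is_subring_def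
  proof (intro conjI ballI)
    show "1 \<in> ?B" using AB AR(1) by blast
    fix b c assume "b \<in> ?B" "c \<in> ?B"
    then obtain d e where de: "b \<in> polys_below A x d" "c \<in> polys_below A x e" by blast
    show "b * c \<in> ?B" using polys_below_mult[OF sA de] by (auto simp del: polys_below.simps)
    have "- 1 * c \<in> polys_below A x e" using polys_below_scale[OF sA AR(3)[OF AR(1)] de(2)] .
    then have "b + - 1 * c \<in> polys_below A x (max d e)"
      by (intro polys_below_add[OF sA] mono[OF max.cobounded1 de(1)] mono[OF max.cobounded2])
    then show "b - c \<in> ?B" by (auto simp del: polys_below.simps)
  qed
  have "\<exists>G\<subseteq>K. finite G \<and> (\<forall>J. is_ideal ?B J \<and> G \<subseteq> J \<longrightarrow> K \<subseteq> J)" if K: "is_ideal ?B K" for K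
  proof -
    define lead where "lead J d = {a \<in> A. \<exists>b\<in>polys_below A x d. a * x ^ d + b \<in> J}" for J d
    have lead_ideal: "is_ideal A (lead J d)" if J: "is_ideal ?B J" for J d
      unfolding is_ideal_def
    proof (intro conjI ballI)
      note JD = is_idealD[OF J]
      show "lead J d \<subseteq> A" by (auto simp: lead_def)
      have "0 \<in> polys_below A x d" using mono[of 0 d 0] by simp
      then show "0 \<in> lead J d" using JD(2) AR(2) by (auto simp: lead_def)
      fix a assume "a \<in> lead J d"
      then obtain b where b: "a \<in> A" "b \<in> polys_below A x d" "a * x ^ d + b \<in> J"
        by (auto simp: lead_def)
      { fix a' assume "a' \<in> lead J d"
        then obtain b' where b': "a' \<in> A" "b' \<in> polys_below A x d" "a' * x ^ d + b' \<in> J"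
          by (auto simp: lead_def)
        have "(a + a') * x ^ d + (b + b') \<in> J"
          using JD(3)[OF b(3) b'(3)] by (simp add: algebra_simps)
        then show "a + a' \<in> lead J d"
          using AR(4)[OF b(1) b'(1)] polys_below_add[OF sA b(2) b'(2)] by (auto simp: lead_def) }
    next
      note JD = is_idealD[OF J]
      fix r a assume r: "r \<in> A" and "a \<in> lead J d"
      then obtain b where b: "a \<in> A" "b \<in> polys_below A x d" "a * x ^ d + b \<in> J"
        by (auto simp: lead_def)
      have "(r * a) * x ^ d + r * b \<in> J"
        using JD(4)[OF _ b(3), of r] r AB by (auto simp: algebra_simps)
      then show "r * a \<in> lead J d"
        using AR(6)[OF r b(1)] polys_below_scale[OF sA r b(2)] by (auto simp: lead_def)
    qed
    have lead_Suc: "lead J d \<subseteq> lead J (Suc d)" if J: "is_ideal ?B J" for J d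
    proof
      fix a assume "a \<in> lead J d"
      then obtain b where b: "a \<in> A" "b \<in> polys_below A x d" "a * x ^ d + b \<in> J"
        by (auto simp: lead_def)
      have "a * x ^ Suc d + x * b \<in> J"
        using is_idealD(4)[OF J xB b(3)] by (simp add: algebra_simps)
      then show "a \<in> lead J (Suc d)" using b polys_below_shift[OF sA b(2)] by (auto simp: lead_def)
    qed
    obtain D where D: "\<And>n. lead K n \<subseteq> lead K D"
      using noetherian_chain_stable[of A "lead K"] A lead_ideal[OF K] lead_Suc[OF K] by blast
    have "\<exists>G. finite G \<and> G \<subseteq> lead K d \<and> (\<forall>J. is_ideal A J \<and> G \<subseteq> J \<longrightarrow> lead K d \<subseteq> J)" for d
      using A lead_ideal[OF K, of d] unfolding noetherian_def by meson
    then obtain G where G: "\<And>d. finite (G d)" "\<And>d. G d \<subseteq> lead K d"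
      "\<And>d J. is_ideal A J \<Longrightarrow> G d \<subseteq> J \<Longrightarrow> lead K d \<subseteq> J" by metis
    have "\<exists>h. h \<in> K \<and> (\<exists>b\<in>polys_below A x d. h = g * x ^ d + b)" if gG: "g \<in> G d" for g d
    proof -
      obtain b where "b \<in> polys_below A x d" "g * x ^ d + b \<in> K"
        using subsetD[OF G(2) gG] by (auto simp: lead_def)
      then show ?thesis by blast
    qed
    then obtain h where h: "\<And>g d. g \<in> G d \<Longrightarrow> h g d \<in> K"
      "\<And>g d. g \<in> G d \<Longrightarrow> \<exists>b\<in>polys_below A x d. h g d = g * x ^ d + b" by metis
    define H where "H = (\<Union>d\<le>D. (\<lambda>g. h g d) ` G d)"
    have "K \<subseteq> J" if J: "is_ideal ?B J" "H \<subseteq> J" for J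
    proof -
      \<comment> \<open>Leading coefficients are realised in \<open>K \<inter> J\<close> and not
        just in \<open>J\<close>: subtracting such an element from an element of \<open>K\<close>
        lowers the bound without leaving \<open>K\<close>, so the induction below can
        continue.\<close>
      have KJ: "is_ideal ?B (K \<inter> J)" using K J(1) unfolding is_ideal_def by auto
      have small: "lead K d \<subseteq> lead (K \<inter> J) d" if "d \<le> D" for d
      proof (rule G(3)[OF lead_ideal[OF KJ]], rule subsetI)
        fix g assume g: "g \<in> G d"
        then have "h g d \<in> K \<inter> J" using h(1) J(2) that unfolding H_def by blast
        then show "g \<in> lead (K \<inter> J) d"
          using h(2)[OF g] G(2)[of d] g by (auto simp: lead_def)
      qed
      have big: "lead (K \<inter> J) D \<subseteq> lead (K \<inter> J) d" if "D \<le> d" for d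
        using lift_Suc_mono_le[of "lead (K \<inter> J)", OF lead_Suc[OF KJ] that] .
      have lead_sub: "lead K d \<subseteq> lead (K \<inter> J) d" for d
        using small[of d] small[of D] big[of d] D[of d] by (cases "d \<le> D") auto
      have "b \<in> K \<longrightarrow> b \<in> J" if "b \<in> polys_below A x d" for b d
        using that
      proof (induction d arbitrary: b)
        case 0
        then show ?case using is_idealD(2)[OF J(1)] by simp
      next
        case (Suc d)
        show ?case
        proof
          assume bK: "b \<in> K"
          obtain a b' where b: "b = a * x ^ d + b'" "a \<in> A" "b' \<in> polys_below A x d"
            using Suc.prems by auto
          then have "a \<in> lead K d" using bK by (auto simp: lead_def)
          then obtain c where c: "c \<in> polys_below A x d" "a * x ^ d + c \<in> K" "a * x ^ d + c \<in> J"
            using lead_sub[of d] by (auto simp: lead_def)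
          have "b' + (- 1) * c \<in> polys_below A x d"
            by (intro polys_below_add[OF sA] polys_below_scale[OF sA] b(3) c(1) AR(1,3))
          moreover have "b' + (- 1) * c = b - (a * x ^ d + c)" by (simp add: b)
          ultimately have "b - (a * x ^ d + c) \<in> polys_below A x d" by (simp only:)
          then have "b - (a * x ^ d + c) \<in> J"
            using Suc.IH is_ideal_minus(2)[OF sB K bK c(2)] by blast
          then show "b \<in> J" using is_idealD(3)[OF J(1) _ c(3), of "b - (a * x ^ d + c)"] by simp
        qed
      qed
      then show ?thesis using is_idealD(1)[OF K] by blast
    qed
    moreover have "finite H" "H \<subseteq> K" using G(1) h(1) by (auto simp: H_def)
    ultimately show ?thesis by blast
  qed
  then show ?thesis using sB by (simp add: noetherian_def)
qed

section \<open>The ring of polynomial functions in finitely many variables\<close>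

lemma sum_fun_apply: "sum f S z = (\<Sum>i\<in>S. f i z)"
  by (induction S rule: infinite_finite_induct) auto

lemma power_fun_apply: "(f ^ n) z = f z ^ n"
  by (induction n) auto

lemma poly_fun_algebra:
  shows "f \<in> poly_fun N \<Longrightarrow> g \<in> poly_fun N \<Longrightarrow> f + g \<in> poly_fun N"
    "f \<in> poly_fun N \<Longrightarrow> g \<in> poly_fun N \<Longrightarrow> f * g \<in> poly_fun N"
    "f \<in> poly_fun N \<Longrightarrow> g \<in> poly_fun N \<Longrightarrow> f - g \<in> poly_fun N"
    "f \<in> poly_fun N \<Longrightarrow> - f \<in> poly_fun N" "1 \<in> poly_fun N" "0 \<in> poly_fun N"
proof -
  show A: "f \<in> poly_fun N \<Longrightarrow> g \<in> poly_fun N \<Longrightarrow> f + g \<in> poly_fun N" for f g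
    using poly_fun.add[of f N g] by (simp add: plus_fun_def)
  show "f \<in> poly_fun N \<Longrightarrow> g \<in> poly_fun N \<Longrightarrow> f * g \<in> poly_fun N"
    using poly_fun.mult[of f N g] by (simp add: times_fun_def)
  show M: "f \<in> poly_fun N \<Longrightarrow> - f \<in> poly_fun N" for f
    using poly_fun.mult[OF poly_fun.const[of "-1"], of f N] by (simp add: fun_Compl_def)
  show "f \<in> poly_fun N \<Longrightarrow> g \<in> poly_fun N \<Longrightarrow> f - g \<in> poly_fun N"
    using A[OF _ M, of f g] by simp
  show "1 \<in> poly_fun N" "0 \<in> poly_fun N"
    by (simp_all add: one_fun_def zero_fun_def poly_fun.const)
qed

lemma is_subring_poly_fun: "is_subring (poly_fun N)"
  by (simp add: is_subring_def poly_fun_algebra)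

lemma poly_fun_mono: "f \<in> poly_fun N \<Longrightarrow> N \<le> M \<Longrightarrow> f \<in> poly_fun M"
  by (induction rule: poly_fun.induct) (auto intro: poly_fun.intros)

text \<open>Adjoining the coordinate with index \<open>N\<close> in the sense of
  \<open>polys_below\<close>; this makes \<open>hilbert_basis\<close> the induction step of
  \<open>noetherian_poly_fun\<close>.\<close>

lemma poly_fun_Suc: "poly_fun (Suc N) = (\<Union>d. polys_below (poly_fun N) (\<lambda>z. z N) d)"
proof (intro equalityI subsetI)
  note s = is_subring_poly_fun[of N]
  let ?B = "polys_below (poly_fun N) (\<lambda>z. z N)"
  have base: "f \<in> (\<Union>d. ?B d)" if "f \<in> poly_fun N" for f
  proof -
    have "f \<in> ?B (Suc 0)" using that by auto
    then show ?thesis by blast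
  qed
  fix f :: "(nat \<Rightarrow> complex) \<Rightarrow> complex" assume "f \<in> poly_fun (Suc N)"
  then show "f \<in> (\<Union>d. ?B d)"
  proof (induction rule: poly_fun.induct)
    case (const c)
    then show ?case by (intro base poly_fun.const)
  next
    case (coord k)
    show ?case
    proof (cases "k = N")
      case True
      show ?thesis unfolding True by (rule UN_I, rule UNIV_I, rule polys_below_gen[OF s])
    next
      case False
      then show ?thesis using coord by (intro base poly_fun.coord) simp
    qed
  next
    case (add f g)
    then obtain d e where "f \<in> ?B d" "g \<in> ?B e" by blast
    then have "f \<in> ?B (max d e)" "g \<in> ?B (max d e)"
      using polys_below_mono[OF s max.cobounded1] polys_below_mono[OF s max.cobounded2] by blast+
    then have "f + g \<in> ?B (max d e)" by (rule polys_below_add[OF s])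
    then show ?case unfolding plus_fun_def by (rule UN_I[OF UNIV_I])
  next
    case (mult f g)
    then obtain d e where "f \<in> ?B d" "g \<in> ?B e" by blast
    then obtain k where "f * g \<in> ?B k" using polys_below_mult[OF s] by blast
    then show ?case unfolding times_fun_def by (rule UN_I[OF UNIV_I])
  qed
next
  fix f :: "(nat \<Rightarrow> complex) \<Rightarrow> complex"
  have "f \<in> polys_below (poly_fun N) (\<lambda>z. z N) d \<Longrightarrow> f \<in> poly_fun (Suc N)" for d
  proof (induction d arbitrary: f)
    case (Suc d)
    have "(\<lambda>z. z N) ^ d \<in> poly_fun (Suc N)"
      by (intro is_subringD(7)[OF is_subring_poly_fun] poly_fun.coord) simp
    then show ?case using Suc by (auto intro!: poly_fun_algebra intro: poly_fun_mono)
  qed (simp add: poly_fun_algebra)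
  then show "f \<in> (\<Union>d. polys_below (poly_fun N) (\<lambda>z. z N) d) \<Longrightarrow> f \<in> poly_fun (Suc N)" by blast
qed

lemma poly_fun_0: "f \<in> poly_fun 0 \<Longrightarrow> \<exists>c. f = (\<lambda>z. c)"
  by (induction rule: poly_fun.induct) auto

lemma noetherian_poly_fun: "noetherian (poly_fun N)"
proof (induction N)
  case 0
  have "\<exists>G\<subseteq>K. finite G \<and> (\<forall>J. is_ideal (poly_fun 0) J \<and> G \<subseteq> J \<longrightarrow> K \<subseteq> J)"
    if K: "is_ideal (poly_fun 0) K" for K
  proof (cases "K = {0}")
    case True
    then show ?thesis by (intro exI[of _ "{0}"]) auto
  next
    case False
    then obtain g where g: "g \<in> K" "g \<noteq> 0" using is_idealD(2)[OF K] by blast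
    then obtain c where c: "g = (\<lambda>z. c)" using is_idealD(1)[OF K] poly_fun_0 by blast
    then have "c \<noteq> 0" using g(2) by (auto simp: zero_fun_def)
    have "K \<subseteq> J" if J: "is_ideal (poly_fun 0) J" "g \<in> J" for J
    proof
      fix f assume "f \<in> K"
      then have "(f * (\<lambda>z. 1 / c)) * g \<in> J"
        using is_idealD(1)[OF K] by (intro is_idealD(4)[OF J(1)] J(2) poly_fun_algebra poly_fun.const)
      moreover have "(f * (\<lambda>z. 1 / c)) * g = f" using \<open>c \<noteq> 0\<close> by (auto simp: c fun_eq_iff)
      ultimately show "f \<in> J" by simp
    qed
    then show ?thesis using g(1) by (intro exI[of _ "{g}"]) auto
  qed
  then show ?case by (simp add: noetherian_def is_subring_poly_fun)
next
  case (Suc N)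
  then show ?case unfolding poly_fun_Suc by (rule hilbert_basis)
qed

section \<open>Nullstellensatz\<close>

lemma poly_fun_const_diff: "f \<in> poly_fun N \<Longrightarrow> f - (\<lambda>z. c) \<in> poly_fun N"
  by (intro poly_fun_algebra poly_fun.const)

lemma poly_fun_poly: "a \<in> poly_fun N \<Longrightarrow> (\<lambda>z. poly p (a z)) \<in> poly_fun N"
  by (induction p) (auto intro!: poly_fun.intros)

text \<open>Uncountably many reals are distributed over countably many values. In the application
  \<open>h\<close> records an exponent and a finite list of monomials.\<close>

lemma infinite_fibre:
  fixes h :: "real \<Rightarrow> 'b::countable"
  obtains y where "infinite (h -` {y})"
proof -
  have "\<exists>y. infinite (h -` {y})"
  proof (rule ccontr)
    assume "\<not> ?thesis"
    then have "countable (\<Union>y. h -` {y})" by (intro countable_UN countableI_type) (auto intro: countable_finite)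
    moreover have "(\<Union>y. h -` {y}) = UNIV" by auto
    ultimately show False using uncountable_UNIV_real by simp
  qed
  then show thesis using that by blast
qed

text \<open>
  The argument for the field \<open>\<complex>\<close>, which is uncountable: if \<open>a - c\<close> divides a power of \<open>f\<close>
  modulo \<open>M\<close> for all \<open>c\<close>, then infinitely many of the quotients lie in one finite
  dimensional space, and a linear relation between them is a polynomial equation for \<open>a\<close>.
\<close>

lemma constant_mod_prime:
  assumes M: "is_ideal (poly_fun N) M" and f: "f \<in> poly_fun N" "\<And>n. f ^ n \<notin> M"
    and prime: "\<And>a b. a \<in> poly_fun N \<Longrightarrow> b \<in> poly_fun N \<Longrightarrow> a * b \<in> M \<Longrightarrow> a \<in> M \<or> b \<in> M"
    and a: "a \<in> poly_fun N"
    and dvd: "\<And>c. a - (\<lambda>z. c) \<notin> M \<Longrightarrow> \<exists>n. \<exists>r\<in>poly_fun N. f ^ n - r * (a - (\<lambda>z. c)) \<in> M"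
  shows "\<exists>c. a - (\<lambda>z. c) \<in> M"
proof (rule ccontr)
  assume "\<not> ?thesis"
  then have nin: "a - (\<lambda>z. c) \<notin> M" for c by blast
  note sR = is_subring_poly_fun[of N]
  interpret fs: vector_space "\<lambda>(c::complex) (g::(nat \<Rightarrow> complex) \<Rightarrow> complex). (\<lambda>z. c * g z)"
    by unfold_locales (auto simp: fun_eq_iff algebra_simps)
  \<comment> \<open>Monomials are indexed by lists of variable indices, so that a finite family of
    monomials is a value of a countable type, as \<open>infinite_fibre\<close> demands.\<close>
  define mono :: "nat list \<Rightarrow> (nat \<Rightarrow> complex) \<Rightarrow> complex" where
    "mono xs = (\<lambda>z. prod_list (map z xs))" for xs
  have mono_mult: "g * mono xs \<in> fs.span (range mono)" if "g \<in> fs.span (range mono)" for g xs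
    using that
  proof (induction rule: fs.span_induct_alt)
    case base
    then show ?case using fs.span_zero by (simp add: zero_fun_def times_fun_def)
  next
    case (step c x y)
    obtain ys where ys: "x = mono ys" using step(1) by blast
    have "((\<lambda>z. c * x z) + y) * mono xs = (\<lambda>z. c * mono (ys @ xs) z) + y * mono xs"
      by (auto simp: ys mono_def fun_eq_iff algebra_simps)
    then show ?case
      by (simp only:) (intro fs.span_add fs.span_scale fs.span_base rangeI step)
  qed
  have span: "g \<in> fs.span (range mono)" if "g \<in> poly_fun N" for g
    using that
  proof (induction rule: poly_fun.induct)
    case (const c)
    have "(\<lambda>z. c) = (\<lambda>z. c * mono [] z)" by (simp add: mono_def)
    then show ?case using fs.span_scale[OF fs.span_base[of "mono []" "range mono"], of c] by simp
  next
    case (coord k)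
    have "(\<lambda>z. z k) = mono [k]" by (simp add: mono_def)
    then show ?case by (simp add: fs.span_base)
  next
    case (add g h)
    then show ?case using fs.span_add[of g _ h] by (simp add: plus_fun_def)
  next
    case (mult g h)
    have "g * h \<in> fs.span (range mono)" using mult(4)
    proof (induction rule: fs.span_induct_alt)
      case base
      then show ?case using fs.span_zero by (simp add: zero_fun_def times_fun_def)
    next
      case (step c x y)
      have "g * ((\<lambda>z. c * x z) + y) = (\<lambda>z. c * (g * x) z) + g * y"
        by (auto simp: fun_eq_iff algebra_simps)
      moreover obtain xs where "x = mono xs" using step(1) by blast
      ultimately show ?case
        by (simp only:) (intro fs.span_add fs.span_scale mono_mult mult step)
    qed
    then show ?case by (simp add: times_fun_def)
  qed
  have "\<exists>xss. g \<in> fs.span (mono ` set xss)" if g: "g \<in> poly_fun N" for g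
  proof -
    obtain t r where t: "finite t" "t \<subseteq> range mono" "g = (\<Sum>a\<in>t. (\<lambda>z. r a * a z))"
      using span[OF g] unfolding fs.span_explicit by blast
    obtain T where T: "finite T" "t = mono ` T" using finite_subset_image[OF t(1,2)] by blast
    obtain xss where "T = set xss" using finite_list[OF T(1)] by blast
    then show ?thesis
      by (intro exI[of _ xss]) (simp only: t(3) T(2), intro fs.span_sum fs.span_scale fs.span_base)
  qed
  then obtain xss where xss: "\<And>g. g \<in> poly_fun N \<Longrightarrow> g \<in> fs.span (mono ` set (xss g))" by metis
  \<comment> \<open>The real constants already form an uncountable family.\<close>
  have "\<exists>n r. r \<in> poly_fun N \<and> f ^ n - r * (a - (\<lambda>z. of_real c)) \<in> M" for c :: real
    using dvd[OF nin] by blast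
  then obtain n r where r: "\<And>c::real. r c \<in> poly_fun N"
    "\<And>c::real. f ^ n c - r c * (a - (\<lambda>z. of_real c)) \<in> M"
    by metis
  obtain y where inf: "infinite ((\<lambda>c. (n c, xss (r c))) -` {y})" by (rule infinite_fibre)
  obtain m ys where y: "y = (m, ys)" by (cases y)
  define T where "T = mono ` set ys"
  \<comment> \<open>One more constant than there are spanning monomials: the corresponding quotients
    \<open>r c\<close> must be linearly dependent.\<close>
  obtain C where C: "finite C" "card C = card T + 1" "C \<subseteq> (\<lambda>c. (n c, xss (r c))) -` {y}"
    using infinite_arbitrarily_large[OF inf] by blast
  have rC: "r c \<in> fs.span T" "n c = m" if "c \<in> C" for c
    using that C(3) xss[OF r(1)[of c]] by (auto simp: y T_def)
  \<comment> \<open>If two constants had the same quotient, subtracting their congruences would put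
    \<open>r c\<close>, and with it \<open>f ^ m\<close>, into \<open>M\<close>.\<close>
  have inj: "inj_on r C"
  proof (rule inj_onI, rule ccontr)
    fix c d assume cd: "c \<in> C" "d \<in> C" "r c = r d" "c \<noteq> d"
    have "f ^ m - r c * (a - (\<lambda>z. of_real c)) \<in> M" "f ^ m - r c * (a - (\<lambda>z. of_real d)) \<in> M"
      using r(2)[of c] r(2)[of d] rC(2) cd by simp_all
    then have "(f ^ m - r c * (a - (\<lambda>z. of_real c))) - (f ^ m - r c * (a - (\<lambda>z. of_real d))) \<in> M"
      by (rule is_ideal_minus(2)[OF sR M])
    then have *: "(\<lambda>z. of_real (c - d)) * r c \<in> M"
      by (simp add: fun_diff_def times_fun_def algebra_simps)
    have "(\<lambda>z. 1 / of_real (c - d)) * ((\<lambda>z. of_real (c - d)) * r c) \<in> M"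
      by (intro is_idealD(4)[OF M] * poly_fun.const)
    also have "(\<lambda>z. 1 / of_real (c - d)) * ((\<lambda>z. of_real (c - d)) * r c) = r c"
      using cd(4) by (auto simp: fun_eq_iff simp flip: of_real_diff)
    finally have "r c * (a - (\<lambda>z. of_real c)) \<in> M"
      by (intro is_idealD(5)[OF M] poly_fun_const_diff a)
    then have "(f ^ m - r c * (a - (\<lambda>z. of_real c))) + r c * (a - (\<lambda>z. of_real c)) \<in> M"
      using r(2)[of c] rC(2)[OF cd(1)] is_idealD(3)[OF M] by blast
    then show False using f(2)[of m] by simp
  qed
  have "fs.dependent (r ` C)"
  proof (rule ccontr)
    assume "fs.independent (r ` C)"
    then have "card (r ` C) \<le> card T"
      using fs.independent_span_bound[of T "r ` C"] rC(1) by (auto simp: T_def)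
    then show False using card_image[OF inj] C(2) by simp
  qed
  then obtain u v where u: "v \<in> r ` C" "u v \<noteq> 0" "(\<Sum>v\<in>r ` C. (\<lambda>z. u v * v z)) = 0"
    using fs.dependent_finite[of "r ` C"] C(1) by auto
  then obtain c0 where c0: "c0 \<in> C" "u (r c0) \<noteq> 0" by blast
  have sum0: "(\<Sum>c\<in>C. (\<lambda>z. u (r c) * r c z)) = 0" using u(3) unfolding sum.reindex[OF inj] o_def .
  \<comment> \<open>Modulo \<open>M\<close> the quotient \<open>r c\<close> behaves like
    \<open>f ^ m / (a - c)\<close>. Clearing denominators in the linear relation between the
    quotients leaves \<open>p\<close>, evaluated at \<open>a\<close>. At the point \<open>c0\<close>
    only one summand of \<open>p\<close> survives, hence \<open>p\<close> is not zero.\<close>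
  define p where "p = (\<Sum>c\<in>C. smult (u (r c)) (\<Prod>e\<in>C - {c}. [:- complex_of_real e, 1:]))"
  have "poly p (of_real c0) = (\<Sum>c\<in>C. if c = c0 then u (r c0) * (\<Prod>e\<in>C - {c0}. of_real (c0 - e)) else 0)"
    unfolding p_def poly_sum
  proof (rule sum.cong[OF refl])
    fix c assume "c \<in> C"
    show "poly (smult (u (r c)) (\<Prod>e\<in>C - {c}. [:- complex_of_real e, 1:])) (complex_of_real c0) =
      (if c = c0 then u (r c0) * (\<Prod>e\<in>C - {c0}. complex_of_real (c0 - e)) else 0)"
      using C(1) c0 by (auto simp: poly_prod intro!: prod_zero bexI[of _ c0])
  qed
  also have "\<dots> = u (r c0) * (\<Prod>e\<in>C - {c0}. of_real (c0 - e))" using C(1) c0 by simp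
  also have "\<dots> \<noteq> 0" using C(1) c0 by simp
  finally have "p \<noteq> 0" by auto
  \<comment> \<open>Over the complex numbers \<open>p\<close> splits into linear factors. None of
    the factors \<open>a - \<zeta>\<close> lies in the prime ideal \<open>M\<close>, and neither
    does a nonzero constant, since \<open>f ^ 0\<close> is outside \<open>M\<close>.\<close>
  have npM: "(\<lambda>z. poly p (a z)) \<notin> M" if "p \<noteq> 0" for p
    using that
  proof (induction "degree p" arbitrary: p)
    case 0
    then obtain c where c: "p = [:c:]" "c \<noteq> 0" by (metis degree_eq_zeroE pCons_0_0)
    show ?case
    proof
      assume "(\<lambda>z. poly p (a z)) \<in> M"
      then have "(\<lambda>z. 1 / c) * (\<lambda>z. poly p (a z)) \<in> M" by (intro is_idealD(4)[OF M] poly_fun.const)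
      also have "(\<lambda>z. 1 / c) * (\<lambda>z. poly p (a z)) = f ^ 0" using c by (auto simp: fun_eq_iff)
      finally show False using f(2) by blast
    qed
  next
    case (Suc d)
    have "\<not> constant (poly p)" using Suc.hyps(2) by (simp add: constant_degree)
    then obtain \<zeta> where "poly p \<zeta> = 0" using fundamental_theorem_of_algebra by blast
    then obtain q where q: "p = [:-\<zeta>, 1:] * q" by (auto simp: poly_eq_0_iff_dvd elim: dvdE)
    have "q \<noteq> 0" using Suc.prems q by auto
    have "degree p = degree [:-\<zeta>, 1:] + degree q"
      unfolding q by (rule degree_mult_eq) (use \<open>q \<noteq> 0\<close> in auto)
    then have "degree q = d" using Suc.hyps(2) by simp
    then have nq: "(\<lambda>z. poly q (a z)) \<notin> M" using Suc.hyps(1) \<open>q \<noteq> 0\<close> by blast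
    have "(\<lambda>z. poly p (a z)) = (a - (\<lambda>z. \<zeta>)) * (\<lambda>z. poly q (a z))"
      by (auto simp: q fun_eq_iff algebra_simps)
    then show ?case using prime[OF poly_fun_const_diff[OF a] poly_fun_poly[OF a], of \<zeta> q] nq nin by auto
  qed
  define P where "P = (\<lambda>S z. \<Prod>e\<in>S. a z - complex_of_real e)"
  have P: "P S \<in> poly_fun N" for S
  proof -
    have "P S = (\<lambda>z. poly (\<Prod>e\<in>S. [:- complex_of_real e, 1:]) (a z))"
      by (auto simp: P_def poly_prod fun_eq_iff intro!: prod.cong)
    then show ?thesis using poly_fun_poly[OF a] by simp
  qed
  \<comment> \<open>Each congruence is multiplied by its coefficient and by the product of the other
    factors \<open>a - e\<close>. In the sum the quotients are all multiplied by \<open>P C\<close>,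
    and the linear relation removes them.\<close>
  have "(\<Sum>c\<in>C. (P (C - {c}) * (\<lambda>z. u (r c))) * (f ^ n c - r c * (a - (\<lambda>z. of_real c)))) \<in> M"
    by (intro is_ideal_sum[OF M] is_idealD(4)[OF M] r(2) poly_fun_algebra P poly_fun.const)
  also have "(\<Sum>c\<in>C. (P (C - {c}) * (\<lambda>z. u (r c))) * (f ^ n c - r c * (a - (\<lambda>z. of_real c)))) =
    (\<Sum>c\<in>C. f ^ m * (P (C - {c}) * (\<lambda>z. u (r c))) - P C * (\<lambda>z. u (r c) * r c z))"
  proof (rule sum.cong[OF refl])
    fix c assume c: "c \<in> C"
    have PC: "P C z = (a z - of_real c) * P (C - {c}) z" for z
      unfolding P_def using c C(1) by (simp add: prod.remove)
    then show "(P (C - {c}) * (\<lambda>z. u (r c))) * (f ^ n c - r c * (a - (\<lambda>z. of_real c))) =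
      f ^ m * (P (C - {c}) * (\<lambda>z. u (r c))) - P C * (\<lambda>z. u (r c) * r c z)"
      using rC(2)[OF c] by (simp add: fun_eq_iff PC) (simp add: algebra_simps)
  qed
  also have "\<dots> = f ^ m * (\<Sum>c\<in>C. P (C - {c}) * (\<lambda>z. u (r c))) - P C * (\<Sum>c\<in>C. (\<lambda>z. u (r c) * r c z))"
    by (simp only: sum_subtractf sum_distrib_left)
  also have "\<dots> = f ^ m * (\<Sum>c\<in>C. P (C - {c}) * (\<lambda>z. u (r c)))" by (simp add: sum0)
  also have "(\<Sum>c\<in>C. P (C - {c}) * (\<lambda>z. u (r c))) = (\<lambda>z. poly p (a z))"
  proof
    fix z
    have "(\<Sum>c\<in>C. P (C - {c}) * (\<lambda>z. u (r c))) z = (\<Sum>c\<in>C. P (C - {c}) z * u (r c))"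
      by (simp add: sum_fun_apply)
    also have "\<dots> = poly p (a z)"
      unfolding p_def by (auto simp: poly_sum P_def poly_prod intro!: sum.cong)
    finally show "(\<Sum>c\<in>C. P (C - {c}) * (\<lambda>z. u (r c))) z = poly p (a z)" .
  qed
  finally have "f ^ m * (\<lambda>z. poly p (a z)) \<in> M" .
  then show False
    using prime[OF is_subringD(7)[OF sR f(1)] poly_fun_poly[OF a]] f(2) npM[OF \<open>p \<noteq> 0\<close>] by blast
qed

lemma poly_fun_eval_mod:
  assumes M: "is_ideal (poly_fun N) M" and q: "\<And>k. k < N \<Longrightarrow> (\<lambda>z. z k) - (\<lambda>z. q k) \<in> M"
    and "h \<in> poly_fun N"
  shows "h - (\<lambda>z. h q) \<in> M"
  using assms(3)
proof (induction rule: poly_fun.induct)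
  case (const c)
  then show ?case using is_idealD(2)[OF M] by (simp add: fun_diff_def zero_fun_def)
next
  case (coord k)
  then show ?case by (rule q)
next
  case (add f g)
  have "(f - (\<lambda>z. f q)) + (g - (\<lambda>z. g q)) = (\<lambda>z. f z + g z) - (\<lambda>z. f q + g q)"
    by (auto simp: fun_eq_iff)
  then show ?case using is_idealD(3)[OF M add(3,4)] by (simp only:)
next
  case (mult f g)
  have "g * (f - (\<lambda>z. f q)) + (\<lambda>z. f q) * (g - (\<lambda>z. g q)) = (\<lambda>z. f z * g z) - (\<lambda>z. f q * g q)"
    by (auto simp: fun_eq_iff algebra_simps)
  then show ?case
    using is_idealD(3)[OF M is_idealD(4)[OF M mult(2,3)] is_idealD(4)[OF M poly_fun.const mult(4)]]
    by metis
qed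

text \<open>If no power of \<open>f\<close> lies in \<open>K\<close>, choose \<open>M\<close> above
  \<open>K\<close> maximal among the ideals without powers of \<open>f\<close>. Every polynomial
  outside \<open>M\<close> divides a power of \<open>f\<close> modulo \<open>M\<close>, so
  \<open>M\<close> is prime and \<open>constant_mod_prime\<close> makes every coordinate congruent
  to a constant. These constants form a common zero of \<open>K\<close>; as \<open>f\<close> would
  vanish there, \<open>f\<close> would lie in \<open>M\<close>.\<close>

theorem nullstellensatz:
  assumes K: "is_ideal (poly_fun N) K" and f: "f \<in> poly_fun N"
    and zero: "\<And>z. z \<in> cspace N \<Longrightarrow> (\<And>h. h \<in> K \<Longrightarrow> h z = 0) \<Longrightarrow> f z = 0"
  shows "\<exists>n. f ^ n \<in> K"
proof (rule ccontr)
  assume "\<not> ?thesis"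
  then have "K \<inter> range (\<lambda>n. f ^ n) = {}" by auto
  then obtain M where M: "is_ideal (poly_fun N) M" "K \<subseteq> M" "M \<inter> range (\<lambda>n. f ^ n) = {}"
    and max: "\<And>L. is_ideal (poly_fun N) L \<Longrightarrow> M \<subseteq> L \<Longrightarrow> L \<inter> range (\<lambda>n. f ^ n) = {} \<Longrightarrow> L = M"
    using maximal_ideal_avoiding[OF K] by metis
  note sR = is_subring_poly_fun[of N]
  have fM: "f ^ n \<notin> M" for n using M(3) by auto
  have dvd: "\<exists>n. \<exists>r\<in>poly_fun N. f ^ n - r * a \<in> M" if a: "a \<in> poly_fun N" "a \<notin> M" for a
  proof -
    let ?L = "{k + r * a |k r. k \<in> M \<and> r \<in> poly_fun N}"
    have L: "is_ideal (poly_fun N) ?L" by (rule is_ideal_add_principal[OF sR M(1) a(1)])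
    have sub: "M \<subseteq> ?L"
    proof
      fix k assume "k \<in> M"
      then show "k \<in> ?L" using is_subringD(2)[OF sR] by (intro CollectI exI[of _ k] exI[of _ 0]) auto
    qed
    have "a \<in> ?L"
      using is_subringD(1)[OF sR] is_idealD(2)[OF M(1)]
      by (intro CollectI exI[of _ 0] exI[of _ 1]) auto
    then have "?L \<inter> range (\<lambda>n. f ^ n) \<noteq> {}" using max[OF L sub] a(2) by auto
    then obtain n k r where "f ^ n = k + r * a" "k \<in> M" "r \<in> poly_fun N" by auto
    then show ?thesis by (intro exI[of _ n] bexI[of _ r]) auto
  qed
  have prime: "a \<in> M \<or> b \<in> M" if ab: "a \<in> poly_fun N" "b \<in> poly_fun N" "a * b \<in> M" for a b
  proof (rule ccontr)
    assume "\<not> ?thesis"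
    then obtain m r n s where *: "f ^ m - r * a \<in> M" "f ^ n - s * b \<in> M"
      "r \<in> poly_fun N" "s \<in> poly_fun N"
      using dvd[OF ab(1)] dvd[OF ab(2)] by blast
    have "f ^ n * (f ^ m - r * a) + ((r * a) * (f ^ n - s * b) + (r * s) * (a * b)) \<in> M"
      by (intro is_idealD(3,4)[OF M(1)] * ab poly_fun_algebra is_subringD(7)[OF sR f])
    also have "f ^ n * (f ^ m - r * a) + ((r * a) * (f ^ n - s * b) + (r * s) * (a * b)) = f ^ (m + n)"
      by (simp add: algebra_simps power_add)
    finally show False using fM by blast
  qed
  have "\<exists>c. (\<lambda>z. z k) - (\<lambda>z. c) \<in> M" if "k < N" for k
    using constant_mod_prime[OF M(1) f fM prime poly_fun.coord[OF that]]
      dvd[OF poly_fun_const_diff[OF poly_fun.coord[OF that]]] by blast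
  then obtain q where q: "\<And>k. k < N \<Longrightarrow> (\<lambda>z. z k) - (\<lambda>z. q k) \<in> M" by metis
  define q' where "q' k = (if k < N then q k else 0)" for k
  have q': "\<And>k. k < N \<Longrightarrow> (\<lambda>z. z k) - (\<lambda>z. q' k) \<in> M" "q' \<in> cspace N"
    using q by (auto simp: q'_def cspace_def)
  have ev: "h - (\<lambda>z. h q') \<in> M" if "h \<in> poly_fun N" for h
    by (rule poly_fun_eval_mod[OF M(1) q'(1) that])
  have "h q' = 0" if h: "h \<in> K" for h
  proof (rule ccontr)
    assume nz: "h q' \<noteq> 0"
    have hM: "h \<in> M" using h M(2) by blast
    then have "h - (h - (\<lambda>z. h q')) \<in> M"
      using is_ideal_minus(2)[OF sR M(1) hM ev] is_idealD(1)[OF M(1)] by blast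
    then have "(\<lambda>z. 1 / h q') * (h - (h - (\<lambda>z. h q'))) \<in> M"
      by (intro is_idealD(4)[OF M(1)] poly_fun.const)
    also have "(\<lambda>z. 1 / h q') * (h - (h - (\<lambda>z. h q'))) = f ^ 0" using nz by (auto simp: fun_eq_iff)
    finally show False using fM by blast
  qed
  then have "f q' = 0" by (intro zero q')
  then have "f ^ 1 \<in> M" using ev[OF f] by (simp add: fun_diff_def)
  then show False using fM by blast
qed

section \<open>Krull intersection theorem\<close>

lemmas fun_algebra_apply = plus_fun_apply times_fun_apply zero_fun_apply one_fun_apply

text \<open>As simp rules these also rewrite unapplied sums and products of functions, by eta-expansion.\<close>

declare fun_algebra_apply [simp del] minus_apply [simp del] uminus_apply [simp del]

text \<open>\<open>f\<close> lies in the \<open>n\<close>-th power of the maximal ideal of polynomials vanishing at \<open>p\<close>.\<close>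

inductive vanish :: "nat \<Rightarrow> (nat \<Rightarrow> complex) \<Rightarrow> nat \<Rightarrow> ((nat \<Rightarrow> complex) \<Rightarrow> complex) \<Rightarrow> bool"
  for N p where
  base: "f \<in> poly_fun N \<Longrightarrow> vanish N p 0 f"
| zero: "vanish N p n 0"
| add: "vanish N p n f \<Longrightarrow> vanish N p n g \<Longrightarrow> vanish N p n (f + g)"
| step: "k < N \<Longrightarrow> vanish N p n f \<Longrightarrow> vanish N p (Suc n) (((\<lambda>z. z k) - (\<lambda>z. p k)) * f)"

lemma coord_diff_poly_fun: "k < N \<Longrightarrow> (\<lambda>z. z k) - (\<lambda>z. c) \<in> poly_fun N"
  by (intro poly_fun_const_diff poly_fun.coord)

lemma vanish_poly_fun: "vanish N p n f \<Longrightarrow> f \<in> poly_fun N"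
  by (induction rule: vanish.induct) (auto intro!: poly_fun_algebra coord_diff_poly_fun)

lemma vanish_scale:
  assumes "vanish N p n f" "r \<in> poly_fun N"
  shows "vanish N p n (r * f)"
  using assms
proof (induction rule: vanish.induct)
  case (zero n)
  then show ?case using vanish.zero by simp
next
  case (add n f g)
  then show ?case using vanish.add[of N p n "r * f" "r * g"] by (simp only: distrib_left)
next
  case (step k n f)
  then have "vanish N p (Suc n) (((\<lambda>z. z k) - (\<lambda>z. p k)) * (r * f))" by (intro vanish.step) auto
  then show ?case by (simp only: mult.left_commute)
qed (auto intro: vanish.base poly_fun_algebra)

lemma vanish_mult:
  assumes "vanish N p m f" "vanish N p n g"
  shows "vanish N p (m + n) (f * g)"
  using assms
proof (induction rule: vanish.induct)
  case (base f)
  then show ?case using vanish_scale by simp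
next
  case (zero n)
  then show ?case using vanish.zero by simp
next
  case (add n f g)
  then show ?case by (simp only: distrib_right vanish.add)
next
  case (step k n f)
  then show ?case by (simp only: mult.assoc add_Suc vanish.step)
qed

lemma vanish_Suc: "vanish N p (Suc n) f \<Longrightarrow> vanish N p n f"
proof (induction "Suc n" f arbitrary: n rule: vanish.induct)
  case (step k n f)
  show ?case by (rule vanish_scale[OF step(2) coord_diff_poly_fun[OF step(1)]])
qed (auto intro: vanish.zero vanish.add)

lemma vanish_minus: "vanish N p n f \<Longrightarrow> vanish N p n (- f)"
  using vanish_scale[of N p n f "- 1"] poly_fun_algebra(4)[OF poly_fun_algebra(5)] by simp

lemma vanish_sum: "(\<And>i. i \<in> S \<Longrightarrow> vanish N p n (f i)) \<Longrightarrow> vanish N p n (sum f S)"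
  by (induction S rule: infinite_finite_induct) (auto intro: vanish.zero vanish.add)

lemma vanish_coord: "k < N \<Longrightarrow> vanish N p (Suc 0) ((\<lambda>z. z k) - (\<lambda>z. p k))"
  using vanish.step[OF _ vanish.base[OF poly_fun_algebra(5)], of k N p] by simp

text \<open>Reduces membership of the \<open>n\<close>-th power of the maximal ideal to monomials of
  degree \<open>n\<close> in the shifted coordinates. The factor \<open>r\<close> accumulates the
  linear factors that the induction has already split off.\<close>

lemma vanish_by_monomials:
  assumes M: "is_ideal (poly_fun N) M" and "vanish N p n f" "r \<in> poly_fun N"
    and "\<And>e. (\<Sum>k<N. e k) = n \<Longrightarrow> r * (\<Prod>k<N. ((\<lambda>z. z k) - (\<lambda>z. p k)) ^ e k) \<in> M"
  shows "r * f \<in> M"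
  using assms(2-)
proof (induction arbitrary: r rule: vanish.induct)
  case (base f)
  from base(3)[of "\<lambda>_. 0"] have "r \<in> M" by simp
  then show ?case using is_idealD(5)[OF M base(1)] by blast
next
  case (zero n)
  then show ?case using is_idealD(2)[OF M] by simp
next
  case (add n f g)
  then have "r * f + r * g \<in> M" by (intro is_idealD(3)[OF M]) auto
  then show ?case by (simp only: distrib_left)
next
  case (step k n f)
  let ?a = "\<lambda>k. (\<lambda>z::nat \<Rightarrow> complex. z k) - (\<lambda>z. p k)"
  have "(r * ?a k) * f \<in> M"
  proof (rule step.IH)
    show "r * ?a k \<in> poly_fun N" by (intro poly_fun_algebra(2) step coord_diff_poly_fun)
    fix e :: "nat \<Rightarrow> nat" assume e: "(\<Sum>j<N. e j) = n"
    let ?e = "e(k := Suc (e k))"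
    have s: "(\<Sum>j<N. ?e j) = Suc n"
      using e step(1) by (simp add: sum.remove[of "{..<N}" k])
    have "(\<Prod>j<N. ?a j ^ ?e j) = ?a k * (\<Prod>j<N. ?a j ^ e j)"
      using step(1) by (simp add: prod.remove[of "{..<N}" k] mult.assoc)
    then have "r * ?a k * (\<Prod>j<N. ?a j ^ e j) = r * (\<Prod>j<N. ?a j ^ ?e j)" by (simp only: mult.assoc)
    then show "r * ?a k * (\<Prod>j<N. ?a j ^ e j) \<in> M" using step.prems(2)[OF s] by (simp only:)
  qed
  then show ?case by (simp only: mult.assoc)
qed

text \<open>In a monomial of degree \<open>N * b + 1\<close> in \<open>N\<close> variables some
  exponent exceeds \<open>b\<close>, and \<open>b\<close> bounds all the exponents
  \<open>i k\<close> with which the shifted coordinates fall into \<open>M\<close>.\<close>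

lemma vanish_in_ideal:
  assumes M: "is_ideal (poly_fun N) M"
    and nil: "\<And>k. k < N \<Longrightarrow> \<exists>i. ((\<lambda>z. z k) - (\<lambda>z. p k)) ^ i \<in> M"
  shows "\<exists>n. \<forall>f. vanish N p n f \<longrightarrow> f \<in> M"
proof -
  let ?a = "\<lambda>k. (\<lambda>z::nat \<Rightarrow> complex. z k) - (\<lambda>z. p k)"
  obtain i where i: "\<And>k. k < N \<Longrightarrow> ?a k ^ i k \<in> M" using nil by metis
  define b where "b = Max (i ` {..<N})"
  have "f \<in> M" if f: "vanish N p (N * b + 1) f" for f
  proof -
    have "1 * f \<in> M"
    proof (rule vanish_by_monomials[OF M f poly_fun_algebra(5)])
      fix e :: "nat \<Rightarrow> nat" assume e: "(\<Sum>k<N. e k) = N * b + 1"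
      have "\<exists>k<N. b < e k"
      proof (rule ccontr)
        assume "\<not> ?thesis"
        then have "(\<Sum>k<N. e k) \<le> (\<Sum>k<N. b)" by (intro sum_mono) auto
        then show False using e by simp
      qed
      then obtain k where k: "k < N" "b < e k" by blast
      then have "i k \<le> b" unfolding b_def by (intro Max_ge) auto
      then have "e k = (e k - i k) + i k" using k by simp
      then have "?a k ^ e k = ?a k ^ (e k - i k) * ?a k ^ i k" by (metis power_add)
      moreover have "?a k ^ (e k - i k) \<in> poly_fun N"
        by (intro is_subringD(7)[OF is_subring_poly_fun] coord_diff_poly_fun k)
      ultimately have "?a k ^ e k \<in> M" using is_idealD(4)[OF M _ i[OF k(1)]] by metis
      moreover have "(\<Prod>j\<in>{..<N} - {k}. ?a j ^ e j) \<in> poly_fun N"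
      proof -
        have *: "prod g S \<in> poly_fun N" if "\<And>j. j \<in> S \<Longrightarrow> g j \<in> poly_fun N" for g and S :: "nat set"
          using that by (induction S rule: infinite_finite_induct) (auto intro: poly_fun_algebra)
        then show ?thesis
          by (intro *) (auto intro!: is_subringD(7)[OF is_subring_poly_fun] coord_diff_poly_fun)
      qed
      ultimately have "?a k ^ e k * (\<Prod>j\<in>{..<N} - {k}. ?a j ^ e j) \<in> M"
        by (intro is_idealD(5)[OF M])
      then show "1 * (\<Prod>k<N. ?a k ^ e k) \<in> M"
        using k(1) by (simp only: mult_1 prod.remove[of "{..<N}" k] finite_lessThan lessThan_iff)
    qed
    then show ?thesis by simp
  qed
  then show ?thesis by blast
qed

text \<open>The ideals \<open>C i\<close> of all \<open>r\<close> with
  \<open>a ^ i * r \<in> M\<close> increase and stop at some \<open>d\<close>. If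
  \<open>a ^ d\<close> were outside \<open>M\<close>, maximality would give
  \<open>x = k + r * a ^ d\<close> with \<open>k \<in> M\<close>. Multiplying by \<open>a\<close>
  shows \<open>r \<in> C (Suc d)\<close>, so \<open>r \<in> C d\<close>, and \<open>x\<close> would
  lie in \<open>M\<close>.\<close>

lemma nilpotent_mod_maximal:
  assumes M: "is_ideal (poly_fun N) M" "x \<notin> M"
    and max: "\<And>L. is_ideal (poly_fun N) L \<Longrightarrow> M \<subseteq> L \<Longrightarrow> x \<notin> L \<Longrightarrow> L = M"
    and a: "a \<in> poly_fun N" "a * x \<in> M"
  shows "\<exists>i. a ^ i \<in> M"
proof -
  note sR = is_subring_poly_fun[of N]
  define C where "C i = {r \<in> poly_fun N. a ^ i * r \<in> M}" for i
  have pow: "a ^ i \<in> poly_fun N" for i by (rule is_subringD(7)[OF sR a(1)])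
  have "is_ideal (poly_fun N) (C i)" for i unfolding is_ideal_def
  proof (intro conjI ballI)
    show "0 \<in> C i" using is_idealD(2)[OF M(1)] poly_fun_algebra(6) by (simp add: C_def)
    show "r + s \<in> C i" if "r \<in> C i" "s \<in> C i" for r s
      using that is_idealD(3)[OF M(1), of "a ^ i * r" "a ^ i * s"]
      by (auto simp: C_def distrib_left intro: poly_fun_algebra simp del: times_fun_apply plus_fun_apply)
    show "s * r \<in> C i" if "s \<in> poly_fun N" "r \<in> C i" for r s
      using that is_idealD(4)[OF M(1), of s "a ^ i * r"]
      by (simp add: C_def mult.left_commute poly_fun_algebra)
  qed (simp add: C_def)
  moreover have "C i \<subseteq> C (Suc i)" for i
    using is_idealD(4)[OF M(1) a(1)] by (auto simp: C_def mult.assoc)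
  ultimately obtain d where d: "\<And>n. C n \<subseteq> C d"
    using noetherian_chain_stable[OF noetherian_poly_fun] by blast
  have "a ^ d \<in> M"
  proof (rule ccontr)
    assume nM: "a ^ d \<notin> M"
    let ?L = "{k + r * a ^ d |k r. k \<in> M \<and> r \<in> poly_fun N}"
    have L: "is_ideal (poly_fun N) ?L" by (rule is_ideal_add_principal[OF sR M(1) pow])
    have sub: "M \<subseteq> ?L"
    proof
      fix k assume "k \<in> M"
      then show "k \<in> ?L" using is_subringD(2)[OF sR] by (intro CollectI exI[of _ k] exI[of _ 0]) auto
    qed
    have "a ^ d \<in> ?L"
      using is_subringD(1)[OF sR] is_idealD(2)[OF M(1)]
      by (intro CollectI exI[of _ 0] exI[of _ 1]) auto
    then have "x \<in> ?L" using max[OF L sub] nM by blast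
    then obtain k r where kr: "x = k + r * a ^ d" "k \<in> M" "r \<in> poly_fun N" by blast
    have "a * x - a * k \<in> M"
      by (intro is_ideal_minus(2)[OF sR M(1)] a is_idealD(4)[OF M(1)] kr)
    moreover have "a * x - a * k = a ^ Suc d * r" by (simp add: kr algebra_simps)
    ultimately have "r \<in> C (Suc d)" using kr(3) by (simp add: C_def)
    then have "r \<in> C d" using d by blast
    then have "a ^ d * r \<in> M" by (simp add: C_def)
    then have "k + a ^ d * r \<in> M" using is_idealD(3)[OF M(1) kr(2)] by blast
    then show False using M(2) kr(1) by (simp add: mult.commute)
  qed
  then show ?thesis by blast
qed

text \<open>
  If \<open>x \<notin> K + \<mm> x\<close>, an ideal \<open>M\<close> that is maximal among those containing \<open>K + \<mm> x\<close> but not \<open>x\<close>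
  contains a power of \<open>\<mm>\<close>, so \<open>x\<close> is not in the closure of \<open>K\<close>.
\<close>

theorem krull_intersection:
  assumes K: "is_ideal (poly_fun N) K" and x: "x \<in> poly_fun N"
    and cl: "\<And>n. \<exists>k\<in>K. vanish N p n (x - k)"
  shows "\<exists>q\<in>poly_fun N. q p \<noteq> 0 \<and> q * x \<in> K"
proof (rule ccontr)
  assume no: "\<not> ?thesis"
  define K0 where "K0 = {k + m * x |k m. k \<in> K \<and> m \<in> poly_fun N \<and> m p = 0}"
  have K0I: "k + m * x \<in> K0" if "k \<in> K" "m \<in> poly_fun N" "m p = 0" for k m
    using that by (auto simp: K0_def)
  have K0: "is_ideal (poly_fun N) K0" unfolding is_ideal_def
  proof (intro conjI ballI subsetI)
    show "f \<in> poly_fun N" if "f \<in> K0" for f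
      using that x by (auto simp: K0_def intro!: poly_fun_algebra intro: is_idealD(1)[OF K])
    show "0 \<in> K0" using K0I[OF is_idealD(2)[OF K] poly_fun_algebra(6)] by (simp add: zero_fun_apply)
    show "f + g \<in> K0" if "f \<in> K0" "g \<in> K0" for f g
    proof -
      obtain k m k' m' where *: "f = k + m * x" "k \<in> K" "m \<in> poly_fun N" "m p = 0"
        "g = k' + m' * x" "k' \<in> K" "m' \<in> poly_fun N" "m' p = 0" using \<open>f \<in> K0\<close> \<open>g \<in> K0\<close>
        unfolding K0_def by blast
      have "f + g = (k + k') + (m + m') * x" by (simp add: * algebra_simps)
      then show ?thesis
        using K0I[OF is_idealD(3)[OF K *(2,6)] poly_fun_algebra(1)[OF *(3,7)]] *(4,8)
        by (simp add: plus_fun_apply)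
    qed
    show "r * f \<in> K0" if "r \<in> poly_fun N" "f \<in> K0" for r f
    proof -
      obtain k m where *: "f = k + m * x" "k \<in> K" "m \<in> poly_fun N" "m p = 0"
        using \<open>f \<in> K0\<close> unfolding K0_def by blast
      have "r * f = r * k + (r * m) * x" by (simp add: * algebra_simps)
      then show ?thesis
        using K0I[OF is_idealD(4)[OF K that(1) *(2)] poly_fun_algebra(2)[OF that(1) *(3)]] *(4)
        by (simp add: times_fun_apply)
    qed
  qed
  have "x \<notin> K0"
  proof
    assume "x \<in> K0"
    then obtain k m where *: "x = k + m * x" "k \<in> K" "m \<in> poly_fun N" "m p = 0"
      unfolding K0_def by blast
    \<comment> \<open>The factor \<open>1 - m\<close> has the value \<open>1\<close> at
      \<open>p\<close>, so it would be one of the multipliers excluded by \<open>no\<close>.\<close>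
    have "(1 - m) * x = k" using *(1) by (simp add: left_diff_distrib) (metis add_diff_cancel_right')
    moreover have "1 - m \<in> poly_fun N" "(1 - m) p \<noteq> 0"
      using *(3,4) by (auto intro: poly_fun_algebra simp: one_fun_apply minus_apply)
    ultimately show False using no *(2) by blast
  qed
  then obtain M where M: "is_ideal (poly_fun N) M" "K0 \<subseteq> M" "M \<inter> {x} = {}"
    and max: "\<And>L. is_ideal (poly_fun N) L \<Longrightarrow> M \<subseteq> L \<Longrightarrow> L \<inter> {x} = {} \<Longrightarrow> L = M"
    using maximal_ideal_avoiding[OF K0, of "{x}"] by auto
  have "\<exists>i. ((\<lambda>z. z k) - (\<lambda>z. p k)) ^ i \<in> M" if "k < N" for k
  proof (rule nilpotent_mod_maximal[OF M(1)])
    show "x \<notin> M" using M(3) by blast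
    show "L = M" if "is_ideal (poly_fun N) L" "M \<subseteq> L" "x \<notin> L" for L using max that by blast
    show "(\<lambda>z. z k) - (\<lambda>z. p k) \<in> poly_fun N" by (rule coord_diff_poly_fun[OF that])
    have "0 + ((\<lambda>z. z k) - (\<lambda>z. p k)) * x \<in> K0"
      by (rule K0I[OF is_idealD(2)[OF K] coord_diff_poly_fun[OF that]]) (simp add: fun_diff_def)
    then show "((\<lambda>z. z k) - (\<lambda>z. p k)) * x \<in> M" using M(2) by (simp only: add_0_left) blast
  qed
  then obtain n where n: "\<And>f. vanish N p n f \<Longrightarrow> f \<in> M" using vanish_in_ideal[OF M(1)] by blast
  obtain k where k: "k \<in> K" "vanish N p n (x - k)" using cl by blast
  have "k + 0 * x \<in> M" using M(2) K0I[OF k(1) poly_fun_algebra(6) zero_fun_apply] by blast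
  then have "k + 0 * x + (x - k) \<in> M" using is_idealD(3)[OF M(1)] n[OF k(2)] by blast
  then show False using M(3) by simp
qed

section \<open>Differentials and initial forms\<close>

definition dif :: "nat \<Rightarrow> ((nat \<Rightarrow> complex) \<Rightarrow> complex) \<Rightarrow> (nat \<Rightarrow> complex) \<Rightarrow> (nat \<Rightarrow> complex) \<Rightarrow> complex" where
  "dif N f p v = (\<Sum>k<N. pderivative k f p * v k)"

lemma poly_fun_partial_differentiable:
  "f \<in> poly_fun N \<Longrightarrow> (\<lambda>w. f (p(k := w))) field_differentiable at w0"
proof (induction rule: poly_fun.induct)
  case (coord j)
  then show ?case by (cases "j = k") auto
qed (auto intro!: field_differentiable_add field_differentiable_mult)

lemma pderivative_simps:
  "pderivative k (\<lambda>z. c) p = 0"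
  "pderivative k (\<lambda>z. z j) p = (if j = k then 1 else 0)"
  "f \<in> poly_fun N \<Longrightarrow> g \<in> poly_fun N \<Longrightarrow>
    pderivative k (\<lambda>z. f z + g z) p = pderivative k f p + pderivative k g p"
  "f \<in> poly_fun N \<Longrightarrow> g \<in> poly_fun N \<Longrightarrow>
    pderivative k (\<lambda>z. f z * g z) p = f p * pderivative k g p + pderivative k f p * g p"
  by (auto simp: pderivative_def poly_fun_partial_differentiable deriv_add deriv_mult)

lemma dif_simps:
  "dif N (\<lambda>z. c) p v = 0"
  "j < N \<Longrightarrow> dif N (\<lambda>z. z j) p v = v j"
  "f \<in> poly_fun N \<Longrightarrow> g \<in> poly_fun N \<Longrightarrow> dif N (\<lambda>z. f z + g z) p v = dif N f p v + dif N g p v"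
  "f \<in> poly_fun N \<Longrightarrow> g \<in> poly_fun N \<Longrightarrow>
    dif N (\<lambda>z. f z * g z) p v = f p * dif N g p v + g p * dif N f p v"
  by (auto simp: dif_def pderivative_simps if_distrib[of "\<lambda>x. x * _"] cong: if_cong)
    (simp_all add: algebra_simps sum.distrib sum_distrib_left)

lemma dif_linear:
  "dif N f p (\<lambda>k. v k + w k) = dif N f p v + dif N f p w"
  "dif N f p (\<lambda>k. v k - w k) = dif N f p v - dif N f p w"
  "dif N f p (\<lambda>k. a * v k) = a * dif N f p v"
  "dif N f p (\<lambda>k. \<Sum>i\<in>S. b i * u i k) = (\<Sum>i\<in>S. b i * dif N f p (u i))"
proof -
  show "dif N f p (\<lambda>k. \<Sum>i\<in>S. b i * u i k) = (\<Sum>i\<in>S. b i * dif N f p (u i))"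
    by (simp add: dif_def sum_distrib_left sum.swap[of _ S] algebra_simps)
qed (simp_all add: dif_def algebra_simps sum.distrib sum_subtractf sum_distrib_left)

text \<open>Induction on the number of forms. The new form is not a combination of the old ones, so
  subtracting that combination of the old forms which has the same values on the old dual vectors
  leaves a form that is nonzero at some unit vector \<open>k0\<close>. The vector \<open>w\<close>
  is this unit vector, moved into the kernel of the old forms and normalised by \<open>D\<close>;
  the old dual vectors are then corrected by multiples of \<open>w\<close>.\<close>

lemma dual_vectors:
  fixes r :: "nat \<Rightarrow> nat \<Rightarrow> complex"
  assumes "\<And>a. (\<forall>k<N. (\<Sum>j<c. a j * r j k) = 0) \<Longrightarrow> \<forall>j<c. a j = 0"
  shows "\<exists>\<epsilon>. \<forall>i<c. \<forall>j<c. (\<Sum>k<N. r i k * \<epsilon> j k) = (if i = j then 1 else 0)"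
  using assms
proof (induction c)
  case (Suc c)
  let ?l = "\<lambda>i v. \<Sum>k<N. r i k * v k"
  have "\<forall>j<c. a j = 0" if a: "\<forall>k<N. (\<Sum>j<c. a j * r j k) = 0" for a
  proof -
    have *: "\<forall>j<Suc c. (a(c := 0)) j = 0"
      by (rule Suc.prems) (use a in simp)
    show ?thesis
    proof (intro allI impI)
      fix j assume "j < c"
      then show "a j = 0" using spec[OF *, of j] by simp
    qed
  qed
  then obtain \<epsilon> where \<epsilon>: "\<And>i j. i < c \<Longrightarrow> j < c \<Longrightarrow> ?l i (\<epsilon> j) = (if i = j then 1 else 0)"
    using Suc.IH by blast
  have "\<exists>k<N. r c k - (\<Sum>j<c. ?l c (\<epsilon> j) * r j k) \<noteq> 0"
  proof (rule ccontr)
    assume "\<not> ?thesis"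
    then have *: "\<forall>k<N. r c k - (\<Sum>j<c. ?l c (\<epsilon> j) * r j k) = 0" by blast
    have 0: "\<forall>j<Suc c. ((\<lambda>j. - ?l c (\<epsilon> j))(c := 1)) j = 0"
      by (rule Suc.prems) (use * in \<open>simp add: sum_negf\<close>)
    show False using spec[OF 0, of c] by simp
  qed
  then obtain k0 where k0: "k0 < N" "r c k0 - (\<Sum>j<c. ?l c (\<epsilon> j) * r j k0) \<noteq> 0" by blast
  define D where "D = r c k0 - (\<Sum>j<c. ?l c (\<epsilon> j) * r j k0)"
  define w where "w k = ((if k = k0 then 1 else 0) - (\<Sum>j<c. r j k0 * \<epsilon> j k)) / D" for k
  have lin: "?l i w = (r i k0 - (\<Sum>j<c. r j k0 * ?l i (\<epsilon> j))) / D" for i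
  proof -
    have "?l i w = ((\<Sum>k<N. r i k * (if k = k0 then 1 else 0))
        - (\<Sum>k<N. \<Sum>j<c. r i k * (r j k0 * \<epsilon> j k))) / D"
      by (simp add: w_def sum_divide_distrib[symmetric] sum_subtractf[symmetric]
          right_diff_distrib sum_distrib_left)
    also have "(\<Sum>k<N. r i k * (if k = k0 then 1 else 0)) = r i k0"
      using k0(1) by (simp add: if_distrib[of "\<lambda>x. _ * x"] cong: if_cong)
    also have "(\<Sum>k<N. \<Sum>j<c. r i k * (r j k0 * \<epsilon> j k)) = (\<Sum>j<c. r j k0 * ?l i (\<epsilon> j))"
      by (subst sum.swap) (simp add: sum_distrib_left algebra_simps)
    finally show ?thesis .
  qed
  have w_low: "?l i w = 0" if "i < c" for i
  proof -
    have "(\<Sum>j<c. r j k0 * ?l i (\<epsilon> j)) = (\<Sum>j<c. if j = i then r i k0 else 0)"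
      by (rule sum.cong) (use that \<epsilon> in auto)
    then show ?thesis using lin[of i] that by simp
  qed
  have w_c: "?l c w = 1"
    using lin[of c] k0(2) by (simp add: D_def mult.commute)
  define \<epsilon>' where "\<epsilon>' = (\<lambda>j k. \<epsilon> j k - ?l c (\<epsilon> j) * w k)(c := w)"
  have \<epsilon>': "?l i (\<epsilon>' j) = ?l i (\<epsilon> j) - ?l c (\<epsilon> j) * ?l i w" if "j < c" for i j
    using that by (simp add: \<epsilon>'_def right_diff_distrib sum_subtractf sum_distrib_left mult.left_commute)
  have "?l i (\<epsilon>' j) = (if i = j then 1 else 0)" if "i < Suc c" "j < Suc c" for i j
  proof (cases "j = c")
    case True
    then show ?thesis using w_low w_c that by (auto simp: \<epsilon>'_def less_Suc_eq)
  next
    case False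
    then show ?thesis using \<epsilon>'[of j i] w_low w_c that \<epsilon>[of i j] by (auto simp: less_Suc_eq)
  qed
  then show ?case by blast
qed simp

lemma vanish_taylor:
  assumes "f \<in> poly_fun N"
  shows "vanish N p 2 (\<lambda>z. f z - f p - dif N f p (\<lambda>k. z k - p k))"
    and "vanish N p 1 (\<lambda>z. f z - f p)"
proof -
  have lin: "vanish N p 1 (\<lambda>z. dif N f p (\<lambda>k. z k - p k))" for f
  proof -
    have eq: "(\<lambda>z. dif N f p (\<lambda>k. z k - p k)) =
      (\<Sum>k<N. (\<lambda>z. pderivative k f p) * ((\<lambda>z. z k) - (\<lambda>z. p k)))"
      by (simp add: fun_eq_iff dif_def sum_fun_apply times_fun_apply minus_apply)
    show ?thesis unfolding eq One_nat_def
      by (intro vanish_sum vanish_scale vanish_coord poly_fun.const) simp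
  qed
  show *: "vanish N p 2 (\<lambda>z. f z - f p - dif N f p (\<lambda>k. z k - p k))"
    using assms
  proof (induction rule: poly_fun.induct)
    case (const c)
    then show ?case using vanish.zero[of N p 2] by (simp add: dif_simps zero_fun_def)
  next
    case (coord k)
    then show ?case using vanish.zero[of N p 2] by (simp add: dif_simps zero_fun_def)
  next
    case (add f g)
    have "(\<lambda>z. f z + g z - (f p + g p) - dif N (\<lambda>z. f z + g z) p (\<lambda>k. z k - p k)) =
      (\<lambda>z. f z - f p - dif N f p (\<lambda>k. z k - p k)) + (\<lambda>z. g z - g p - dif N g p (\<lambda>k. z k - p k))"
      using add(1,2) by (auto simp: dif_simps fun_eq_iff plus_fun_apply)
    then show ?case using vanish.add[OF add(3,4)] by (simp only:)
  next
    case (mult f g)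
    let ?df = "\<lambda>z. dif N f p (\<lambda>k. z k - p k)" and ?dg = "\<lambda>z. dif N g p (\<lambda>k. z k - p k)"
    \<comment> \<open>The first term is a product of two linear parts; the others contain the second
      order remainders of \<open>f\<close> and \<open>g\<close>.\<close>
    have eq: "(\<lambda>z. f z * g z - f p * g p - dif N (\<lambda>z. f z * g z) p (\<lambda>k. z k - p k)) =
      ?df * ?dg + (g * (\<lambda>z. f z - f p - ?df z) + ((\<lambda>z. f p) + ?df) * (\<lambda>z. g z - g p - ?dg z))"
      using mult(1,2)
      by (auto simp: dif_simps fun_eq_iff plus_fun_apply times_fun_apply algebra_simps)
    have "vanish N p (1 + 1) (?df * ?dg)" by (intro vanish_mult lin)
    then have "vanish N p 2 (?df * ?dg)" by (simp only: one_add_one)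
    then show ?case unfolding eq
      by (rule vanish.add[OF _ vanish.add[OF vanish_scale[OF mult(3,2)] vanish_scale[OF mult(4)]]])
        (intro poly_fun_algebra poly_fun.const vanish_poly_fun[OF lin])
  qed
  have "vanish N p 1 (\<lambda>z. f z - f p - dif N f p (\<lambda>k. z k - p k))"
    using vanish_Suc[of N p 1] * by (simp add: numeral_2_eq_2)
  from vanish.add[OF this lin[of f]] show "vanish N p 1 (\<lambda>z. f z - f p)"
    by (simp add: plus_fun_def)
qed

text \<open>The rules copy those of \<open>vanish\<close>, with coordinates in place of shifted
  coordinates, so that leading forms can be read off by induction on \<open>vanish\<close>. The zero
  function counts as homogeneous of every degree.\<close>

inductive homog :: "nat \<Rightarrow> nat \<Rightarrow> ((nat \<Rightarrow> complex) \<Rightarrow> complex) \<Rightarrow> bool" for N where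
  const: "homog N 0 (\<lambda>z. c)"
| zero: "homog N n 0"
| add: "homog N n f \<Longrightarrow> homog N n g \<Longrightarrow> homog N n (f + g)"
| step: "k < N \<Longrightarrow> homog N n f \<Longrightarrow> homog N (Suc n) ((\<lambda>z. z k) * f)"

lemma homog_poly_fun: "homog N n f \<Longrightarrow> f \<in> poly_fun N"
  by (induction rule: homog.induct) (auto intro!: poly_fun_algebra poly_fun.intros)

lemma homog_scale: "homog N n f \<Longrightarrow> f (\<lambda>k. t * v k) = t ^ n * f v"
  by (induction rule: homog.induct) (auto simp: fun_algebra_apply algebra_simps)

lemma vanish_homog: "homog N n f \<Longrightarrow> vanish N p n (\<lambda>z. f (\<lambda>k. z k - p k))"
proof (induction rule: homog.induct)
  case (const c)
  then show ?case by (intro vanish.base poly_fun.const)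
next
  case (zero n)
  then show ?case using vanish.zero[of N p n] by (simp add: zero_fun_def)
next
  case (add n f g)
  then show ?case using vanish.add[OF add(3,4)] by (simp add: plus_fun_def)
next
  case (step k n f)
  then show ?case using vanish.step[OF step(1,3)] by (simp add: times_fun_def fun_diff_def)
qed

text \<open>Represents the class of \<open>f\<close> in the quotient of two successive powers of the
  maximal ideal by a form in the shifted coordinates.\<close>

lemma vanish_homog_part:
  "vanish N p n f \<Longrightarrow> \<exists>H. homog N n H \<and> vanish N p (Suc n) (f - (\<lambda>z. H (\<lambda>k. z k - p k)))"
proof (induction rule: vanish.induct)
  case (base f)
  then show ?case using vanish_taylor(2)[OF base, of p] homog.const
    by (intro exI[of _ "\<lambda>_. f p"]) (auto simp: fun_diff_def)
next
  case (zero n)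
  then show ?case using homog.zero vanish.zero
    by (intro exI[of _ 0]) (auto simp: fun_diff_def zero_fun_def)
next
  case (add n f g)
  then obtain G H where *: "homog N n G" "vanish N p (Suc n) (f - (\<lambda>z. G (\<lambda>k. z k - p k)))"
    "homog N n H" "vanish N p (Suc n) (g - (\<lambda>z. H (\<lambda>k. z k - p k)))" by blast
  have "f + g - (\<lambda>z. (G + H) (\<lambda>k. z k - p k)) =
    (f - (\<lambda>z. G (\<lambda>k. z k - p k))) + (g - (\<lambda>z. H (\<lambda>k. z k - p k)))"
    by (auto simp: fun_eq_iff fun_algebra_apply minus_apply)
  then have "vanish N p (Suc n) (f + g - (\<lambda>z. (G + H) (\<lambda>k. z k - p k)))"
    using vanish.add[OF *(2,4)] by (simp only:)
  then show ?case using homog.add[OF *(1,3)] by blast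
next
  case (step k n f)
  then obtain H where *: "homog N n H" "vanish N p (Suc n) (f - (\<lambda>z. H (\<lambda>k. z k - p k)))" by blast
  have "((\<lambda>z. z k) - (\<lambda>z. p k)) * f - (\<lambda>z. ((\<lambda>z. z k) * H) (\<lambda>k. z k - p k)) =
    ((\<lambda>z. z k) - (\<lambda>z. p k)) * (f - (\<lambda>z. H (\<lambda>k. z k - p k)))"
    by (auto simp: fun_eq_iff fun_algebra_apply minus_apply algebra_simps)
  then have "vanish N p (Suc (Suc n))
      (((\<lambda>z. z k) - (\<lambda>z. p k)) * f - (\<lambda>z. ((\<lambda>z. z k) * H) (\<lambda>k. z k - p k)))"
    using vanish.step[OF step(1) *(2)] by (simp only:)
  then show ?case using homog.step[OF step(1) *(1)] by blast
qed

section \<open>Finitely generated ideals and the order of vanishing modulo an ideal\<close>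

definition gen_ideal :: "nat \<Rightarrow> nat \<Rightarrow> (nat \<Rightarrow> (nat \<Rightarrow> complex) \<Rightarrow> complex) \<Rightarrow> ((nat \<Rightarrow> complex) \<Rightarrow> complex) set"
  where "gen_ideal N c F = {\<Sum>j<c. r j * F j |r. \<forall>j<c. r j \<in> poly_fun N}"

lemma gen_ideal_is_ideal:
  assumes "\<And>j. j < c \<Longrightarrow> F j \<in> poly_fun N"
  shows "is_ideal (poly_fun N) (gen_ideal N c F)"
  unfolding is_ideal_def
proof (intro conjI ballI subsetI)
  show "f \<in> poly_fun N" if "f \<in> gen_ideal N c F" for f
    using that assms by (auto simp: gen_ideal_def intro!: is_subring_sum[OF is_subring_poly_fun] poly_fun_algebra)
  show "0 \<in> gen_ideal N c F"
    unfolding gen_ideal_def by (intro CollectI exI[of _ "\<lambda>_. 0"]) (simp add: poly_fun_algebra)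
  show "f + g \<in> gen_ideal N c F" if fg: "f \<in> gen_ideal N c F" "g \<in> gen_ideal N c F" for f g
  proof -
    obtain r s where *: "f = (\<Sum>j<c. r j * F j)" "g = (\<Sum>j<c. s j * F j)"
      "\<forall>j<c. r j \<in> poly_fun N" "\<forall>j<c. s j \<in> poly_fun N" using fg unfolding gen_ideal_def by blast
    have "f + g = (\<Sum>j<c. (r j + s j) * F j)" by (simp only: * distrib_right sum.distrib)
    then show ?thesis unfolding gen_ideal_def
      using *(3,4) by (intro CollectI exI[of _ "\<lambda>j. r j + s j"] conjI) (auto intro: poly_fun_algebra(1))
  qed
  show "q * f \<in> gen_ideal N c F" if qf: "q \<in> poly_fun N" "f \<in> gen_ideal N c F" for q f
  proof -
    obtain r where *: "f = (\<Sum>j<c. r j * F j)" "\<forall>j<c. r j \<in> poly_fun N"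
      using qf(2) unfolding gen_ideal_def by blast
    have "q * f = (\<Sum>j<c. (q * r j) * F j)" by (simp only: * sum_distrib_left mult.assoc)
    then show ?thesis unfolding gen_ideal_def
      using *(2) qf(1) by (intro CollectI exI[of _ "\<lambda>j. q * r j"] conjI) (auto intro: poly_fun_algebra(2))
  qed
qed

lemma gen_ideal_member:
  assumes "j < c" shows "F j \<in> gen_ideal N c F"
proof -
  have "F j = (\<Sum>i<c. (if i = j then 1 else 0) * F i)"
    using assms by (simp add: if_distrib[of "\<lambda>x. x * _"] cong: if_cong)
  then show ?thesis unfolding gen_ideal_def
    by (intro CollectI exI[of _ "\<lambda>i. if i = j then 1 else 0"] conjI) (simp_all add: poly_fun_algebra)
qed

text \<open>The sum of \<open>K\<close> and the \<open>n\<close>-th power of the maximal ideal at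
  \<open>p\<close>, that is, the elements of order at least \<open>n\<close> modulo
  \<open>K\<close>.\<close>

definition adic :: "nat \<Rightarrow> (nat \<Rightarrow> complex) \<Rightarrow> ((nat \<Rightarrow> complex) \<Rightarrow> complex) set \<Rightarrow> nat \<Rightarrow>
    ((nat \<Rightarrow> complex) \<Rightarrow> complex) set" where
  "adic N p K n = {f. \<exists>k\<in>K. vanish N p n (f - k)}"

lemma adic_rules:
  assumes K: "is_ideal (poly_fun N) K"
  shows "k \<in> K \<Longrightarrow> k \<in> adic N p K n" "vanish N p n f \<Longrightarrow> f \<in> adic N p K n"
    "f \<in> adic N p K n \<Longrightarrow> g \<in> adic N p K n \<Longrightarrow> f + g \<in> adic N p K n"
    "vanish N p m g \<Longrightarrow> f \<in> adic N p K n \<Longrightarrow> g * f \<in> adic N p K (m + n)"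
proof -
  show "k \<in> K \<Longrightarrow> k \<in> adic N p K n"
    using vanish.zero by (auto simp: adic_def intro!: bexI[of _ k])
  show "vanish N p n f \<Longrightarrow> f \<in> adic N p K n"
    using is_idealD(2)[OF K] by (auto simp: adic_def intro!: bexI[of _ 0])
  show "f + g \<in> adic N p K n" if fg: "f \<in> adic N p K n" "g \<in> adic N p K n"
  proof -
    obtain k l where *: "k \<in> K" "l \<in> K" "vanish N p n (f - k)" "vanish N p n (g - l)"
      using fg unfolding adic_def by blast
    have "(f - k) + (g - l) = f + g - (k + l)" by simp
    then have "vanish N p n (f + g - (k + l))" using vanish.add[OF *(3,4)] by (simp only:)
    then show ?thesis using is_idealD(3)[OF K *(1,2)] unfolding adic_def by blast
  qed
  show "g * f \<in> adic N p K (m + n)" if gf: "vanish N p m g" "f \<in> adic N p K n"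
  proof -
    obtain k where *: "k \<in> K" "vanish N p n (f - k)" using gf(2) unfolding adic_def by blast
    have "vanish N p (m + n) (g * (f - k))" by (rule vanish_mult[OF gf(1) *(2)])
    then have "vanish N p (m + n) (g * f - g * k)" by (simp only: right_diff_distrib)
    then show ?thesis using is_idealD(4)[OF K vanish_poly_fun[OF gf(1)] *(1)]
      unfolding adic_def by blast
  qed
qed

lemma adic_sum:
  assumes "is_ideal (poly_fun N) K" "\<And>i. i \<in> S \<Longrightarrow> f i \<in> adic N p K n"
  shows "sum f S \<in> adic N p K n"
  using assms(2)
  by (induction S rule: infinite_finite_induct)
    (auto intro: adic_rules(1,3)[OF assms(1)] is_idealD(2)[OF assms(1)])

section \<open>Prime ideals at nonsingular points\<close>

definition curve :: "(nat \<Rightarrow> complex poly) \<Rightarrow> complex \<Rightarrow> nat \<Rightarrow> complex" where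
  "curve \<gamma> t = (\<lambda>j. poly (\<gamma> j) t)"

lemma poly_split: "\<exists>q'. \<forall>t. poly q t = poly q 0 + t * poly q' t"
  by (cases q) auto

lemma poly_fun_curve: "f \<in> poly_fun N \<Longrightarrow> \<exists>q. \<forall>t. f (curve \<gamma> t) = poly q t"
proof (induction rule: poly_fun.induct)
  case (const c)
  then show ?case by (intro exI[of _ "[:c:]"]) simp
next
  case (coord k)
  then show ?case by (auto simp: curve_def)
next
  case (add f g)
  then obtain q r where "\<forall>t. f (curve \<gamma> t) = poly q t" "\<forall>t. g (curve \<gamma> t) = poly r t" by blast
  then show ?case by (intro exI[of _ "q + r"]) simp
next
  case (mult f g)
  then obtain q r where "\<forall>t. f (curve \<gamma> t) = poly q t" "\<forall>t. g (curve \<gamma> t) = poly r t" by blast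
  then show ?case by (intro exI[of _ "q * r"]) simp
qed

text \<open>The differential may be taken at the starting point of the curve, since moving it along
  the curve costs a factor \<open>t\<close>. The quadratic terms carry \<open>t ^ (2 * m)\<close>,
  which \<open>0 < m\<close> makes divisible by \<open>t ^ Suc m\<close>.\<close>

lemma poly_fun_curve_perturb:
  assumes "f \<in> poly_fun N" "0 < m"
  shows "\<exists>q. \<forall>t. f (\<lambda>j. curve \<gamma> t j + t ^ m * \<epsilon> j) =
    f (curve \<gamma> t) + t ^ m * dif N f (curve \<gamma> 0) \<epsilon> + t ^ Suc m * poly q t"
  using assms(1)
proof (induction rule: poly_fun.induct)
  case (const c)
  then show ?case by (intro exI[of _ 0]) (simp add: dif_simps)
next
  case (coord k)
  then show ?case by (intro exI[of _ 0]) (simp add: dif_simps)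
next
  case (add f g)
  then obtain q r where
    "\<forall>t. f (\<lambda>j. curve \<gamma> t j + t ^ m * \<epsilon> j) =
      f (curve \<gamma> t) + t ^ m * dif N f (curve \<gamma> 0) \<epsilon> + t ^ Suc m * poly q t"
    "\<forall>t. g (\<lambda>j. curve \<gamma> t j + t ^ m * \<epsilon> j) =
      g (curve \<gamma> t) + t ^ m * dif N g (curve \<gamma> 0) \<epsilon> + t ^ Suc m * poly r t" by blast
  then show ?case using add(1,2)
    by (intro exI[of _ "q + r"]) (simp add: dif_simps algebra_simps)
next
  case (mult f g)
  then obtain q r where q: "\<And>t. f (\<lambda>j. curve \<gamma> t j + t ^ m * \<epsilon> j) =
      f (curve \<gamma> t) + t ^ m * dif N f (curve \<gamma> 0) \<epsilon> + t ^ Suc m * poly q t"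
    and r: "\<And>t. g (\<lambda>j. curve \<gamma> t j + t ^ m * \<epsilon> j) =
      g (curve \<gamma> t) + t ^ m * dif N g (curve \<gamma> 0) \<epsilon> + t ^ Suc m * poly r t" by blast
  obtain u v where u: "\<And>t. f (curve \<gamma> t) = poly u t" and v: "\<And>t. g (curve \<gamma> t) = poly v t"
    using poly_fun_curve mult(1,2) by metis
  obtain u' v' where u': "\<And>t. poly u t = poly u 0 + t * poly u' t"
    and v': "\<And>t. poly v t = poly v 0 + t * poly v' t"
    using poly_split by metis
  define a b where "a = dif N f (curve \<gamma> 0) \<epsilon>" and "b = dif N g (curve \<gamma> 0) \<epsilon>"
  obtain m' where m: "m = Suc m'" using assms(2) by (cases m) auto
  \<comment> \<open>All terms of the product that are divisible by \<open>t ^ Suc m\<close>, divided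
    by it. The product of the two linear terms has order \<open>2 * m = m' + Suc m\<close>, whence
    the factor \<open>monom 1 m'\<close>.\<close>
  let ?s = "smult b u' + smult a v' + u * r + q * v + monom 1 m' * [:a * b:]
    + monom 1 m * (smult a r + smult b q) + monom 1 (Suc m) * (q * r)"
  have "(poly u t + t ^ m * a + t ^ Suc m * poly q t) * (poly v t + t ^ m * b + t ^ Suc m * poly r t) =
    poly u t * poly v t + t ^ m * (poly u 0 * b + poly v 0 * a) + t ^ Suc m * poly ?s t" for t
  proof -
    have 0: "poly u 0 = poly u t - t * poly u' t" "poly v 0 = poly v t - t * poly v' t"
      using u'[of t] v'[of t] by simp_all
    show ?thesis unfolding 0 by (simp add: poly_monom m algebra_simps)
  qed
  then have "f (\<lambda>j. curve \<gamma> t j + t ^ m * \<epsilon> j) * g (\<lambda>j. curve \<gamma> t j + t ^ m * \<epsilon> j) =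
    f (curve \<gamma> t) * g (curve \<gamma> t) + t ^ m * dif N (\<lambda>z. f z * g z) (curve \<gamma> 0) \<epsilon>
    + t ^ Suc m * poly ?s t" for t
    unfolding q r dif_simps(4)[OF mult(1,2)] u v a_def b_def .
  then show ?case by (intro exI[of _ ?s]) blast
qed

lemma vanish_curve:
  assumes "vanish N p n f" "\<And>j. poly (\<gamma> j) 0 = p j"
  shows "\<exists>q. \<forall>t. f (curve \<gamma> t) = t ^ n * poly q t"
  using assms(1)
proof (induction rule: vanish.induct)
  case (base f)
  then show ?case using poly_fun_curve by simp
next
  case (zero n)
  then show ?case by (intro exI[of _ 0]) (simp add: zero_fun_apply)
next
  case (add n f g)
  then obtain q r where "\<forall>t. f (curve \<gamma> t) = t ^ n * poly q t" "\<forall>t. g (curve \<gamma> t) = t ^ n * poly r t" by blast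
  then show ?case by (intro exI[of _ "q + r"]) (simp add: plus_fun_apply algebra_simps)
next
  case (step k n f)
  then obtain q where q: "\<And>t. f (curve \<gamma> t) = t ^ n * poly q t" by blast
  obtain r where "\<And>t. poly (\<gamma> k) t = p k + t * poly r t" using poly_split[of "\<gamma> k"] assms(2) by auto
  then have "curve \<gamma> t k - p k = t * poly r t" for t by (simp add: curve_def)
  then show ?case using q
    by (intro exI[of _ "q * r"]) (simp add: times_fun_apply minus_apply algebra_simps)
qed

text \<open>Newton iteration: the dual vectors \<open>\<epsilon>\<close> invert the differentials of \<open>F\<close>.\<close>

lemma approximate_curve:
  fixes c :: nat
  assumes F: "\<And>j. j < c \<Longrightarrow> F j \<in> poly_fun N" "\<And>j. j < c \<Longrightarrow> F j p = 0"
    and \<epsilon>: "\<And>i j. i < c \<Longrightarrow> j < c \<Longrightarrow> dif N (F i) p (\<epsilon> j) = (if i = j then 1 else 0)"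
    and \<delta>: "\<And>j. j < c \<Longrightarrow> dif N (F j) p \<delta> = 0"
  shows "\<exists>\<eta>. (\<forall>j. poly (\<eta> j) 0 = \<delta> j) \<and>
    (\<forall>j<c. \<exists>q. \<forall>t. F j (curve (\<lambda>j. pCons (p j) (\<eta> j)) t) = t ^ (n + 2) * poly q t)"
proof (induction n)
  case 0
  \<comment> \<open>The straight line in the direction \<delta> satisfies the equations to order two
    because \<delta> is tangent.\<close>
  have "\<exists>q. \<forall>t. F j (curve (\<lambda>j. pCons (p j) [:\<delta> j:]) t) = t ^ (0 + 2) * poly q t" if j: "j < c" for j
  proof -
    obtain q where q: "\<And>t. F j (\<lambda>i. curve (\<lambda>j. [:p j:]) t i + t ^ 1 * \<delta> i) =
        F j (curve (\<lambda>j. [:p j:]) t) + t ^ 1 * dif N (F j) (curve (\<lambda>j. [:p j:]) 0) \<delta> + t ^ Suc 1 * poly q t"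
      using poly_fun_curve_perturb[OF F(1)[OF j], of 1 "\<lambda>j. [:p j:]" \<delta>] by auto
    have "curve (\<lambda>j. [:p j:]) t = p" for t by (simp add: curve_def)
    then have "F j (curve (\<lambda>j. pCons (p j) [:\<delta> j:]) t) = t ^ (0 + 2) * poly q t" for t
      using q[of t] F(2)[OF j] \<delta>[OF j] by (simp add: curve_def power2_eq_square)
    then show ?thesis by blast
  qed
  then show ?case by (intro exI[of _ "\<lambda>j. [:\<delta> j:]"]) simp
next
  case (Suc n)
  then obtain \<eta> where \<eta>: "\<And>j. poly (\<eta> j) 0 = \<delta> j"
    "\<forall>j<c. \<exists>q. \<forall>t. F j (curve (\<lambda>j. pCons (p j) (\<eta> j)) t) = t ^ (n + 2) * poly q t" by blast
  let ?\<gamma> = "\<lambda>j. pCons (p j) (\<eta> j)"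
  have "\<forall>j\<in>{..<c}. \<exists>q. \<forall>t. F j (curve ?\<gamma> t) = t ^ (n + 2) * poly q t" using \<eta>(2) by blast
  from bchoice[OF this]
  obtain q where q: "\<And>j t. j < c \<Longrightarrow> F j (curve ?\<gamma> t) = t ^ (n + 2) * poly (q j) t"
    by blast
  \<comment> \<open>The curve is to be changed by \<open>t ^ (n + 2) * e\<close>. The dual vectors
    allow a choice of \<open>e\<close> for which the differential of every \<open>F j\<close>
    cancels the leading coefficient \<open>poly (q j) 0\<close>.\<close>
  define e where "e k = (\<Sum>i<c. (- poly (q i) 0) * \<epsilon> i k)" for k
  \<comment> \<open>The curve is \<open>p j\<close> plus \<open>t\<close> times
    \<open>\<eta> j\<close>, so a correction of order \<open>n + 2\<close> enters
    \<open>\<eta>\<close> with exponent \<open>Suc n\<close>. This exponent is positive, and the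
    initial direction stays \<delta>.\<close>
  define \<eta>' where "\<eta>' j = \<eta> j + monom (e j) (Suc n)" for j
  have "\<exists>r. \<forall>t. F j (curve (\<lambda>j. pCons (p j) (\<eta>' j)) t) = t ^ (Suc n + 2) * poly r t" if j: "j < c" for j
  proof -
    have 0: "curve ?\<gamma> 0 = p" by (simp add: curve_def)
    have de: "dif N (F j) p e = - poly (q j) 0"
    proof -
      have "dif N (F j) p e = (\<Sum>i<c. (- poly (q i) 0) * dif N (F j) p (\<epsilon> i))"
        unfolding e_def by (rule dif_linear(4))
      also have "\<dots> = (\<Sum>i<c. if i = j then - poly (q j) 0 else 0)"
        by (rule sum.cong) (use \<epsilon> j in auto)
      also have "\<dots> = - poly (q j) 0" by (subst sum.delta) (use j in auto)
      finally show ?thesis .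
    qed
    obtain r where r: "\<And>t. F j (\<lambda>i. curve ?\<gamma> t i + t ^ (n + 2) * e i) =
        F j (curve ?\<gamma> t) + t ^ (n + 2) * dif N (F j) (curve ?\<gamma> 0) e + t ^ Suc (n + 2) * poly r t"
      using poly_fun_curve_perturb[OF F(1)[OF j], of "n + 2" ?\<gamma> e] by auto
    obtain q' where q': "\<And>t. poly (q j) t = poly (q j) 0 + t * poly q' t" using poly_split by metis
    have eq: "curve (\<lambda>j. pCons (p j) (\<eta>' j)) t = (\<lambda>i. curve ?\<gamma> t i + t ^ (n + 2) * e i)" for t
      by (simp add: curve_def \<eta>'_def poly_monom algebra_simps)
    have "F j (curve (\<lambda>j. pCons (p j) (\<eta>' j)) t) = t ^ (Suc n + 2) * poly (q' + r) t" for t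
    proof -
      have "F j (curve (\<lambda>j. pCons (p j) (\<eta>' j)) t) =
        t ^ (n + 2) * poly (q j) t + t ^ (n + 2) * (- poly (q j) 0) + t ^ Suc (n + 2) * poly r t"
        unfolding eq r q[OF j] 0 de ..
      then show ?thesis by (subst (asm) q') (simp add: algebra_simps)
    qed
    then show ?thesis by blast
  qed
  moreover have "poly (\<eta>' j) 0 = \<delta> j" for j by (simp add: \<eta>'_def \<eta>(1) poly_monom)
  ultimately show ?case by blast
qed

section \<open>Localised ideals and initial forms\<close>

definition independent_at :: "nat \<Rightarrow> nat \<Rightarrow> (nat \<Rightarrow> (nat \<Rightarrow> complex) \<Rightarrow> complex) \<Rightarrow> (nat \<Rightarrow> complex) \<Rightarrow> bool" where
  "independent_at N c F p \<longleftrightarrow>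
    (\<forall>a. (\<forall>k<N. (\<Sum>j<c. a j * pderivative k (F j) p) = 0) \<longrightarrow> (\<forall>j<c. a j = 0))"

text \<open>The polynomials whose image in the local ring at \<open>p\<close> lies in the ideal
  generated by \<open>K\<close>. Fractions are avoided by multipliers that do not vanish at
  \<open>p\<close>.\<close>

definition local_ideal :: "nat \<Rightarrow> (nat \<Rightarrow> complex) \<Rightarrow> ((nat \<Rightarrow> complex) \<Rightarrow> complex) set \<Rightarrow>
    ((nat \<Rightarrow> complex) \<Rightarrow> complex) set" where
  "local_ideal N p K = {f \<in> poly_fun N. \<exists>q\<in>poly_fun N. q p \<noteq> 0 \<and> q * f \<in> K}"

text \<open>As \<open>F j\<close> vanishes at \<open>p\<close>, it agrees with its differential up
  to order two; modulo the ideal the differential itself therefore has order two. Subtracting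
  multiples of the differentials from the arguments of a form of degree \<open>e\<close> changes the
  form only in order \<open>Suc e\<close>.\<close>

lemma homog_tangent:
  assumes F: "\<And>j. j < c \<Longrightarrow> F j \<in> poly_fun N" "\<And>j. j < c \<Longrightarrow> F j p = 0"
    and H: "homog N e H"
  shows "(\<lambda>z. H (\<lambda>k. z k - p k) - H (\<lambda>k. (z k - p k) - (\<Sum>j<c. dif N (F j) p (\<lambda>k. z k - p k) * \<epsilon> j k)))
    \<in> adic N p (gen_ideal N c F) (Suc e)"
proof -
  have K: "is_ideal (poly_fun N) (gen_ideal N c F)" by (rule gen_ideal_is_ideal) (rule F(1))
  note A = adic_rules[OF K]
  show ?thesis using H
  proof (induction rule: homog.induct)
    case (const a)
    then show ?case using A(2)[OF vanish.zero] by (simp add: zero_fun_def)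
  next
    case (zero n)
    then show ?case using A(2)[OF vanish.zero] by (simp add: zero_fun_def)
  next
    case (add n f g)
    then show ?case using A(3)[OF add(3,4)] by (simp add: plus_fun_def algebra_simps)
  next
    case (step k n H)
    let ?w = "\<lambda>z k. z k - p k"
    let ?d = "\<lambda>j z. dif N (F j) p (?w z)"
    let ?\<pi> = "\<lambda>z k. ?w z k - (\<Sum>j<c. ?d j z * \<epsilon> j k)"
    have d: "?d j \<in> adic N p (gen_ideal N c F) 2" if j: "j < c" for j
    proof -
      have eq: "?d j = F j + - (\<lambda>z. F j z - F j p - ?d j z)"
        using F(2)[OF j] by (auto simp: fun_eq_iff plus_fun_apply uminus_apply minus_apply)
      show ?thesis
        by (subst eq) (intro A(3) A(1)[OF gen_ideal_member[of j c F N]] A(2) vanish_minus vanish_taylor(1) F(1) j)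
    qed
    have dv: "vanish N p 1 (?d j)" if j: "j < c" for j
    proof -
      have eq: "?d j = (\<lambda>z. F j z - F j p) + - (\<lambda>z. F j z - F j p - ?d j z)"
        by (auto simp: fun_eq_iff plus_fun_apply uminus_apply minus_apply)
      have "vanish N p 1 (\<lambda>z. F j z - F j p - ?d j z)"
        using vanish_Suc[of N p 1] vanish_taylor(1)[OF F(1)[OF j]] by (simp add: numeral_2_eq_2)
      then show ?thesis by (subst eq) (intro vanish.add vanish_taylor(2) F(1) j vanish_minus)
    qed
    have \<pi>v: "vanish N p 1 (\<lambda>z. ?\<pi> z k)"
    proof -
      have eq: "(\<lambda>z. ?\<pi> z k) = ((\<lambda>z. z k) - (\<lambda>z. p k)) + - (\<Sum>j<c. (\<lambda>z. \<epsilon> j k) * ?d j)"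
        by (simp add: fun_eq_iff plus_fun_apply uminus_apply minus_apply sum_fun_apply times_fun_apply mult.commute)
      show ?thesis unfolding eq
        by (intro vanish.add vanish_minus vanish_sum vanish_scale dv poly_fun.const)
          (use vanish_coord[OF step(1)] in simp_all)
    qed
    have s1: "(\<Sum>j<c. ((\<lambda>z. \<epsilon> j k) * (\<lambda>z. H (?w z))) * ?d j) \<in> adic N p (gen_ideal N c F) (n + 2)"
      by (intro adic_sum[OF K] A(4) d vanish_scale vanish_homog step(2) poly_fun.const) auto
    have s2: "(\<lambda>z. ?\<pi> z k) * (\<lambda>z. H (?w z) - H (?\<pi> z)) \<in> adic N p (gen_ideal N c F) (1 + Suc n)"
      by (rule A(4)[OF \<pi>v step(3)])
    have "(\<lambda>z. ((\<lambda>z. z k) * H) (?w z) - ((\<lambda>z. z k) * H) (?\<pi> z)) =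
      (\<Sum>j<c. ((\<lambda>z. \<epsilon> j k) * (\<lambda>z. H (?w z))) * ?d j) + (\<lambda>z. ?\<pi> z k) * (\<lambda>z. H (?w z) - H (?\<pi> z))"
      by (simp add: fun_eq_iff plus_fun_apply sum_fun_apply times_fun_apply algebra_simps sum_distrib_left sum_distrib_right)
    moreover have "n + 2 = Suc (Suc n)" "1 + Suc n = Suc (Suc n)" by simp_all
    ultimately show ?case using A(3)[OF s1[unfolded \<open>n + 2 = _\<close>] s2[unfolded \<open>1 + Suc n = _\<close>]]
      by (simp only:)
  qed
qed

text \<open>By Krull's theorem there is a largest \<open>e\<close> for which \<open>f\<close> has
  order \<open>e\<close> modulo the ideal; \<open>H\<close> is a leading form in that degree. The
  map \<open>?\<pi>\<close> projects onto the common kernel of the differentials. If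
  \<open>H\<close> vanished on this kernel, \<open>homog_tangent\<close> would raise the order of
  \<open>f\<close> by one.\<close>

lemma initial_form:
  assumes F: "\<And>j. j < c \<Longrightarrow> F j \<in> poly_fun N" "\<And>j. j < c \<Longrightarrow> F j p = 0"
    and \<epsilon>: "\<And>i j. i < c \<Longrightarrow> j < c \<Longrightarrow> dif N (F i) p (\<epsilon> j) = (if i = j then 1 else 0)"
    and f: "f \<in> poly_fun N" "f \<notin> local_ideal N p (gen_ideal N c F)"
  shows "\<exists>e H \<delta>. homog N e H \<and> (\<forall>j<c. dif N (F j) p \<delta> = 0) \<and> H \<delta> \<noteq> 0 \<and>
    f - (\<lambda>z. H (\<lambda>k. z k - p k)) \<in> adic N p (gen_ideal N c F) (Suc e)"
proof -
  let ?K = "gen_ideal N c F"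
  have K: "is_ideal (poly_fun N) (gen_ideal N c F)" by (rule gen_ideal_is_ideal) (rule F(1))
  note A = adic_rules[OF K]
  have "\<exists>n. f \<notin> adic N p ?K n"
  proof (rule ccontr)
    assume "\<not> ?thesis"
    then have "\<exists>q\<in>poly_fun N. q p \<noteq> 0 \<and> q * f \<in> ?K"
      by (intro krull_intersection[OF K f(1), of p]) (auto simp: adic_def)
    then show False using f by (auto simp: local_ideal_def)
  qed
  then obtain n where n: "f \<notin> adic N p ?K n" "\<And>m. m < n \<Longrightarrow> f \<in> adic N p ?K m"
    using exists_least_iff[of "\<lambda>n. f \<notin> adic N p ?K n"] by blast
  have "n \<noteq> 0" using n(1) A(2)[OF vanish.base[OF f(1)]] by metis
  then obtain e where e: "n = Suc e" by (cases n) auto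
  then obtain k where k: "k \<in> ?K" "vanish N p e (f - k)" using n(2)[of e] by (auto simp: adic_def)
  obtain H where H: "homog N e H" "vanish N p (Suc e) (f - k - (\<lambda>z. H (\<lambda>k. z k - p k)))"
    using vanish_homog_part[OF k(2)] by blast
  have "f - (\<lambda>z. H (\<lambda>k. z k - p k)) = k + (f - k - (\<lambda>z. H (\<lambda>k. z k - p k)))" by simp
  then have fH: "f - (\<lambda>z. H (\<lambda>k. z k - p k)) \<in> adic N p ?K (Suc e)"
    using A(3)[OF A(1)[OF k(1)] A(2)[OF H(2)]] by (simp only:)
  let ?\<pi> = "\<lambda>v k. v k - (\<Sum>j<c. dif N (F j) p v * \<epsilon> j k)"
  have tangent: "dif N (F i) p (?\<pi> v) = 0" if i: "i < c" for v i
  proof -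
    have "dif N (F i) p (?\<pi> v) = dif N (F i) p v - (\<Sum>j<c. dif N (F j) p v * dif N (F i) p (\<epsilon> j))"
      by (simp add: dif_linear)
    also have "(\<Sum>j<c. dif N (F j) p v * dif N (F i) p (\<epsilon> j)) = (\<Sum>j<c. if j = i then dif N (F i) p v else 0)"
      by (rule sum.cong) (use \<epsilon> i in auto)
    also have "\<dots> = dif N (F i) p v" by (subst sum.delta) (use i in auto)
    finally show ?thesis by simp
  qed
  have "\<exists>v. H (?\<pi> v) \<noteq> 0"
  proof (rule ccontr)
    assume "\<not> ?thesis"
    then have H0: "H (?\<pi> v) = 0" for v by blast
    have "(\<lambda>z. H (\<lambda>k. z k - p k) - H (?\<pi> (\<lambda>k. z k - p k))) \<in> adic N p ?K (Suc e)"
      by (rule homog_tangent[OF _ _ H(1)]) (use F in auto)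
    then have "(\<lambda>z. H (\<lambda>k. z k - p k)) \<in> adic N p ?K (Suc e)" by (simp add: H0)
    then have "f - (\<lambda>z. H (\<lambda>k. z k - p k)) + (\<lambda>z. H (\<lambda>k. z k - p k)) \<in> adic N p ?K (Suc e)"
      using A(3)[OF fH] by blast
    then show False using n(1) e by simp
  qed
  then show ?thesis using H(1) tangent fH by blast
qed

lemma gen_ideal_curve:
  assumes F: "\<And>j. j < c \<Longrightarrow> F j \<in> poly_fun N"
    and \<gamma>: "\<And>j. j < c \<Longrightarrow> \<exists>q. \<forall>t. F j (curve \<gamma> t) = t ^ n * poly q t"
    and k: "k \<in> gen_ideal N c F"
  shows "\<exists>q. \<forall>t. k (curve \<gamma> t) = t ^ n * poly q t"
proof -
  obtain r where r: "k = (\<Sum>j<c. r j * F j)" "\<forall>j<c. r j \<in> poly_fun N"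
    using k unfolding gen_ideal_def by blast
  have "\<forall>j\<in>{..<c}. \<exists>q. \<forall>t. F j (curve \<gamma> t) = t ^ n * poly q t" using \<gamma> by blast
  from bchoice[OF this]
  obtain q where q: "\<And>j t. j < c \<Longrightarrow> F j (curve \<gamma> t) = t ^ n * poly (q j) t" by blast
  have "\<forall>j\<in>{..<c}. \<exists>s. \<forall>t. r j (curve \<gamma> t) = poly s t" using r(2) poly_fun_curve by blast
  from bchoice[OF this]
  obtain s where s: "\<And>j t. j < c \<Longrightarrow> r j (curve \<gamma> t) = poly (s j) t" by blast
  have "k (curve \<gamma> t) = t ^ n * poly (\<Sum>j<c. s j * q j) t" for t
    using q s by (simp add: r(1) sum_fun_apply times_fun_apply poly_sum sum_distrib_left algebra_simps)
  then show ?thesis by blast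
qed

text \<open>Along an arc that starts in the direction \<delta>, homogeneity turns the initial form
  into \<open>t ^ e\<close> times a polynomial with constant term \<open>H \<delta>\<close>. The
  part of \<open>f\<close> in the ideal has order \<open>n > e\<close> and the remainder has order
  \<open>Suc e\<close>, so neither affects that constant term.\<close>

lemma initial_form_curve:
  assumes F: "\<And>j. j < c \<Longrightarrow> F j \<in> poly_fun N"
    and \<eta>: "\<And>j. poly (\<eta> j) 0 = \<delta> j"
      "\<And>j. j < c \<Longrightarrow> \<exists>q. \<forall>t. F j (curve (\<lambda>j. pCons (p j) (\<eta> j)) t) = t ^ n * poly q t"
    and H: "homog N e H" "e < n"
    and f: "f - (\<lambda>z. H (\<lambda>k. z k - p k)) \<in> adic N p (gen_ideal N c F) (Suc e)"
  shows "\<exists>u. poly u 0 = H \<delta> \<and> (\<forall>t. f (curve (\<lambda>j. pCons (p j) (\<eta> j)) t) = t ^ e * poly u t)"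
proof -
  let ?\<gamma> = "\<lambda>j. pCons (p j) (\<eta> j)"
  obtain k where k: "k \<in> gen_ideal N c F" "vanish N p (Suc e) (f - (\<lambda>z. H (\<lambda>k. z k - p k)) - k)"
    using f by (auto simp: adic_def)
  obtain v where v: "\<And>t. (f - (\<lambda>z. H (\<lambda>k. z k - p k)) - k) (curve ?\<gamma> t) = t ^ Suc e * poly v t"
    using vanish_curve[OF k(2), of ?\<gamma>] by auto
  obtain w where w: "\<And>t. k (curve ?\<gamma> t) = t ^ n * poly w t"
    using gen_ideal_curve[OF F \<eta>(2) k(1)] by blast
  obtain h where h: "\<And>t. H (curve \<eta> t) = poly h t"
    using poly_fun_curve[OF homog_poly_fun[OF H(1)]] by blast
  have "(\<lambda>k. curve ?\<gamma> t k - p k) = (\<lambda>k. t * curve \<eta> t k)" for t by (simp add: curve_def)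
  then have H': "H (\<lambda>k. curve ?\<gamma> t k - p k) = t ^ e * poly h t" for t
    using homog_scale[OF H(1), of t "curve \<eta> t"] h by simp
  have "curve \<eta> 0 = \<delta>" using \<eta>(1) by (simp add: curve_def)
  then have h0: "poly h 0 = H \<delta>" using h[of 0] by simp
  obtain m where m: "n = Suc (e + m)" using H(2) less_iff_Suc_add by auto
  have "f (curve ?\<gamma> t) = t ^ e * poly (h + monom 1 1 * v + monom 1 (Suc m) * w) t" for t
  proof -
    have "f (curve ?\<gamma> t) - t ^ e * poly h t - t ^ n * poly w t = t ^ Suc e * poly v t"
      using v[of t] by (simp only: minus_apply w H')
    then have "f (curve ?\<gamma> t) = t ^ e * poly h t + t ^ n * poly w t + t ^ Suc e * poly v t"
      by (simp add: algebra_simps)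
    then show ?thesis by (simp add: poly_monom m power_add algebra_simps)
  qed
  moreover have "poly (h + monom 1 1 * v + monom 1 (Suc m) * w) 0 = H \<delta>"
    by (simp add: h0 poly_monom)
  ultimately show ?thesis by blast
qed

text \<open>
  The tangent cone of the common zero locus of \<open>F\<close> at \<open>p\<close> is a linear space: the product of two
  nonzero initial forms is nonzero at some tangent vector, hence along a curve in that direction.
\<close>

theorem local_gen_ideal_prime:
  assumes F: "\<And>j. j < c \<Longrightarrow> F j \<in> poly_fun N" "\<And>j. j < c \<Longrightarrow> F j p = 0"
    and ind: "independent_at N c F p"
    and fg: "f \<in> poly_fun N" "g \<in> poly_fun N" "f * g \<in> local_ideal N p (gen_ideal N c F)"
  shows "f \<in> local_ideal N p (gen_ideal N c F) \<or> g \<in> local_ideal N p (gen_ideal N c F)"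
proof (rule ccontr)
  assume no: "\<not> ?thesis"
  obtain \<epsilon> where \<epsilon>: "\<And>i j. i < c \<Longrightarrow> j < c \<Longrightarrow> dif N (F i) p (\<epsilon> j) = (if i = j then 1 else 0)"
    using dual_vectors[where N = N and c = c and r = "\<lambda>j k. pderivative k (F j) p"] ind
    unfolding independent_at_def dif_def by blast
  obtain e H \<delta>1 where H: "homog N e H" "\<forall>j<c. dif N (F j) p \<delta>1 = 0" "H \<delta>1 \<noteq> 0"
    "f - (\<lambda>z. H (\<lambda>k. z k - p k)) \<in> adic N p (gen_ideal N c F) (Suc e)"
    using initial_form[OF F \<epsilon> fg(1)] no by blast
  obtain d G \<delta>2 where G: "homog N d G" "\<forall>j<c. dif N (F j) p \<delta>2 = 0" "G \<delta>2 \<noteq> 0"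
    "g - (\<lambda>z. G (\<lambda>k. z k - p k)) \<in> adic N p (gen_ideal N c F) (Suc d)"
    using initial_form[OF F \<epsilon> fg(2)] no by blast
  \<comment> \<open>The line joining the two tangent vectors. Both initial forms restrict to nonzero
    polynomials on it, so some parameter \<open>t0\<close> gives a tangent vector at which neither
    vanishes.\<close>
  let ?l = "\<lambda>j. [:\<delta>1 j, \<delta>2 j - \<delta>1 j:]"
  obtain h l where h: "\<And>t. H (curve ?l t) = poly h t" and l: "\<And>t. G (curve ?l t) = poly l t"
    using poly_fun_curve[OF homog_poly_fun[OF H(1)]] poly_fun_curve[OF homog_poly_fun[OF G(1)]] by blast
  have "curve ?l 0 = \<delta>1" "curve ?l 1 = \<delta>2" by (simp_all add: curve_def)
  then have "poly h 0 \<noteq> 0" "poly l 1 \<noteq> 0" using h[of 0] l[of 1] H(3) G(3) by simp_all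
  then have "h * l \<noteq> 0" by auto
  then obtain t0 where t0: "poly (h * l) t0 \<noteq> 0" using poly_all_0_iff_0 by blast
  define \<delta> where "\<delta> = curve ?l t0"
  have \<delta>0: "H \<delta> \<noteq> 0" "G \<delta> \<noteq> 0" using t0 h l by (auto simp: \<delta>_def)
  have "\<delta> = (\<lambda>k. \<delta>1 k + t0 * (\<delta>2 k - \<delta>1 k))" by (simp add: \<delta>_def curve_def)
  then have "dif N (F j) p \<delta> = 0" if "j < c" for j
    using H(2) G(2) that by (simp only: dif_linear) simp
  \<comment> \<open>The order exceeds \<open>e + d\<close>, the order of \<open>f * g\<close> along
    the arc.\<close>
  then obtain \<eta> where \<eta>: "\<And>j. poly (\<eta> j) 0 = \<delta> j"
    "\<And>j. j < c \<Longrightarrow> \<exists>q. \<forall>t. F j (curve (\<lambda>j. pCons (p j) (\<eta> j)) t) = t ^ (e + d + 2) * poly q t"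
    using approximate_curve[OF F \<epsilon>, where n = "e + d"] by blast
  let ?\<gamma> = "\<lambda>j. pCons (p j) (\<eta> j)"
  have "\<exists>u. poly u 0 = H \<delta> \<and> (\<forall>t. f (curve ?\<gamma> t) = t ^ e * poly u t)"
    by (rule initial_form_curve[OF F(1) \<eta> H(1) _ H(4)]) simp_all
  then obtain u where u: "poly u 0 = H \<delta>" "\<And>t. f (curve ?\<gamma> t) = t ^ e * poly u t" by blast
  have "\<exists>v. poly v 0 = G \<delta> \<and> (\<forall>t. g (curve ?\<gamma> t) = t ^ d * poly v t)"
    by (rule initial_form_curve[OF F(1) \<eta> G(1) _ G(4)]) simp_all
  then obtain v where v: "poly v 0 = G \<delta>" "\<And>t. g (curve ?\<gamma> t) = t ^ d * poly v t" by blast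
  obtain q where q: "q \<in> poly_fun N" "q p \<noteq> 0" "q * (f * g) \<in> gen_ideal N c F"
    using fg(3) by (auto simp: local_ideal_def)
  obtain w where w: "\<And>t. q (curve ?\<gamma> t) = poly w t" using poly_fun_curve[OF q(1)] by blast
  have "curve ?\<gamma> 0 = p" by (simp add: curve_def)
  then have w0: "poly w 0 \<noteq> 0" using w[of 0] q(2) by simp
  obtain y where y: "\<And>t. (q * (f * g)) (curve ?\<gamma> t) = t ^ (e + d + 2) * poly y t"
    using gen_ideal_curve[OF F(1) \<eta>(2) q(3)] by blast
  \<comment> \<open>The values agree for every \<open>t\<close>, so this is an identity of
    polynomials and the power of \<open>t\<close> can be cancelled. At \<open>0\<close> the
    remaining right side vanishes, while the left side is a product of three nonzero values.\<close>
  have eq: "poly (monom 1 (e + d) * (w * u * v)) t = poly (monom 1 (e + d) * (monom 1 2 * y)) t" for t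
    using y[of t] by (simp add: times_fun_apply w u(2) v(2) poly_monom power_add power2_eq_square mult_ac)
  have "monom 1 (e + d) * (w * u * v) = monom 1 (e + d) * (monom 1 2 * y)"
    unfolding poly_eq_poly_eq_iff[symmetric] by (rule ext) (rule eq)
  moreover have "monom (1::complex) (e + d) \<noteq> 0" by (simp add: monom_eq_0_iff)
  ultimately have *: "w * u * v = monom 1 2 * y" by (metis mult_cancel_left)
  have "poly (w * u * v) 0 = poly w 0 * H \<delta> * G \<delta>" by (simp only: poly_mult u(1) v(1))
  moreover have "poly (w * u * v) 0 = 0" unfolding * by (simp add: poly_monom)
  ultimately have "poly w 0 * H \<delta> * G \<delta> = 0" by (rule trans[OF sym])
  then show False using w0 \<delta>0 by simp
qed

section \<open>Affine charts and local rings\<close>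

text \<open>Germs are treated through the filter \<open>nhdsin\<close>: statements valid near a
  point are combined by \<open>eventually_elim\<close> in place of intersecting
  neighbourhoods.\<close>

lemma eventually_near_iff:
  "x \<in> topspace T \<Longrightarrow> eventually P (nhdsin T x) \<longleftrightarrow> (\<exists>U. openin T U \<and> x \<in> U \<and> (\<forall>y\<in>U. P y))"
  by (simp add: eventually_nhdsin)

lemma eventually_near_self: "x \<in> topspace T \<Longrightarrow> eventually P (nhdsin T x) \<Longrightarrow> P x"
  by (auto simp: eventually_near_iff)

lemma topspace_zariski: "topspace (zariski N) = cspace N"
proof -
  have "cspace N \<in> {{z \<in> cspace N. f z \<noteq> 0} |f. f \<in> poly_fun N}"
    by (intro CollectI exI[of _ "\<lambda>_. 1"] conjI) (simp_all add: poly_fun.const)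
  then have "cspace N \<subseteq> \<Union>{{z \<in> cspace N. f z \<noteq> 0} |f. f \<in> poly_fun N}" by (rule Union_upper)
  moreover have "\<Union>{{z \<in> cspace N. f z \<noteq> 0} |f. f \<in> poly_fun N} \<subseteq> cspace N" by auto
  ultimately show ?thesis unfolding zariski_def topology_generated_by_topspace by simp
qed

lemma openin_zariski_basic: "f \<in> poly_fun N \<Longrightarrow> openin (zariski N) {z \<in> cspace N. f z \<noteq> 0}"
  unfolding zariski_def by (rule topology_generated_by_Basis) blast

lemma zariski_basic_neighbourhood:
  assumes "openin (zariski N) V" "p \<in> V"
  shows "\<exists>R\<in>poly_fun N. R p \<noteq> 0 \<and> {z \<in> cspace N. R z \<noteq> 0} \<subseteq> V"
proof -
  have "generate_topology_on {{z \<in> cspace N. f z \<noteq> 0} |f. f \<in> poly_fun N} V"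
    using assms(1) unfolding zariski_def openin_topology_generated_by_iff .
  then show ?thesis using assms(2)
  proof (induction rule: generate_topology_on.induct)
    case (Int a b)
    then obtain R S where "R \<in> poly_fun N" "R p \<noteq> 0" "{z \<in> cspace N. R z \<noteq> 0} \<subseteq> a"
      "S \<in> poly_fun N" "S p \<noteq> 0" "{z \<in> cspace N. S z \<noteq> 0} \<subseteq> b" by blast
    then show ?case by (intro bexI[of _ "\<lambda>z. R z * S z"]) (auto intro: poly_fun.mult)
  next
    case (UN K)
    then obtain k where "k \<in> K" "p \<in> k" by blast
    then show ?case using UN.IH[of k] by blast
  next
    case (Basis s)
    then show ?case by blast
  qed simp
qed

lemma affine_chart_facts:
  assumes "affine_chart X U N Z \<phi>"
  shows "openin (ztop X) U" "inj_on \<phi> U" "\<phi> ` U = Z" "Z \<subseteq> cspace N"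
    and "\<And>W. openin (ztop X) W \<Longrightarrow> W \<subseteq> U \<Longrightarrow> openin (subtopology (zariski N) Z) (\<phi> ` W)"
    and "\<And>V. openin (zariski N) V \<Longrightarrow> openin (ztop X) {y \<in> U. \<phi> y \<in> V}"
    and "\<And>V f. openin (subtopology (zariski N) Z) V \<Longrightarrow>
      f \<in> reg (affine_fspace N Z) V \<longleftrightarrow> f \<circ> \<phi> \<in> reg X {y \<in> U. \<phi> y \<in> V}"
proof -
  show U: "openin (ztop X) U" using assms by (simp add: affine_chart_def)
  show Z: "Z \<subseteq> cspace N"
    using assms closedin_subset[of "zariski N" Z] by (simp add: affine_chart_def topspace_zariski)
  have iso: "fspace_iso (open_subspace X U) (affine_fspace N Z) \<phi>"
    using assms by (simp add: affine_chart_def)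
  have top: "topspace (subtopology (ztop X) U) = U" "topspace (subtopology (zariski N) Z) = Z"
    using openin_subset[OF U] Z by (auto simp: topspace_zariski)
  have h: "homeomorphic_map (subtopology (ztop X) U) (subtopology (zariski N) Z) \<phi>"
    using iso by (simp add: fspace_iso_def open_subspace_def affine_fspace_def)
  show "inj_on \<phi> U" using homeomorphic_imp_injective_map[OF h] by (simp only: top)
  show img: "\<phi> ` U = Z" using homeomorphic_imp_surjective_map[OF h] by (simp only: top)
  show "openin (subtopology (zariski N) Z) (\<phi> ` W)" if "openin (ztop X) W" "W \<subseteq> U" for W
  proof -
    have "openin (subtopology (ztop X) U) W" using that U by (simp add: openin_open_subtopology)
    then show ?thesis using homeomorphic_imp_open_map[OF h] by (simp add: open_map_def)
  qed
  show "openin (ztop X) {y \<in> U. \<phi> y \<in> V}" if V: "openin (zariski N) V" for V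
  proof -
    have "openin (subtopology (zariski N) Z) (V \<inter> Z)" using V by (auto simp: openin_subtopology)
    then have "openin (subtopology (ztop X) U) {y \<in> U. \<phi> y \<in> V \<inter> Z}"
      using homeomorphic_imp_continuous_map[OF h] by (simp only: continuous_map_def top)
    moreover have "{y \<in> U. \<phi> y \<in> V \<inter> Z} = {y \<in> U. \<phi> y \<in> V}" using img by auto
    ultimately show ?thesis using U by (simp add: openin_open_subtopology)
  qed
  show "f \<in> reg (affine_fspace N Z) V \<longleftrightarrow> f \<circ> \<phi> \<in> reg X {y \<in> U. \<phi> y \<in> V}"
    if V: "openin (subtopology (zariski N) Z) V" for V f
  proof -
    have "points (open_subspace X U) = U" using top(1) by (simp only: open_subspace_def fspace.simps)
    moreover have "ztop (affine_fspace N Z) = subtopology (zariski N) Z" "reg (open_subspace X U) = reg X"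
      by (simp_all add: affine_fspace_def open_subspace_def)
    ultimately show ?thesis using iso V by (simp add: fspace_iso_def)
  qed
qed

lemma chart_poly_nonzero:
  assumes "affine_chart X U N Z \<phi>" "x \<in> U" "R \<in> poly_fun N" "R (\<phi> x) \<noteq> 0"
  shows "\<forall>\<^sub>F y in nhdsin (ztop X) x. y \<in> U \<and> R (\<phi> y) \<noteq> 0"
proof -
  note C = affine_chart_facts[OF assms(1)]
  have "x \<in> points X" using openin_subset[OF C(1)] assms(2) by blast
  moreover have "openin (ztop X) {y \<in> U. \<phi> y \<in> {z \<in> cspace N. R z \<noteq> 0}}"
    by (rule C(6)[OF openin_zariski_basic[OF assms(3)]])
  moreover have "x \<in> {y \<in> U. \<phi> y \<in> {z \<in> cspace N. R z \<noteq> 0}}"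
    using assms(2,4) C(3,4) by auto
  ultimately show ?thesis unfolding eventually_near_iff[OF \<open>x \<in> points X\<close>] by blast
qed

text \<open>Replaces a neighbourhood of \<open>x\<close> by the nonvanishing locus of one polynomial
  on \<open>Z\<close>. Multiplying by \<open>R\<close> then extends a vanishing statement near
  \<open>x\<close> to all of \<open>Z\<close>, as the Nullstellensatz demands.\<close>

lemma chart_basic_neighbourhood:
  assumes "affine_chart X U N Z \<phi>" "x \<in> U" "\<forall>\<^sub>F y in nhdsin (ztop X) x. P y"
  shows "\<exists>R\<in>poly_fun N. R (\<phi> x) \<noteq> 0 \<and> (\<forall>z\<in>Z. R z \<noteq> 0 \<longrightarrow> (\<exists>y\<in>U. \<phi> y = z \<and> P y))"
proof -
  note C = affine_chart_facts[OF assms(1)]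
  have x: "x \<in> points X" using openin_subset[OF C(1)] assms(2) by blast
  obtain W where W: "openin (ztop X) W" "x \<in> W" "\<forall>y\<in>W. P y"
    using assms(3) unfolding eventually_near_iff[OF x] by blast
  have "openin (subtopology (zariski N) Z) (\<phi> ` (W \<inter> U))" using W(1) C(1) by (intro C(5)) auto
  then obtain T where T: "openin (zariski N) T" "\<phi> ` (W \<inter> U) = T \<inter> Z"
    unfolding openin_subtopology by blast
  have "\<phi> x \<in> T" using T(2) W(2) assms(2) by blast
  then obtain R where R: "R \<in> poly_fun N" "R (\<phi> x) \<noteq> 0" "{z \<in> cspace N. R z \<noteq> 0} \<subseteq> T"
    using zariski_basic_neighbourhood[OF T(1)] by blast
  have "\<exists>y\<in>U. \<phi> y = z \<and> P y" if "z \<in> Z" "R z \<noteq> 0" for z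
  proof -
    have "z \<in> T \<inter> Z" using that R(3) C(4) by blast
    then show ?thesis using W(3) by (auto simp: T(2)[symmetric])
  qed
  then show ?thesis using R(1,2) by blast
qed

section \<open>The local ring at a point\<close>

lemma function_sheafD:
  assumes "function_sheaf X"
  shows "openin (ztop X) U \<Longrightarrow> f \<in> reg X U \<Longrightarrow> (\<And>y. y \<in> U \<Longrightarrow> f y = g y) \<Longrightarrow> g \<in> reg X U"
    "openin (ztop X) U \<Longrightarrow> openin (ztop X) V \<Longrightarrow> V \<subseteq> U \<Longrightarrow> f \<in> reg X U \<Longrightarrow> f \<in> reg X V"
    "(\<And>U. U \<in> \<U> \<Longrightarrow> openin (ztop X) U) \<Longrightarrow> (\<And>U. U \<in> \<U> \<Longrightarrow> f \<in> reg X U) \<Longrightarrow> f \<in> reg X (\<Union>\<U>)"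
proof -
  note * = assms[unfolded function_sheaf_def]
  show "openin (ztop X) U \<Longrightarrow> f \<in> reg X U \<Longrightarrow> (\<And>y. y \<in> U \<Longrightarrow> f y = g y) \<Longrightarrow> g \<in> reg X U"
    by (rule conjunct1[OF *, rule_format, of U f g]) simp
  show "openin (ztop X) U \<Longrightarrow> openin (ztop X) V \<Longrightarrow> V \<subseteq> U \<Longrightarrow> f \<in> reg X U \<Longrightarrow> f \<in> reg X V"
    by (rule conjunct1[OF conjunct2[OF *], rule_format, of U V f]) simp
  show "(\<And>U. U \<in> \<U> \<Longrightarrow> openin (ztop X) U) \<Longrightarrow> (\<And>U. U \<in> \<U> \<Longrightarrow> f \<in> reg X U) \<Longrightarrow> f \<in> reg X (\<Union>\<U>)"
    by (rule conjunct2[OF conjunct2[OF *], rule_format, of \<U> f]) simp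
qed

text \<open>The bridge to polynomial algebra: later arguments in the local ring replace germs by
  numerators and denominators in a chart.\<close>

lemma local_reg_chart:
  assumes sh: "function_sheaf X" and ch: "affine_chart X U N Z \<phi>" and x: "x \<in> U"
  shows "f \<in> local_reg X x \<longleftrightarrow> (\<exists>P\<in>poly_fun N. \<exists>Q\<in>poly_fun N.
    \<forall>\<^sub>F y in nhdsin (ztop X) x. Q (\<phi> y) \<noteq> 0 \<and> f y = P (\<phi> y) / Q (\<phi> y))"
proof
  note C = affine_chart_facts[OF ch] and S = function_sheafD[OF sh]
  have xX: "x \<in> points X" using openin_subset[OF C(1)] x by blast
  { assume "f \<in> local_reg X x"
    then obtain V where V: "openin (ztop X) V" "x \<in> V" "f \<in> reg X V" by (auto simp: local_reg_def)
    define W where "W = V \<inter> U"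
    have W: "openin (ztop X) W" "x \<in> W" "W \<subseteq> U" using V C(1) x by (auto simp: W_def)
    have fW: "f \<in> reg X W" by (rule S(2)[OF V(1) W(1) _ V(3)]) (auto simp: W_def)
    \<comment> \<open>The chart compares functions on affine space with their pullbacks, so
      \<open>f\<close> is first transported to affine space along the inverse of \<phi> on
      \<open>U\<close>.\<close>
    define f' where "f' = f \<circ> inv_into U \<phi>"
    have f': "f' (\<phi> y) = f y" if "y \<in> U" for y using inv_into_f_f[OF C(2) that] by (simp add: f'_def)
    have "f' \<circ> \<phi> \<in> reg X W" by (rule S(1)[OF W(1) fW]) (use f' W(3) in auto)
    moreover have "{y \<in> U. \<phi> y \<in> \<phi> ` W} = W" using W(3) C(2) by (auto dest: inj_onD)
    ultimately have "f' \<in> reg (affine_fspace N Z) (\<phi> ` W)"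
      using C(7)[OF C(5)[OF W(1,3)], of f'] by simp
    then obtain V' P Q where V': "openin (zariski N) V'" "\<phi> x \<in> V'" "P \<in> poly_fun N" "Q \<in> poly_fun N"
      "\<forall>q\<in>V' \<inter> \<phi> ` W. Q q \<noteq> 0 \<and> f' q = P q / Q q"
      using W(2) unfolding affine_fspace_def fspace.simps by blast
    have "openin (ztop X) ({y \<in> U. \<phi> y \<in> V'} \<inter> W)" using C(6)[OF V'(1)] W(1) by blast
    moreover have "x \<in> {y \<in> U. \<phi> y \<in> V'} \<inter> W" using V'(2) W(2) x by simp
    moreover have "\<forall>y\<in>{y \<in> U. \<phi> y \<in> V'} \<inter> W. Q (\<phi> y) \<noteq> 0 \<and> f y = P (\<phi> y) / Q (\<phi> y)"
      using V'(5) f' by fastforce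
    ultimately show "\<exists>P\<in>poly_fun N. \<exists>Q\<in>poly_fun N.
      \<forall>\<^sub>F y in nhdsin (ztop X) x. Q (\<phi> y) \<noteq> 0 \<and> f y = P (\<phi> y) / Q (\<phi> y)"
      unfolding eventually_near_iff[OF xX] using V'(3,4) by blast }
  assume "\<exists>P\<in>poly_fun N. \<exists>Q\<in>poly_fun N.
    \<forall>\<^sub>F y in nhdsin (ztop X) x. Q (\<phi> y) \<noteq> 0 \<and> f y = P (\<phi> y) / Q (\<phi> y)"
  then obtain P Q V where PQ: "P \<in> poly_fun N" "Q \<in> poly_fun N" "openin (ztop X) V" "x \<in> V"
    "\<forall>y\<in>V. Q (\<phi> y) \<noteq> 0 \<and> f y = P (\<phi> y) / Q (\<phi> y)"
    unfolding eventually_near_iff[OF xX] by blast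
  define W where "W = V \<inter> U"
  have W: "openin (ztop X) W" "x \<in> W" "W \<subseteq> U" using PQ(3,4) C(1) x by (auto simp: W_def)
  have "(\<lambda>z. P z / Q z) \<in> reg (affine_fspace N Z) (\<phi> ` W)"
    unfolding affine_fspace_def fspace.simps mem_Collect_eq
  proof
    fix q assume q: "q \<in> \<phi> ` W"
    then have "q \<in> topspace (zariski N)" using C(3,4) W(3) by (auto simp: topspace_zariski)
    then show "\<exists>V. openin (zariski N) V \<and> q \<in> V \<and> (\<exists>Pa\<in>poly_fun N. \<exists>Qa\<in>poly_fun N.
      \<forall>q\<in>V \<inter> \<phi> ` W. Qa q \<noteq> 0 \<and> P q / Q q = Pa q / Qa q)"
      using PQ(1,2,5) by (intro exI[of _ "topspace (zariski N)"]) (auto simp: W_def)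
  qed
  then have "(\<lambda>z. P z / Q z) \<circ> \<phi> \<in> reg X {y \<in> U. \<phi> y \<in> \<phi> ` W}"
    using C(7)[OF C(5)[OF W(1,3)]] by blast
  moreover have "{y \<in> U. \<phi> y \<in> \<phi> ` W} = W" using W(3) C(2) by (auto dest: inj_onD)
  ultimately have "(\<lambda>z. P z / Q z) \<circ> \<phi> \<in> reg X W" by simp
  then have "f \<in> reg X W" by (rule S(1)[OF W(1)]) (use PQ(5) in \<open>auto simp: W_def\<close>)
  then show "f \<in> local_reg X x" using W by (auto simp: local_reg_def)
qed

lemma variety_sheaf: "variety X \<Longrightarrow> function_sheaf X"
  by (simp add: variety_def)

lemma variety_chart:
  assumes "variety X" "x \<in> points X"
  obtains U N Z \<phi> where "x \<in> U" "affine_chart X U N Z \<phi>"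
proof -
  obtain \<U> where \<U>: "\<Union>\<U> = points X" "\<forall>U\<in>\<U>. \<exists>N Z \<phi>. affine_chart X U N Z \<phi>"
    using conjunct1[OF conjunct2[OF assms(1)[unfolded variety_def]]] by (elim exE conjE)
  then obtain U where "U \<in> \<U>" "x \<in> U" using assms(2) by blast
  then show thesis using \<U>(2) that by blast
qed

lemma local_reg_cong:
  assumes X: "variety X" "x \<in> points X" and f: "f \<in> local_reg X x"
    and eq: "\<forall>\<^sub>F y in nhdsin (ztop X) x. f y = g y"
  shows "g \<in> local_reg X x"
proof -
  note S = function_sheafD[OF variety_sheaf[OF X(1)]]
  obtain U V where *: "openin (ztop X) U" "x \<in> U" "f \<in> reg X U"
    "openin (ztop X) V" "x \<in> V" "\<forall>y\<in>V. f y = g y"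
    using f eq unfolding eventually_near_iff[OF X(2)] local_reg_def by blast
  have "openin (ztop X) (U \<inter> V)" using * by blast
  moreover have "f \<in> reg X (U \<inter> V)" by (rule S(2)[OF *(1) \<open>openin _ (U \<inter> V)\<close> _ *(3)]) simp
  ultimately have "g \<in> reg X (U \<inter> V)" by (rule S(1)) (use *(6) in auto)
  then show ?thesis using * \<open>openin _ (U \<inter> V)\<close> by (auto simp: local_reg_def)
qed

lemma local_reg_poly:
  assumes X: "variety X" and ch: "affine_chart X U N Z \<phi>" "x \<in> U" and P: "P \<in> poly_fun N"
  shows "(\<lambda>y. P (\<phi> y)) \<in> local_reg X x"
  unfolding local_reg_chart[OF variety_sheaf[OF X] ch]
  by (intro bexI[of _ P] bexI[of _ "\<lambda>z. 1"]) (simp_all add: P poly_fun.const)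

lemma local_reg_const:
  assumes X: "variety X" "x \<in> points X"
  shows "(\<lambda>y. c) \<in> local_reg X x"
proof -
  obtain U N Z \<phi> where "x \<in> U" "affine_chart X U N Z \<phi>" using variety_chart[OF X] .
  then show ?thesis using local_reg_poly[OF X(1) _ _ poly_fun.const] by blast
qed

lemma local_reg_combine:
  assumes X: "variety X" "x \<in> points X" and f: "f \<in> local_reg X x" and g: "g \<in> local_reg X x"
  shows "(\<lambda>y. f y + g y) \<in> local_reg X x" "(\<lambda>y. f y * g y) \<in> local_reg X x"
    and "g x \<noteq> 0 \<Longrightarrow> (\<lambda>y. f y / g y) \<in> local_reg X x"
    and "g x \<noteq> 0 \<Longrightarrow> \<forall>\<^sub>F y in nhdsin (ztop X) x. g y \<noteq> 0"
proof -
  obtain U N Z \<phi> where ch: "x \<in> U" "affine_chart X U N Z \<phi>" using variety_chart[OF X] .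
  note L = local_reg_chart[OF variety_sheaf[OF X(1)] ch(2,1)]
  obtain P Q where f': "P \<in> poly_fun N" "Q \<in> poly_fun N"
    "\<forall>\<^sub>F y in nhdsin (ztop X) x. Q (\<phi> y) \<noteq> 0 \<and> f y = P (\<phi> y) / Q (\<phi> y)" using f L by blast
  obtain R T where g': "R \<in> poly_fun N" "T \<in> poly_fun N"
    "\<forall>\<^sub>F y in nhdsin (ztop X) x. T (\<phi> y) \<noteq> 0 \<and> g y = R (\<phi> y) / T (\<phi> y)" using g L by blast
  show "(\<lambda>y. f y + g y) \<in> local_reg X x"
    unfolding L
  proof (intro bexI)
    show "\<forall>\<^sub>F y in nhdsin (ztop X) x. (\<lambda>z. Q z * T z) (\<phi> y) \<noteq> 0 \<and>
      f y + g y = (\<lambda>z. P z * T z + R z * Q z) (\<phi> y) / (\<lambda>z. Q z * T z) (\<phi> y)"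
      using f'(3) g'(3) by eventually_elim (auto simp: field_simps)
  qed (intro poly_fun.intros f' g')+
  show "(\<lambda>y. f y * g y) \<in> local_reg X x"
    unfolding L
  proof (intro bexI)
    show "\<forall>\<^sub>F y in nhdsin (ztop X) x. (\<lambda>z. Q z * T z) (\<phi> y) \<noteq> 0 \<and>
      f y * g y = (\<lambda>z. P z * R z) (\<phi> y) / (\<lambda>z. Q z * T z) (\<phi> y)"
      using f'(3) g'(3) by eventually_elim (auto simp: field_simps)
  qed (intro poly_fun.intros f' g')+
  assume "g x \<noteq> 0"
  then have "R (\<phi> x) \<noteq> 0" using eventually_near_self[OF X(2) g'(3)] by auto
  then have R: "\<forall>\<^sub>F y in nhdsin (ztop X) x. y \<in> U \<and> R (\<phi> y) \<noteq> 0"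
    by (rule chart_poly_nonzero[OF ch(2,1) g'(1)])
  show "(\<lambda>y. f y / g y) \<in> local_reg X x"
    unfolding L
  proof (intro bexI)
    show "\<forall>\<^sub>F y in nhdsin (ztop X) x. (\<lambda>z. Q z * R z) (\<phi> y) \<noteq> 0 \<and>
      f y / g y = (\<lambda>z. P z * T z) (\<phi> y) / (\<lambda>z. Q z * R z) (\<phi> y)"
      using f'(3) g'(3) R by eventually_elim (auto simp: field_simps)
  qed (intro poly_fun.intros f' g')+
  show "\<forall>\<^sub>F y in nhdsin (ztop X) x. g y \<noteq> 0"
    using g'(3) R by eventually_elim auto
qed

lemma local_reg_closed:
  assumes X: "variety X" "x \<in> points X"
  shows "f \<in> local_reg X x \<Longrightarrow> g \<in> local_reg X x \<Longrightarrow> (\<lambda>y. f y - g y) \<in> local_reg X x"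
    and "f \<in> local_reg X x \<Longrightarrow> (\<lambda>y. f y ^ n) \<in> local_reg X x"
    and "(\<And>i. i \<in> S \<Longrightarrow> h i \<in> local_reg X x) \<Longrightarrow> (\<lambda>y. \<Prod>i\<in>S. h i y) \<in> local_reg X x"
proof -
  note C = local_reg_combine[OF X] local_reg_const[OF X]
  show "(\<lambda>y. f y - g y) \<in> local_reg X x" if "f \<in> local_reg X x" "g \<in> local_reg X x"
  proof -
    have "(\<lambda>y. f y + (- 1) * g y) \<in> local_reg X x" by (rule C(1)[OF that(1) C(2)[OF C(5) that(2)]])
    then show ?thesis by simp
  qed
  show "f \<in> local_reg X x \<Longrightarrow> (\<lambda>y. f y ^ n) \<in> local_reg X x"
    by (induction n) (auto intro: C(2,5))
  show "(\<And>i. i \<in> S \<Longrightarrow> h i \<in> local_reg X x) \<Longrightarrow> (\<lambda>y. \<Prod>i\<in>S. h i y) \<in> local_reg X x"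
    by (induction S rule: infinite_finite_induct) (auto intro: C(2,5))
qed

text \<open>The gluing axiom. It is what makes the pointwise inverse of a function without zeros off
  \<open>D\<close> a regular function there.\<close>

lemma reg_iff_local_reg:
  assumes X: "variety X" and W: "openin (ztop X) W"
  shows "f \<in> reg X W \<longleftrightarrow> (\<forall>x\<in>W. f \<in> local_reg X x)"
proof
  note S = function_sheafD[OF variety_sheaf[OF X]]
  show "f \<in> reg X W \<Longrightarrow> \<forall>x\<in>W. f \<in> local_reg X x" using W by (auto simp: local_reg_def)
  assume *: "\<forall>x\<in>W. f \<in> local_reg X x"
  let ?\<U> = "{V. openin (ztop X) V \<and> V \<subseteq> W \<and> f \<in> reg X V}"
  have "W \<subseteq> \<Union>?\<U>"
  proof
    fix x assume x: "x \<in> W"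
    then obtain U where U: "openin (ztop X) U" "x \<in> U" "f \<in> reg X U" using * by (auto simp: local_reg_def)
    have UW: "openin (ztop X) (U \<inter> W)" using U W by blast
    have "f \<in> reg X (U \<inter> W)" by (rule S(2)[OF U(1) UW _ U(3)]) simp
    then show "x \<in> \<Union>?\<U>" using UW x U(2) by blast
  qed
  then have "W = \<Union>?\<U>" by blast
  moreover have "f \<in> reg X (\<Union>?\<U>)" by (rule S(3)) auto
  ultimately show "f \<in> reg X W" by simp
qed

section \<open>Derivations of the local ring in a chart\<close>

lemma tangent_rules:
  assumes X: "variety X" "x \<in> points X" and v: "v \<in> tangent_space X x"
  shows "f \<in> local_reg X x \<Longrightarrow> g \<in> local_reg X x \<Longrightarrow> \<forall>\<^sub>F y in nhdsin (ztop X) x. f y = g y \<Longrightarrow> v f = v g"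
    "f \<in> local_reg X x \<Longrightarrow> g \<in> local_reg X x \<Longrightarrow> v (\<lambda>y. f y + g y) = v f + v g"
    "f \<in> local_reg X x \<Longrightarrow> g \<in> local_reg X x \<Longrightarrow> v (\<lambda>y. f y * g y) = f x * v g + g x * v f"
    "v (\<lambda>y. c) = 0"
proof -
  show M: "v (\<lambda>y. f y * g y) = f x * v g + g x * v f"
    if "f \<in> local_reg X x" "g \<in> local_reg X x" for f g
    using v that by (auto simp: tangent_space_def)
  show "v f = v g"
    if "f \<in> local_reg X x" "g \<in> local_reg X x" "\<forall>\<^sub>F y in nhdsin (ztop X) x. f y = g y"
    using v that unfolding tangent_space_def eventually_near_iff[OF X(2)] by blast
  show "v (\<lambda>y. f y + g y) = v f + v g" if "f \<in> local_reg X x" "g \<in> local_reg X x"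
    using v that by (auto simp: tangent_space_def)
  have 1: "(\<lambda>y. 1) \<in> local_reg X x" by (rule local_reg_const[OF X])
  then have "v (\<lambda>y. 1) = 0" using M[OF 1 1] by simp
  moreover have "v (\<lambda>y. c * f y) = c * v f" if "f \<in> local_reg X x" for f
    using v that by (auto simp: tangent_space_def)
  from this[OF 1] have "v (\<lambda>y. c) = c * v (\<lambda>y. 1)" by simp
  ultimately show "v (\<lambda>y. c) = 0" by simp
qed

text \<open>Identifies the derivations with vectors of affine space: the values on the coordinate
  functions are the components of the tangent vector, and the Leibniz rule gives the chain
  rule.\<close>

lemma tangent_poly:
  assumes X: "variety X" "x \<in> points X" and v: "v \<in> tangent_space X x"
    and ch: "affine_chart X U N Z \<phi>" "x \<in> U" and f: "f \<in> poly_fun N"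
  shows "v (\<lambda>y. f (\<phi> y)) = dif N f (\<phi> x) (\<lambda>k. v (\<lambda>y. \<phi> y k))"
  using f
proof (induction rule: poly_fun.induct)
  case (const c)
  then show ?case by (simp add: tangent_rules(4)[OF X v] dif_simps)
next
  case (coord k)
  then show ?case by (simp add: dif_simps)
next
  case (add f g)
  then show ?case
    using tangent_rules(2)[OF X v local_reg_poly[OF X(1) ch add(1)] local_reg_poly[OF X(1) ch add(2)]]
    by (simp add: dif_simps)
next
  case (mult f g)
  then show ?case
    using tangent_rules(3)[OF X v local_reg_poly[OF X(1) ch mult(1)] local_reg_poly[OF X(1) ch mult(2)]]
    by (simp add: dif_simps)
qed

section \<open>Local rings of nonsingular varieties\<close>

lemma local_ideal_zero:
  assumes "\<And>j. j < c \<Longrightarrow> F j p = 0" "f \<in> local_ideal N p (gen_ideal N c F)"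
  shows "f p = 0"
proof -
  obtain q r where "q p \<noteq> 0" "q * f = (\<Sum>j<c. r j * F j)"
    using assms(2) unfolding local_ideal_def gen_ideal_def by blast
  then have "(q * f) p = (\<Sum>j<c. r j p * F j p)" by (simp add: sum_fun_apply times_fun_apply)
  then have "q p * f p = (\<Sum>j<c. r j p * F j p)" by (simp only: times_fun_apply)
  then show ?thesis using assms(1) \<open>q p \<noteq> 0\<close> by simp
qed

text \<open>Passing to a hypersurface of \<open>X\<close> means appending one equation
  \<open>P\<close> to the list \<open>F\<close>.\<close>

lemma gen_ideal_Suc:
  "f \<in> gen_ideal N (Suc c) (F(c := P)) \<longleftrightarrow> (\<exists>k\<in>gen_ideal N c F. \<exists>r\<in>poly_fun N. f = k + r * P)"
proof
  assume "f \<in> gen_ideal N (Suc c) (F(c := P))"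
  then obtain r where r: "f = (\<Sum>j<Suc c. r j * (F(c := P)) j)" "\<forall>j<Suc c. r j \<in> poly_fun N"
    unfolding gen_ideal_def by blast
  have "f = (\<Sum>j<c. r j * F j) + r c * P" using r(1) by simp
  moreover have "(\<Sum>j<c. r j * F j) \<in> gen_ideal N c F" using r(2) unfolding gen_ideal_def by auto
  ultimately show "\<exists>k\<in>gen_ideal N c F. \<exists>r\<in>poly_fun N. f = k + r * P" using r(2) by blast
next
  assume "\<exists>k\<in>gen_ideal N c F. \<exists>r\<in>poly_fun N. f = k + r * P"
  then obtain s r where *: "f = (\<Sum>j<c. s j * F j) + r * P" "\<forall>j<c. s j \<in> poly_fun N" "r \<in> poly_fun N"
    unfolding gen_ideal_def by blast
  have "f = (\<Sum>j<Suc c. (s(c := r)) j * (F(c := P)) j)" by (simp add: *(1))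
  moreover have "\<forall>j<Suc c. (s(c := r)) j \<in> poly_fun N" using * by (auto simp: less_Suc_eq)
  ultimately show "f \<in> gen_ideal N (Suc c) (F(c := P))" unfolding gen_ideal_def by blast
qed

lemma gen_ideal_vanish:
  assumes "f \<in> gen_ideal N c F" "\<And>j. j < c \<Longrightarrow> F j z = 0"
  shows "f z = 0"
  using assms by (auto simp: gen_ideal_def sum_fun_apply times_fun_apply)

text \<open>The local data provided by nonsingularity at one point, with the closed set of the chart
  replaced by its equations.\<close>

locale smooth_point =
  fixes X :: "'a fspace" and x :: 'a and U N \<phi> and c :: nat and F
  assumes X: "variety X" and x: "x \<in> U"
    and chart: "affine_chart X U N {z \<in> cspace N. \<forall>j<c. F j z = 0} \<phi>"
    and F: "\<And>j. j < c \<Longrightarrow> F j \<in> poly_fun N"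
    and independent: "independent_at N c F (\<phi> x)"
begin

abbreviation near :: "('a \<Rightarrow> bool) \<Rightarrow> bool" where
  "near P \<equiv> eventually P (nhdsin (ztop X) x)"

abbreviation K where "K \<equiv> gen_ideal N c F"

lemma x_points: "x \<in> points X"
  using openin_subset[OF affine_chart_facts(1)[OF chart]] x by blast

lemma near_U: "near (\<lambda>y. y \<in> U)"
  using chart_poly_nonzero[OF chart x poly_fun.const[of 1]] by simp

lemma F_zero: "y \<in> U \<Longrightarrow> j < c \<Longrightarrow> F j (\<phi> y) = 0"
  using affine_chart_facts(3)[OF chart] by blast

lemma K_ideal: "is_ideal (poly_fun N) K"
  by (rule gen_ideal_is_ideal) (rule F)

lemma K_vanish: "k \<in> K \<Longrightarrow> y \<in> U \<Longrightarrow> k (\<phi> y) = 0"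
  by (rule gen_ideal_vanish[where F = F]) (auto intro: F_zero)

lemma local_prime:
  "f \<in> poly_fun N \<Longrightarrow> g \<in> poly_fun N \<Longrightarrow> f * g \<in> local_ideal N (\<phi> x) K \<Longrightarrow>
    f \<in> local_ideal N (\<phi> x) K \<or> g \<in> local_ideal N (\<phi> x) K"
  by (rule local_gen_ideal_prime) (use F F_zero x independent in auto)

lemma K_local: "k \<in> K \<Longrightarrow> k \<in> local_ideal N (\<phi> x) K"
  unfolding local_ideal_def using is_idealD(1)[OF K_ideal]
  by (intro CollectI conjI bexI[of _ 1]) (auto simp: one_fun_apply poly_fun_algebra)

lemma local_zero: "f \<in> local_ideal N (\<phi> x) K \<Longrightarrow> f (\<phi> x) = 0"
  by (rule local_ideal_zero) (auto intro: F_zero x)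

text \<open>The nontrivial direction is the Nullstellensatz on \<open>X\<close>: a power of
  \<open>R * f\<close> lies in \<open>K\<close>, and primeness of the localised ideal removes the
  power and the factor \<open>R\<close>, which does not vanish at the point.\<close>

lemma near_zero_iff:
  assumes f: "f \<in> poly_fun N"
  shows "near (\<lambda>y. f (\<phi> y) = 0) \<longleftrightarrow> f \<in> local_ideal N (\<phi> x) K"
proof
  assume "near (\<lambda>y. f (\<phi> y) = 0)"
  then obtain R where R: "R \<in> poly_fun N" "R (\<phi> x) \<noteq> 0"
    "\<And>z. z \<in> cspace N \<Longrightarrow> \<forall>j<c. F j z = 0 \<Longrightarrow> R z \<noteq> 0 \<Longrightarrow> f z = 0"
    using chart_basic_neighbourhood[OF chart x, of "\<lambda>y. f (\<phi> y) = 0"] by fastforce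
  have Rf: "R * f \<in> poly_fun N" by (intro poly_fun_algebra R f)
  have "\<exists>n. (R * f) ^ n \<in> K"
  proof (rule nullstellensatz[OF K_ideal Rf])
    fix z assume z: "z \<in> cspace N" "\<And>h. h \<in> K \<Longrightarrow> h z = 0"
    then have "\<forall>j<c. F j z = 0" using gen_ideal_member by blast
    then show "(R * f) z = 0" using R(3)[OF z(1)] by (auto simp: times_fun_apply)
  qed
  then obtain n where n: "(R * f) ^ n \<in> K" by blast
  \<comment> \<open>Primeness splits off one factor at a time. The exponent \<open>0\<close> cannot
    occur, because elements of the localised ideal vanish at the point and \<open>1\<close> does
    not.\<close>
  have "(R * f) ^ m \<in> local_ideal N (\<phi> x) K \<Longrightarrow> R * f \<in> local_ideal N (\<phi> x) K" for m
  proof (induction m)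
    case 0
    then show ?case using local_zero by (fastforce simp: one_fun_apply)
  next
    case (Suc m)
    then show ?case
      using local_prime[OF Rf is_subringD(7)[OF is_subring_poly_fun Rf], of m] by auto
  qed
  then have "R * f \<in> local_ideal N (\<phi> x) K" using K_local[OF n] by blast
  then show "f \<in> local_ideal N (\<phi> x) K" using local_prime[OF R(1) f] local_zero R(2) by blast
next
  assume "f \<in> local_ideal N (\<phi> x) K"
  then obtain q where q: "q \<in> poly_fun N" "q (\<phi> x) \<noteq> 0" "q * f \<in> K"
    by (auto simp: local_ideal_def)
  show "near (\<lambda>y. f (\<phi> y) = 0)"
    using chart_poly_nonzero[OF chart x q(1,2)]
  proof eventually_elim
    case (elim y)
    then show ?case using K_vanish[OF q(3), of y] by (simp add: times_fun_apply)
  qed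
qed

lemma local_fraction:
  assumes "f \<in> local_reg X x"
  obtains P Q where "P \<in> poly_fun N" "Q \<in> poly_fun N" "Q (\<phi> x) \<noteq> 0"
    "near (\<lambda>y. Q (\<phi> y) \<noteq> 0 \<and> f y = P (\<phi> y) / Q (\<phi> y))"
proof -
  obtain P Q where *: "P \<in> poly_fun N" "Q \<in> poly_fun N"
    "near (\<lambda>y. Q (\<phi> y) \<noteq> 0 \<and> f y = P (\<phi> y) / Q (\<phi> y))"
    using assms local_reg_chart[OF variety_sheaf[OF X] chart x] by blast
  then have "Q (\<phi> x) \<noteq> 0" using eventually_near_self[OF x_points *(3)] by blast
  then show thesis using that * by blast
qed

lemma local_domain:
  assumes f: "f \<in> local_reg X x" and g: "g \<in> local_reg X x" and fg: "near (\<lambda>y. f y * g y = 0)"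
  shows "near (\<lambda>y. f y = 0) \<or> near (\<lambda>y. g y = 0)"
proof -
  obtain P Q where f': "P \<in> poly_fun N" "Q \<in> poly_fun N" "Q (\<phi> x) \<noteq> 0"
    "near (\<lambda>y. Q (\<phi> y) \<noteq> 0 \<and> f y = P (\<phi> y) / Q (\<phi> y))" using local_fraction[OF f] .
  obtain R T where g': "R \<in> poly_fun N" "T \<in> poly_fun N" "T (\<phi> x) \<noteq> 0"
    "near (\<lambda>y. T (\<phi> y) \<noteq> 0 \<and> g y = R (\<phi> y) / T (\<phi> y))" using local_fraction[OF g] .
  have "near (\<lambda>y. (P * R) (\<phi> y) = 0)"
    using f'(4) g'(4) fg by eventually_elim (auto simp: times_fun_apply)
  then have "P * R \<in> local_ideal N (\<phi> x) K"
    by (rule near_zero_iff[OF poly_fun_algebra(2)[OF f'(1) g'(1)], THEN iffD1])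
  then have "P \<in> local_ideal N (\<phi> x) K \<or> R \<in> local_ideal N (\<phi> x) K"
    by (rule local_prime[OF f'(1) g'(1)])
  then show ?thesis
  proof
    assume "P \<in> local_ideal N (\<phi> x) K"
    then have "near (\<lambda>y. P (\<phi> y) = 0)" using near_zero_iff[OF f'(1)] by blast
    then have "near (\<lambda>y. f y = 0)" using f'(4) by eventually_elim auto
    then show ?thesis ..
  next
    assume "R \<in> local_ideal N (\<phi> x) K"
    then have "near (\<lambda>y. R (\<phi> y) = 0)" using near_zero_iff[OF g'(1)] by blast
    then have "near (\<lambda>y. g y = 0)" using g'(4) by eventually_elim auto
    then show ?thesis ..
  qed
qed

lemma quotient_local_reg:
  assumes "P \<in> poly_fun N" "Q \<in> poly_fun N" "Q (\<phi> x) \<noteq> 0"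
  shows "(\<lambda>y. P (\<phi> y) / Q (\<phi> y)) \<in> local_reg X x"
  using local_reg_combine(3)[OF X x_points local_reg_poly[OF X chart x assms(1)]
      local_reg_poly[OF X chart x assms(2)]] assms(3) by simp

text \<open>Let \<open>P\<close> be the numerator of \<open>t\<close>. In the chart the derivation
  \<open>v\<close> is a vector on which the differentials of all \<open>F j\<close> vanish and that
  of \<open>P\<close> does not. Hence \<open>F\<close> extended by \<open>P\<close> has independent
  differentials, \<open>local_gen_ideal_prime\<close> applies to the extended list, and divisibility
  by \<open>t\<close> is membership of the numerator in its localised ideal.\<close>

lemma local_prime_element:
  assumes t: "t \<in> local_reg X x" "t x = 0" and v: "v \<in> tangent_space X x" "v t \<noteq> 0"
    and fgh: "f \<in> local_reg X x" "g \<in> local_reg X x" "h \<in> local_reg X x"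
    and eq: "near (\<lambda>y. f y * g y = t y * h y)"
  shows "\<exists>k\<in>local_reg X x. near (\<lambda>y. f y = t y * k y) \<or> near (\<lambda>y. g y = t y * k y)"
proof -
  obtain P Q where t': "P \<in> poly_fun N" "Q \<in> poly_fun N" "Q (\<phi> x) \<noteq> 0"
    "near (\<lambda>y. Q (\<phi> y) \<noteq> 0 \<and> t y = P (\<phi> y) / Q (\<phi> y))" using local_fraction[OF t(1)] .
  obtain Pf Qf where f': "Pf \<in> poly_fun N" "Qf \<in> poly_fun N" "Qf (\<phi> x) \<noteq> 0"
    "near (\<lambda>y. Qf (\<phi> y) \<noteq> 0 \<and> f y = Pf (\<phi> y) / Qf (\<phi> y))" using local_fraction[OF fgh(1)] .
  obtain Pg Qg where g': "Pg \<in> poly_fun N" "Qg \<in> poly_fun N" "Qg (\<phi> x) \<noteq> 0"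
    "near (\<lambda>y. Qg (\<phi> y) \<noteq> 0 \<and> g y = Pg (\<phi> y) / Qg (\<phi> y))" using local_fraction[OF fgh(2)] .
  obtain Ph Qh where h': "Ph \<in> poly_fun N" "Qh \<in> poly_fun N" "Qh (\<phi> x) \<noteq> 0"
    "near (\<lambda>y. Qh (\<phi> y) \<noteq> 0 \<and> h y = Ph (\<phi> y) / Qh (\<phi> y))" using local_fraction[OF fgh(3)] .
  let ?p = "\<phi> x" and ?\<delta> = "\<lambda>k. v (\<lambda>y. \<phi> y k)"
  note T = tangent_rules[OF X x_points v(1)] and TP = tangent_poly[OF X x_points v(1) chart x]
  note LP = local_reg_poly[OF X chart x]
  have P0: "P ?p = 0" using eventually_near_self[OF x_points t'(4)] t(2) by auto
  have dP: "dif N P ?p ?\<delta> \<noteq> 0"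
  proof -
    have "near (\<lambda>y. Q (\<phi> y) * t y = P (\<phi> y))" using t'(4) by eventually_elim auto
    then have "v (\<lambda>y. Q (\<phi> y) * t y) = v (\<lambda>y. P (\<phi> y))"
      by (intro T(1) local_reg_combine(2)[OF X x_points] LP t' t)
    then have "Q ?p * v t = dif N P ?p ?\<delta>"
      using T(3)[OF LP[OF t'(2)] t(1)] t(2) TP[OF t'(1)] by simp
    then show ?thesis using t'(3) v(2) by auto
  qed
  have dF: "dif N (F j) ?p ?\<delta> = 0" if j: "j < c" for j
  proof -
    have "near (\<lambda>y. F j (\<phi> y) = 0)" using near_U by eventually_elim (use F_zero j in auto)
    then have "v (\<lambda>y. F j (\<phi> y)) = v (\<lambda>y. 0)"
      by (intro T(1) LP F j local_reg_const[OF X x_points])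
    then show ?thesis using TP[OF F[OF j]] T(4) by simp
  qed
  let ?F = "F(c := P)"
  have ind: "independent_at N (Suc c) ?F ?p"
    unfolding independent_at_def
  proof (rule allI, rule impI)
    fix a assume a: "\<forall>k<N. (\<Sum>j<Suc c. a j * pderivative k (?F j) ?p) = 0"
    \<comment> \<open>Pairing the relation with \<open>?\<delta>\<close> kills the terms of all
      \<open>F j\<close> and isolates the coefficient of \<open>P\<close>.\<close>
    have "(\<Sum>j<Suc c. a j * dif N (?F j) ?p ?\<delta>) =
      (\<Sum>k<N. (\<Sum>j<Suc c. a j * pderivative k (?F j) ?p) * ?\<delta> k)"
      unfolding dif_def sum_distrib_left sum_distrib_right
      by (subst sum.swap) (simp only: mult.assoc)
    also have "\<dots> = 0" using a by simp
    finally have "a c * dif N P ?p ?\<delta> = 0" using dF by simp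
    then have ac: "a c = 0" using dP by simp
    then have "\<forall>k<N. (\<Sum>j<c. a j * pderivative k (F j) ?p) = 0" using a by simp
    then have "\<forall>j<c. a j = 0" using independent unfolding independent_at_def by blast
    then show "\<forall>j<Suc c. a j = 0" using ac by (simp add: less_Suc_eq)
  qed
  let ?K = "gen_ideal N (Suc c) ?F"
  have prime: "A \<in> local_ideal N ?p ?K \<or> B \<in> local_ideal N ?p ?K"
    if "A \<in> poly_fun N" "B \<in> poly_fun N" "A * B \<in> local_ideal N ?p ?K" for A B
    by (rule local_gen_ideal_prime[OF _ _ ind that])
      (use F F_zero x t'(1) P0 in \<open>auto simp: less_Suc_eq\<close>)
  have "near (\<lambda>y. (Pf * Pg * (Q * Qh) - P * Ph * (Qf * Qg)) (\<phi> y) = 0)"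
    using t'(4) f'(4) g'(4) h'(4) eq
    by eventually_elim (auto simp: times_fun_apply minus_apply field_simps)
  then have "Pf * Pg * (Q * Qh) - P * Ph * (Qf * Qg) \<in> local_ideal N ?p K"
    by (subst (asm) near_zero_iff) (intro poly_fun_algebra t' f' g' h')
  then obtain q where q: "q \<in> poly_fun N" "q ?p \<noteq> 0"
    "q * (Pf * Pg * (Q * Qh) - P * Ph * (Qf * Qg)) \<in> K" by (auto simp: local_ideal_def)
  have "(q * (Q * Qh)) * (Pf * Pg) =
    q * (Pf * Pg * (Q * Qh) - P * Ph * (Qf * Qg)) + (q * (Ph * (Qf * Qg))) * P"
    by (simp add: algebra_simps)
  moreover have "q * (Ph * (Qf * Qg)) \<in> poly_fun N" by (intro poly_fun_algebra q t' f' g' h')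
  ultimately have "(q * (Q * Qh)) * (Pf * Pg) \<in> ?K" unfolding gen_ideal_Suc using q(3) by blast
  moreover have "q * (Q * Qh) \<in> poly_fun N" by (intro poly_fun_algebra q t' h')
  moreover have "(q * (Q * Qh)) ?p \<noteq> 0" using q(2) t'(3) h'(3) by (simp add: times_fun_apply)
  ultimately have "Pf * Pg \<in> local_ideal N ?p ?K"
    unfolding local_ideal_def using poly_fun_algebra(2)[OF f'(1) g'(1)] by blast
  then have prime': "Pf \<in> local_ideal N ?p ?K \<or> Pg \<in> local_ideal N ?p ?K" by (rule prime[OF f'(1) g'(1)])
  \<comment> \<open>Returns from the ideal to functions: if \<open>w * A = k + r * P\<close>, then
    \<open>k\<close> vanishes on \<open>X\<close>, and \<open>A / B\<close> is \<open>t\<close>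
    times \<open>(r * Q) / (w * B)\<close> near \<open>x\<close>.\<close>
  have dvd: "\<exists>k\<in>local_reg X x. near (\<lambda>y. e y = t y * k y)"
    if A: "A \<in> local_ideal N ?p ?K" and B: "B \<in> poly_fun N" "B ?p \<noteq> 0"
      "near (\<lambda>y. B (\<phi> y) \<noteq> 0 \<and> e y = A (\<phi> y) / B (\<phi> y))" for A B e
  proof -
    obtain w where w: "w \<in> poly_fun N" "w ?p \<noteq> 0" "w * A \<in> ?K"
      using A unfolding local_ideal_def by blast
    obtain k r where kr: "k \<in> K" "r \<in> poly_fun N" "w * A = k + r * P"
      using w(3) unfolding gen_ideal_Suc by blast
    let ?k = "\<lambda>y. (r * Q) (\<phi> y) / (w * B) (\<phi> y)"
    have "?k \<in> local_reg X x"
      by (intro quotient_local_reg poly_fun_algebra kr t' w B) (simp add: times_fun_apply w B)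
    moreover have "near (\<lambda>y. e y = t y * ?k y)"
      using B(3) t'(4) chart_poly_nonzero[OF chart x w(1,2)]
    proof eventually_elim
      case (elim y)
      have "(w * A) (\<phi> y) = r (\<phi> y) * P (\<phi> y)"
        using K_vanish[OF kr(1), of y] elim by (simp add: kr(3) plus_fun_apply times_fun_apply)
      then show ?case using elim by (simp add: times_fun_apply field_simps)
    qed
    ultimately show ?thesis by (intro bexI[of _ ?k])
  qed
  from prime' show ?thesis
  proof
    assume "Pf \<in> local_ideal N ?p ?K"
    from dvd[OF this f'(2-4)] show ?thesis by (elim bexE) (intro bexI disjI1)
  next
    assume "Pg \<in> local_ideal N ?p ?K"
    from dvd[OF this g'(2-4)] show ?thesis by (elim bexE) (intro bexI disjI2)
  qed
qed

text \<open>The Nullstellensatz for the equations of \<open>X\<close> together with the numerator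
  \<open>S\<close> of \<open>g\<close>. On their common zeros \<open>R * P\<close> vanishes: either
  \<open>R\<close> does, or the point lies in the neighbourhood where the hypothesis applies. Near
  \<open>x\<close> the factor \<open>R\<close> is invertible and moves into the denominator of
  \<open>a\<close>.\<close>

lemma local_nullstellensatz:
  assumes f: "f \<in> local_reg X x" and g: "g \<in> local_reg X x"
    and zero: "near (\<lambda>y. g y = 0 \<longrightarrow> f y = 0)"
  shows "\<exists>n. \<exists>a\<in>local_reg X x. near (\<lambda>y. g y * a y = f y ^ n)"
proof -
  obtain P Q where f': "P \<in> poly_fun N" "Q \<in> poly_fun N" "Q (\<phi> x) \<noteq> 0"
    "near (\<lambda>y. Q (\<phi> y) \<noteq> 0 \<and> f y = P (\<phi> y) / Q (\<phi> y))" using local_fraction[OF f] .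
  obtain S T where g': "S \<in> poly_fun N" "T \<in> poly_fun N" "T (\<phi> x) \<noteq> 0"
    "near (\<lambda>y. T (\<phi> y) \<noteq> 0 \<and> g y = S (\<phi> y) / T (\<phi> y))" using local_fraction[OF g] .
  have "near (\<lambda>y. S (\<phi> y) = 0 \<longrightarrow> P (\<phi> y) = 0)"
    using f'(4) g'(4) zero by eventually_elim auto
  then obtain R where R: "R \<in> poly_fun N" "R (\<phi> x) \<noteq> 0"
    "\<And>z. z \<in> cspace N \<Longrightarrow> \<forall>j<c. F j z = 0 \<Longrightarrow> R z \<noteq> 0 \<Longrightarrow> S z = 0 \<Longrightarrow> P z = 0"
    using chart_basic_neighbourhood[OF chart x, of "\<lambda>y. S (\<phi> y) = 0 \<longrightarrow> P (\<phi> y) = 0"] by fastforce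
  let ?F = "F(c := S)"
  let ?K = "gen_ideal N (Suc c) ?F"
  have RP: "R * P \<in> poly_fun N" by (intro poly_fun_algebra R f')
  have "\<exists>n. (R * P) ^ n \<in> ?K"
  proof (rule nullstellensatz[OF _ RP])
    show "is_ideal (poly_fun N) ?K"
      by (rule gen_ideal_is_ideal) (use F g'(1) in \<open>auto simp: less_Suc_eq\<close>)
    fix z assume z: "z \<in> cspace N" "\<And>h. h \<in> ?K \<Longrightarrow> h z = 0"
    have 0: "?F j z = 0" if "j < Suc c" for j using z(2)[OF gen_ideal_member[OF that]] .
    have "\<forall>j<c. F j z = 0"
    proof (intro allI impI)
      fix j assume "j < c"
      then show "F j z = 0" using 0[of j] by simp
    qed
    moreover have "S z = 0" using 0[of c] by simp
    ultimately show "(R * P) z = 0" using R(3)[OF z(1)] by (auto simp: times_fun_apply)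
  qed
  then obtain n k r where nkr: "k \<in> K" "r \<in> poly_fun N" "(R * P) ^ n = k + r * S"
    unfolding gen_ideal_Suc by blast
  let ?w = "(R * Q) ^ n"
  have w: "?w \<in> poly_fun N" by (intro is_subringD(7)[OF is_subring_poly_fun] poly_fun_algebra R f')
  have "?w (\<phi> x) \<noteq> 0" using R(2) f'(3) by (simp add: power_fun_apply times_fun_apply)
  then have "(\<lambda>y. (r * T) (\<phi> y) / ?w (\<phi> y)) \<in> local_reg X x"
    by (intro quotient_local_reg poly_fun_algebra nkr g' w)
  moreover have "near (\<lambda>y. g y * ((r * T) (\<phi> y) / ?w (\<phi> y)) = f y ^ n)"
    using f'(4) g'(4) chart_poly_nonzero[OF chart x R(1,2)]
  proof eventually_elim
    case (elim y)
    have "((R * P) ^ n) (\<phi> y) = r (\<phi> y) * S (\<phi> y)"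
      using K_vanish[OF nkr(1), of y] elim
      by (simp only: nkr(3) plus_fun_apply times_fun_apply) simp
    then have "(R (\<phi> y) * P (\<phi> y)) ^ n = r (\<phi> y) * S (\<phi> y)"
      by (simp only: power_fun_apply times_fun_apply)
    then show ?case using elim
      by (simp add: times_fun_apply power_fun_apply power_mult_distrib power_divide field_simps)
  qed
  ultimately show ?thesis
    by (intro exI[of _ n] bexI[of _ "\<lambda>y. (r * T) (\<phi> y) / ?w (\<phi> y)"])
qed

end

lemma nonsingular_smooth_point:
  assumes "nonsingular_variety X" "x \<in> points X"
  obtains U N \<phi> c F where "smooth_point X x U N \<phi> c F"
proof -
  obtain U N Z \<phi> c F where *: "x \<in> U" "affine_chart X U N Z \<phi>" "\<forall>j<c. F j \<in> poly_fun N"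
    "Z = {z \<in> cspace N. \<forall>j<(c::nat). F j z = 0}"
    "\<forall>a. (\<forall>k<N. (\<Sum>j<c. a j * pderivative k (F j) (\<phi> x)) = 0) \<longrightarrow> (\<forall>j<c. a j = 0)"
    using assms(1)[unfolded nonsingular_variety_def, THEN conjunct2, rule_format, OF assms(2)]
    by (elim exE conjE)
  have "smooth_point X x U N \<phi> c F"
    using * assms(1) by (auto simp: smooth_point_def independent_at_def nonsingular_variety_def)
  then show thesis by (rule that)
qed

section \<open>Stalks of the log sheaf\<close>

text \<open>The common shape of the three target monoids, so that homomorphisms can be classified
  once for an arbitrary \<open>C\<close>.\<close>

definition mult_submonoid :: "'b::comm_monoid_mult set \<Rightarrow> 'b monoid" where
  "mult_submonoid C = \<lparr>carrier = C, monoid.mult = (*), one = 1\<rparr>"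

lemma germ_iff:
  assumes "x \<in> points X"
  shows "g \<in> germ X x f \<longleftrightarrow> (\<forall>\<^sub>F y in nhdsin (ztop X) x. g y = f y)"
  by (simp add: germ_def eventually_near_iff[OF assms])

lemma germ_eq_iff:
  assumes x: "x \<in> points X"
  shows "germ X x f = germ X x g \<longleftrightarrow> (\<forall>\<^sub>F y in nhdsin (ztop X) x. f y = g y)"
proof
  assume "germ X x f = germ X x g"
  moreover have "f \<in> germ X x f" by (simp add: germ_iff[OF x])
  ultimately show "\<forall>\<^sub>F y in nhdsin (ztop X) x. f y = g y" by (simp add: germ_iff[OF x])
next
  assume *: "\<forall>\<^sub>F y in nhdsin (ztop X) x. f y = g y"
  have "h \<in> germ X x f \<longleftrightarrow> h \<in> germ X x g" for h
    unfolding germ_iff[OF x]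
  proof
    assume "\<forall>\<^sub>F y in nhdsin (ztop X) x. h y = f y"
    then show "\<forall>\<^sub>F y in nhdsin (ztop X) x. h y = g y" using * by eventually_elim simp
  next
    assume "\<forall>\<^sub>F y in nhdsin (ztop X) x. h y = g y"
    then show "\<forall>\<^sub>F y in nhdsin (ztop X) x. h y = f y" using * by eventually_elim simp
  qed
  then show "germ X x f = germ X x g" by blast
qed

lemma germ_mult_germ:
  assumes x: "x \<in> points X"
  shows "germ_mult X x (germ X x f) (germ X x g) = germ X x (\<lambda>y. f y * g y)"
proof -
  have "germ X x (\<lambda>y. f' y * g' y) = germ X x (\<lambda>y. f y * g y)"
    if "f' \<in> germ X x f" "g' \<in> germ X x g" for f' g'
  proof -
    have "\<forall>\<^sub>F y in nhdsin (ztop X) x. f' y * g' y = f y * g y"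
      using that[unfolded germ_iff[OF x]] by eventually_elim simp
    then show ?thesis by (simp add: germ_eq_iff[OF x])
  qed
  moreover have "f \<in> germ X x f" "g \<in> germ X x g" by (simp_all add: germ_iff[OF x])
  ultimately show ?thesis unfolding germ_mult_def by fast
qed

lemma stalk_Units_iff:
  assumes X: "variety X" "x \<in> points X"
  shows "germ X x g \<in> Units (stalk X x) \<longleftrightarrow> g \<in> local_reg X x \<and> g x \<noteq> 0"
proof
  assume "germ X x g \<in> Units (stalk X x)"
  then obtain f h where *: "f \<in> local_reg X x" "germ X x g = germ X x f"
    "germ_mult X x (germ X x h) (germ X x g) = germ X x (\<lambda>_. 1)"
    by (auto simp: Units_def stalk_def)
  have "\<forall>\<^sub>F y in nhdsin (ztop X) x. f y = g y" using *(2) by (metis germ_eq_iff[OF X(2)])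
  then have "g \<in> local_reg X x" by (rule local_reg_cong[OF X *(1)])
  moreover have "\<forall>\<^sub>F y in nhdsin (ztop X) x. h y * g y = 1"
    using *(3) by (simp add: germ_mult_germ[OF X(2)] germ_eq_iff[OF X(2)])
  then have "h x * g x = 1" by (rule eventually_near_self[OF X(2)])
  ultimately show "g \<in> local_reg X x \<and> g x \<noteq> 0" by auto
next
  assume g: "g \<in> local_reg X x \<and> g x \<noteq> 0"
  then have "(\<lambda>y. 1 / g y) \<in> local_reg X x"
    by (intro local_reg_combine(3)[OF X] local_reg_const[OF X]) auto
  moreover have nz: "\<forall>\<^sub>F y in nhdsin (ztop X) x. g y \<noteq> 0"
    using g local_reg_combine(4)[OF X, of g g] by blast
  have "\<forall>\<^sub>F y in nhdsin (ztop X) x. 1 / g y * g y = 1" "\<forall>\<^sub>F y in nhdsin (ztop X) x. g y * (1 / g y) = 1"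
    using nz by (eventually_elim, simp)+
  then have "germ_mult X x (germ X x (\<lambda>y. 1 / g y)) (germ X x g) = germ X x (\<lambda>_. 1)"
    "germ_mult X x (germ X x g) (germ X x (\<lambda>y. 1 / g y)) = germ X x (\<lambda>_. 1)"
    by (simp_all only: germ_mult_germ[OF X(2)] germ_eq_iff[OF X(2)])
  ultimately show "germ X x g \<in> Units (stalk X x)"
    using g unfolding Units_def stalk_def monoid.simps partial_object.simps by blast
qed

text \<open>The local algebra, separated from line bundles: the \<open>t i\<close> are equations of
  the branches through \<open>x\<close>. The assumption \<open>tangent\<close> expresses normal
  crossings by tangent vectors that leave one branch and are tangent to the others.\<close>

locale snc_point =
  fixes X :: "'a fspace" and x :: 'a and D :: "'a set" and J :: "'i set" and t :: "'i \<Rightarrow> 'a \<Rightarrow> complex"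
  assumes ns: "nonsingular_variety X" and x: "x \<in> points X" and finJ: "finite J"
    and closedD: "closedin (ztop X) D"
    and t: "\<And>i. i \<in> J \<Longrightarrow> t i \<in> local_reg X x" and t0: "\<And>i. i \<in> J \<Longrightarrow> t i x = 0"
    and tangent: "\<And>i. i \<in> J \<Longrightarrow> \<exists>v\<in>tangent_space X x. v (t i) \<noteq> 0 \<and> (\<forall>j\<in>J. j \<noteq> i \<longrightarrow> v (t j) = 0)"
    and divisor: "\<forall>\<^sub>F y in nhdsin (ztop X) x. y \<in> D \<longleftrightarrow> (\<exists>i\<in>J. t i y = 0)"
begin

abbreviation near :: "('a \<Rightarrow> bool) \<Rightarrow> bool" where
  "near P \<equiv> eventually P (nhdsin (ztop X) x)"

abbreviation O\<^sub>x where "O\<^sub>x \<equiv> local_reg X x"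

lemma X: "variety X"
  using ns by (simp add: nonsingular_variety_def)

lemmas O_combine = local_reg_combine[OF X x] and O_const = local_reg_const[OF X x]
  and O_closed = local_reg_closed[OF X x] and O_cong = local_reg_cong[OF X x]

lemma prime_t:
  assumes "i \<in> J" "f \<in> O\<^sub>x" "g \<in> O\<^sub>x" "h \<in> O\<^sub>x" "near (\<lambda>y. f y * g y = t i y * h y)"
  obtains k where "k \<in> O\<^sub>x" "near (\<lambda>y. f y = t i y * k y)"
    | k where "k \<in> O\<^sub>x" "near (\<lambda>y. g y = t i y * k y)"
proof -
  obtain U N \<phi> c F where "smooth_point X x U N \<phi> c F" using nonsingular_smooth_point[OF ns x] .
  then interpret sp: smooth_point X x U N \<phi> c F .
  obtain v where "v \<in> tangent_space X x" "v (t i) \<noteq> 0" using tangent[OF assms(1)] by blast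
  from sp.local_prime_element[OF t[OF assms(1)] t0[OF assms(1)] this assms(2-)]
  show thesis using that by blast
qed

text \<open>The local ring is a domain, and the germ of \<open>t i\<close> is nonzero because some
  derivation does not kill it.\<close>

lemma cancel_t:
  assumes i: "i \<in> J" and f: "f \<in> O\<^sub>x" and g: "g \<in> O\<^sub>x" and eq: "near (\<lambda>y. t i y * f y = t i y * g y)"
  shows "near (\<lambda>y. f y = g y)"
proof -
  obtain U N \<phi> c F where "smooth_point X x U N \<phi> c F" using nonsingular_smooth_point[OF ns x] .
  then interpret sp: smooth_point X x U N \<phi> c F .
  obtain v where v: "v \<in> tangent_space X x" "v (t i) \<noteq> 0" using tangent[OF i] by blast
  have "near (\<lambda>y. t i y * (f y - g y) = 0)" using eq by eventually_elim (simp add: algebra_simps)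
  then have "near (\<lambda>y. t i y = 0) \<or> near (\<lambda>y. f y - g y = 0)"
    by (rule sp.local_domain[OF t[OF i] O_closed(1)[OF f g]])
  moreover have "\<not> near (\<lambda>y. t i y = 0)"
    using tangent_rules(1)[OF X x v(1) t[OF i] O_const[of 0]] tangent_rules(4)[OF X x v(1), of 0] v(2)
    by auto
  ultimately show ?thesis by simp
qed

text \<open>By the Leibniz rule a derivation that kills \<open>t i\<close> kills all its multiples,
  since \<open>t i\<close> vanishes at \<open>x\<close>. The derivation attached to \<open>j\<close>
  kills \<open>t i\<close> but not \<open>t j\<close>.\<close>

lemma t_not_dvd:
  assumes ij: "i \<in> J" "j \<in> J" "j \<noteq> i" and h: "h \<in> O\<^sub>x"
  shows "\<not> near (\<lambda>y. t j y = t i y * h y)"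
proof
  assume *: "near (\<lambda>y. t j y = t i y * h y)"
  obtain v where v: "v \<in> tangent_space X x" "v (t j) \<noteq> 0" "v (t i) = 0" using tangent[OF ij(2)] ij(1) ij(3)[symmetric] by blast
  note T = tangent_rules[OF X x v(1)]
  have "v (t j) = v (\<lambda>y. t i y * h y)" by (intro T(1) t ij O_combine(2) h *)
  also have "\<dots> = 0" using T(3)[OF t[OF ij(1)] h] t0[OF ij(1)] v(3) by simp
  finally show False using v(2) by simp
qed

section \<open>Unique factorization of germs without zeros off \<open>D\<close>\<close>

definition mon :: "('i \<Rightarrow> nat) \<Rightarrow> 'a \<Rightarrow> complex" where
  "mon n y = (\<Prod>i\<in>J. t i y ^ n i)"

lemma mon_O: "mon n \<in> O\<^sub>x"
  unfolding mon_def by (intro O_closed(3) O_closed(2) t)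

lemma mon_Suc: "i \<in> J \<Longrightarrow> mon (n(i := Suc (n i))) y = t i y * mon n y"
  using finJ by (simp add: mon_def prod.remove[of J i] mult.assoc)

lemma mon_pred:
  assumes "i \<in> J" "0 < n i" shows "mon n y = t i y * mon (n(i := n i - 1)) y"
  using mon_Suc[OF assms(1), of "n(i := n i - 1)"] assms(2) by simp

lemma sum_pred:
  assumes "i \<in> J" "0 < n i" "(\<Sum>i\<in>J. n i) = Suc m"
  shows "(\<Sum>j\<in>J. (n(i := n i - 1)) j) = m"
  using assms finJ by (simp add: sum.remove[of J i])

lemma mon_0: "(\<Sum>i\<in>J. n i) = 0 \<Longrightarrow> mon n y = 1"
  using finJ by (simp add: mon_def)

lemma mon_add: "mon (\<lambda>i. n i + m i) y = mon n y * mon m y"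
  by (simp add: mon_def power_add prod.distrib)

text \<open>One prime \<open>t i\<close> is removed from the monomial at a time. It divides
  \<open>f\<close>, and then contributes to the exponents, or it divides the cofactor
  \<open>a\<close>, and is discarded; in degree zero \<open>f\<close> is invertible at
  \<open>x\<close>.\<close>

lemma factor_divisor:
  assumes "(\<Sum>i\<in>J. m i) = d" "f \<in> O\<^sub>x" "a \<in> O\<^sub>x" "r \<in> O\<^sub>x" "r x \<noteq> 0"
    "near (\<lambda>y. f y * a y = r y * mon m y)"
  shows "\<exists>u\<in>O\<^sub>x. \<exists>n. u x \<noteq> 0 \<and> near (\<lambda>y. f y = u y * mon n y)"
  using assms
proof (induction d arbitrary: m f a)
  case 0
  then have "f x * a x = r x" using eventually_near_self[OF x 0(6)] mon_0[OF 0(1)] by simp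
  then have "f x \<noteq> 0" using 0 by auto
  moreover have "near (\<lambda>y. f y = f y * mon (\<lambda>_. 0) y)" by (simp add: mon_0)
  ultimately show ?case using 0 by blast
next
  case (Suc d)
  then obtain i where i: "i \<in> J" "0 < m i" by (metis gr0I nat.distinct(1) sum.neutral)
  let ?m = "m(i := m i - 1)"
  have eq: "near (\<lambda>y. f y * a y = t i y * (r y * mon ?m y))"
    using Suc.prems(6) by eventually_elim (simp add: mon_pred[of i m, OF i])
  have rm: "(\<lambda>y. r y * mon ?m y) \<in> O\<^sub>x" by (intro O_combine(2) Suc.prems mon_O)
  from prime_t[OF i(1) Suc.prems(2,3) rm eq] show ?case
  proof cases
    case (1 k)
    have "near (\<lambda>y. t i y * (k y * a y) = t i y * (r y * mon ?m y))"
      using 1(2) eq by eventually_elim (simp add: mult.assoc)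
    then have "near (\<lambda>y. k y * a y = r y * mon ?m y)"
      by (rule cancel_t[OF i(1) O_combine(2)[OF 1(1) Suc.prems(3)] rm])
    then obtain u n where un: "u \<in> O\<^sub>x" "u x \<noteq> 0" "near (\<lambda>y. k y = u y * mon n y)"
      using Suc.IH[OF sum_pred[OF i Suc.prems(1)] 1(1) Suc.prems(3-5)] by blast
    have "near (\<lambda>y. f y = u y * mon (n(i := Suc (n i))) y)"
      using 1(2) un(3) by eventually_elim (simp add: mon_Suc[OF i(1)])
    then show ?thesis using un by blast
  next
    case (2 k)
    have "near (\<lambda>y. t i y * (f y * k y) = t i y * (r y * mon ?m y))"
      using 2(2) eq by eventually_elim (simp add: mult_ac)
    then have "near (\<lambda>y. f y * k y = r y * mon ?m y)"
      by (rule cancel_t[OF i(1) O_combine(2)[OF Suc.prems(2) 2(1)] rm])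
    then show ?thesis using Suc.IH[OF sum_pred[OF i Suc.prems(1)] Suc.prems(2) 2(1) Suc.prems(4,5)] by blast
  qed
qed

lemma factorization:
  assumes g: "g \<in> O\<^sub>x" "near (\<lambda>y. y \<notin> D \<longrightarrow> g y \<noteq> 0)"
  obtains u n where "u \<in> O\<^sub>x" "u x \<noteq> 0" "near (\<lambda>y. g y = u y * mon n y)"
proof -
  obtain U N \<phi> c F where "smooth_point X x U N \<phi> c F" using nonsingular_smooth_point[OF ns x] .
  then interpret sp: smooth_point X x U N \<phi> c F .
  \<comment> \<open>With all exponents equal to one, \<open>mon\<close> is the product of the local
    equations, whose zeros near \<open>x\<close> are the points of \<open>D\<close>.\<close>
  have "near (\<lambda>y. g y = 0 \<longrightarrow> mon (\<lambda>_. 1) y = 0)"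
    using g(2) divisor by eventually_elim (auto simp: mon_def finJ)
  from sp.local_nullstellensatz[OF mon_O g(1) this]
  obtain n a where na: "a \<in> O\<^sub>x" "near (\<lambda>y. g y * a y = mon (\<lambda>_. 1) y ^ n)" by blast
  have "near (\<lambda>y. g y * a y = 1 * mon (\<lambda>_. n) y)"
    using na(2) by eventually_elim (simp add: mon_def prod_power_distrib)
  from factor_divisor[OF refl g(1) na(1) O_const _ this] show thesis using that by auto
qed

text \<open>Any prime \<open>t j\<close> of the monomial divides \<open>t i * h\<close> but not
  \<open>t i\<close>, so it divides \<open>h\<close> and can be cancelled. In degree zero a multiple
  of \<open>t i\<close> would be a unit.\<close>

lemma t_not_dvd_mon:
  assumes "(\<Sum>i\<in>J. m i) = d" "i \<in> J" "m i = 0" "h \<in> O\<^sub>x" "w \<in> O\<^sub>x" "w x \<noteq> 0"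
  shows "\<not> near (\<lambda>y. t i y * h y = w y * mon m y)"
  using assms
proof (induction d arbitrary: m h)
  case 0
  show ?case
  proof
    assume "near (\<lambda>y. t i y * h y = w y * mon m y)"
    then have "t i x * h x = w x * mon m x" by (rule eventually_near_self[OF x])
    then show False using t0[OF 0(2)] mon_0[OF 0(1)] 0 by simp
  qed
next
  case (Suc d)
  then obtain j where j: "j \<in> J" "0 < m j" by (metis gr0I nat.distinct(1) sum.neutral)
  have ji: "j \<noteq> i" using Suc.prems(3) j(2) by auto
  let ?m = "m(j := m j - 1)"
  show ?case
  proof
    assume "near (\<lambda>y. t i y * h y = w y * mon m y)"
    then have eq: "near (\<lambda>y. t i y * h y = t j y * (w y * mon ?m y))"
      by eventually_elim (simp add: mon_pred[of j m, OF j])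
    have wm: "(\<lambda>y. w y * mon ?m y) \<in> O\<^sub>x" by (intro O_combine(2) Suc.prems mon_O)
    from prime_t[OF j(1) t[OF Suc.prems(2)] Suc.prems(4) wm eq] show False
    proof cases
      case (1 k)
      then show False using t_not_dvd[OF j(1) Suc.prems(2) _ 1(1)] ji by blast
    next
      case (2 k)
      have "near (\<lambda>y. t j y * (t i y * k y) = t j y * (w y * mon ?m y))"
        using 2(2) eq by eventually_elim (simp add: mult_ac)
      then have "near (\<lambda>y. t i y * k y = w y * mon ?m y)"
        by (rule cancel_t[OF j(1) O_combine(2)[OF t[OF Suc.prems(2)] 2(1)] wm])
      moreover have "?m i = 0" using Suc.prems(3) ji by simp
      from Suc.IH[OF sum_pred[OF j Suc.prems(1)] Suc.prems(2) this 2(1) Suc.prems(5,6)]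
      have "\<not> near (\<lambda>y. t i y * k y = w y * mon ?m y)" .
      ultimately show False by blast
    qed
  qed
qed

text \<open>A \<open>t i\<close> that occurs on the left must occur on the right by
  \<open>t_not_dvd_mon\<close>, and is cancelled from both sides. Once nothing is left on the left,
  the same lemma excludes further factors on the right.\<close>

lemma factorization_unique:
  assumes "(\<Sum>i\<in>J. n i) = d" "u \<in> O\<^sub>x" "u x \<noteq> 0" "w \<in> O\<^sub>x" "w x \<noteq> 0"
    "near (\<lambda>y. u y * mon n y = w y * mon m y)"
  shows "(\<forall>i\<in>J. n i = m i) \<and> near (\<lambda>y. u y = w y)"
  using assms
proof (induction d arbitrary: n m)
  case 0
  have m0: "m i = 0" if i: "i \<in> J" for i
  proof (rule ccontr)
    assume "m i \<noteq> 0"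
    then have mi: "0 < m i" by simp
    have n0: "n i = 0" using 0(1) i finJ by simp
    have "near (\<lambda>y. t i y * (w y * mon (m(i := m i - 1)) y) = u y * mon n y)"
      using 0(6) by eventually_elim (simp add: mon_pred[of i m, OF i mi])
    then show False
      using t_not_dvd_mon[OF 0(1) i n0 O_combine(2)[OF 0(4) mon_O] 0(2,3)] by blast
  qed
  then have sm: "(\<Sum>i\<in>J. m i) = 0" by simp
  have "near (\<lambda>y. u y = w y)"
    using 0(6) by eventually_elim (simp add: mon_0[OF sm] mon_0[OF 0(1)])
  moreover have "\<forall>i\<in>J. n i = m i" using 0(1) m0 finJ by simp
  ultimately show ?case by blast
next
  case (Suc d)
  then obtain i where i: "i \<in> J" "0 < n i" by (metis gr0I nat.distinct(1) sum.neutral)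
  let ?n = "n(i := n i - 1)" and ?m = "m(i := m i - 1)"
  have eq: "near (\<lambda>y. t i y * (u y * mon ?n y) = w y * mon m y)"
    using Suc.prems(6) by eventually_elim (simp add: mon_pred[of i n, OF i] mult.left_commute)
  have un: "(\<lambda>y. u y * mon ?n y) \<in> O\<^sub>x" by (intro O_combine(2) Suc.prems mon_O)
  have wm: "(\<lambda>y. w y * mon ?m y) \<in> O\<^sub>x" by (intro O_combine(2) Suc.prems mon_O)
  have mi: "0 < m i"
    using t_not_dvd_mon[OF refl i(1) _ un Suc.prems(4,5)] eq by blast
  have "near (\<lambda>y. t i y * (u y * mon ?n y) = t i y * (w y * mon ?m y))"
    using eq by eventually_elim (simp add: mon_pred[of i m, OF i(1) mi])
  then have "near (\<lambda>y. u y * mon ?n y = w y * mon ?m y)" by (rule cancel_t[OF i(1) un wm])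
  from Suc.IH[OF sum_pred[OF i Suc.prems(1)] Suc.prems(2-5) this]
  have *: "\<forall>j\<in>J. ?n j = ?m j" "near (\<lambda>y. u y = w y)" by blast+
  have "n j = m j" if "j \<in> J" for j
    using bspec[OF *(1) that] i(2) mi by (cases "j = i") auto
  then show ?case using *(2) by blast
qed

text \<open>Invertibility on \<open>U - D\<close> reduces to the absence of zeros:
  \<open>1 / g\<close> is regular at each point of this open set, hence on the whole of it.\<close>

lemma log_carrier_iff:
  "germ X x g \<in> carrier (log_stalk X D x) \<longleftrightarrow> g \<in> O\<^sub>x \<and> near (\<lambda>y. y \<notin> D \<longrightarrow> g y \<noteq> 0)"
proof
  assume "germ X x g \<in> carrier (log_stalk X D x)"
  then obtain U f where *: "germ X x g = germ X x f" "openin (ztop X) U" "x \<in> U" "f \<in> log_sheaf X D U"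
    by (auto simp: log_stalk_def)
  have eq: "near (\<lambda>y. f y = g y)" using *(1) by (metis germ_eq_iff[OF x])
  have "f \<in> O\<^sub>x" using * by (auto simp: local_reg_def log_sheaf_def)
  then have "g \<in> O\<^sub>x" using O_cong eq by blast
  moreover obtain h where "\<forall>y\<in>U - D. f y * h y = 1" using *(4) by (auto simp: log_sheaf_def)
  then have "\<forall>y\<in>U. y \<notin> D \<longrightarrow> f y \<noteq> 0" by force
  then have "near (\<lambda>y. y \<notin> D \<longrightarrow> f y \<noteq> 0)"
    unfolding eventually_near_iff[OF x] using *(2,3) by blast
  then have "near (\<lambda>y. y \<notin> D \<longrightarrow> g y \<noteq> 0)" using eq by eventually_elim simp
  ultimately show "g \<in> O\<^sub>x \<and> near (\<lambda>y. y \<notin> D \<longrightarrow> g y \<noteq> 0)" ..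
next
  assume g: "g \<in> O\<^sub>x \<and> near (\<lambda>y. y \<notin> D \<longrightarrow> g y \<noteq> 0)"
  then obtain U V where UV: "openin (ztop X) U" "x \<in> U" "g \<in> reg X U"
    "openin (ztop X) V" "x \<in> V" "\<forall>y\<in>V. y \<notin> D \<longrightarrow> g y \<noteq> 0"
    unfolding eventually_near_iff[OF x] local_reg_def by blast
  let ?W = "U \<inter> V"
  have W: "openin (ztop X) ?W" using UV by blast
  have gW: "g \<in> reg X ?W"
    by (rule function_sheafD(2)[OF variety_sheaf[OF X] UV(1) W _ UV(3)]) simp
  have WD: "openin (ztop X) (?W - D)" by (rule openin_diff[OF W closedD])
  have "(\<lambda>y. 1 / g y) \<in> local_reg X y" if y: "y \<in> ?W - D" for y
  proof -
    have yX: "y \<in> points X" using openin_subset[OF WD] y by blast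
    have "g \<in> local_reg X y" using gW W y by (auto simp: local_reg_def)
    then show ?thesis
      using y UV(6) by (intro local_reg_combine(3)[OF X yX] local_reg_const[OF X yX]) auto
  qed
  then have "(\<lambda>y. 1 / g y) \<in> reg X (?W - D)" using reg_iff_local_reg[OF X WD] by blast
  then have "g \<in> log_sheaf X D ?W"
    unfolding log_sheaf_def using gW UV(6) by (intro CollectI conjI bexI[of _ "\<lambda>y. 1 / g y"]) auto
  then show "germ X x g \<in> carrier (log_stalk X D x)"
    using W UV unfolding log_stalk_def partial_object.simps by blast
qed

lemma log_carrier_germ:
  assumes "a \<in> carrier (log_stalk X D x)" obtains g where "a = germ X x g"
  using assms by (auto simp: log_stalk_def)

lemma log_mult: "germ X x f \<otimes>\<^bsub>log_stalk X D x\<^esub> germ X x g = germ X x (\<lambda>y. f y * g y)"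
  by (simp add: log_stalk_def germ_mult_germ[OF x])

lemma log_one: "\<one>\<^bsub>log_stalk X D x\<^esub> = germ X x (\<lambda>y. 1)"
  by (simp add: log_stalk_def)

lemma t_nonzero_off_D: "i \<in> J \<Longrightarrow> near (\<lambda>y. y \<notin> D \<longrightarrow> t i y \<noteq> 0)"
  using divisor by eventually_elim auto

lemma t_carrier: "i \<in> J \<Longrightarrow> germ X x (t i) \<in> carrier (log_stalk X D x)"
  by (simp add: log_carrier_iff t t_nonzero_off_D)

lemma unit_carrier: "u \<in> O\<^sub>x \<Longrightarrow> u x \<noteq> 0 \<Longrightarrow> germ X x u \<in> carrier (log_stalk X D x)"
  using O_combine(4)[of u u] by (auto simp: log_carrier_iff elim: eventually_mono)

lemma carrier_mult:
  assumes "germ X x f \<in> carrier (log_stalk X D x)" "germ X x g \<in> carrier (log_stalk X D x)"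
  shows "germ X x (\<lambda>y. f y * g y) \<in> carrier (log_stalk X D x)"
proof -
  have "near (\<lambda>y. y \<notin> D \<longrightarrow> f y * g y \<noteq> 0)"
    using assms[unfolded log_carrier_iff, THEN conjunct2] by eventually_elim simp
  then show ?thesis using assms O_combine(2) by (simp add: log_carrier_iff)
qed

lemma log_stalk_factorization:
  assumes "a \<in> carrier (log_stalk X D x)"
  obtains u n where "u \<in> O\<^sub>x" "u x \<noteq> 0" "a = germ X x (\<lambda>y. u y * mon n y)"
proof -
  obtain g where g: "a = germ X x g" using log_carrier_germ[OF assms] .
  then have "g \<in> O\<^sub>x" "near (\<lambda>y. y \<notin> D \<longrightarrow> g y \<noteq> 0)" using assms log_carrier_iff by auto
  then obtain u n where "u \<in> O\<^sub>x" "u x \<noteq> 0" "near (\<lambda>y. g y = u y * mon n y)" by (rule factorization)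
  then show thesis using that g germ_eq_iff[OF x] by metis
qed

lemma mon_hom_value:
  assumes h: "h \<in> mon_hom (log_stalk X D x) (mult_submonoid C)" and u: "u \<in> O\<^sub>x" "u x \<noteq> 0"
  shows "h (germ X x (\<lambda>y. u y * mon n y)) = h (germ X x u) * (\<Prod>i\<in>J. h (germ X x (t i)) ^ n i)"
proof -
  let ?M = "carrier (log_stalk X D x)"
  have hm: "h (germ X x (\<lambda>y. f y * g y)) = h (germ X x f) * h (germ X x g)"
    if "germ X x f \<in> ?M" "germ X x g \<in> ?M" for f g
    using h that by (auto simp: mon_hom_def hom_def mult_submonoid_def simp flip: log_mult)
  have h1: "h (germ X x (\<lambda>y. 1)) = 1"
    using h by (simp add: mon_hom_def mult_submonoid_def flip: log_one)
  have 1: "germ X x (\<lambda>y. 1) \<in> ?M" by (rule unit_carrier[OF O_const]) simp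
  have pow: "germ X x (\<lambda>y. t i y ^ k) \<in> ?M \<and> h (germ X x (\<lambda>y. t i y ^ k)) = h (germ X x (t i)) ^ k"
    if "i \<in> J" for i k
  proof (induction k)
    case (Suc k)
    then show ?case
      using carrier_mult[OF t_carrier[OF that], of "\<lambda>y. t i y ^ k"] hm[OF t_carrier[OF that], of "\<lambda>y. t i y ^ k"]
      by simp
  qed (use 1 h1 in simp)
  have prod: "germ X x (\<lambda>y. \<Prod>i\<in>S. t i y ^ n i) \<in> ?M \<and>
    h (germ X x (\<lambda>y. \<Prod>i\<in>S. t i y ^ n i)) = (\<Prod>i\<in>S. h (germ X x (t i)) ^ n i)"
    if "finite S" "S \<subseteq> J" for S
    using that
  proof (induction S rule: finite_induct)
    case empty
    then show ?case using 1 h1 by simp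
  next
    case (insert i S)
    then have "i \<in> J" "S \<subseteq> J" by auto
    then show ?case
      using insert pow[of i "n i"] carrier_mult[of "\<lambda>y. t i y ^ n i" "\<lambda>y. \<Prod>i\<in>S. t i y ^ n i"]
        hm[of "\<lambda>y. t i y ^ n i" "\<lambda>y. \<Prod>i\<in>S. t i y ^ n i"] by simp
  qed
  have eq: "germ X x (mon n) = germ X x (\<lambda>y. \<Prod>i\<in>J. t i y ^ n i)" by (simp add: mon_def[abs_def])
  show ?thesis
    using hm[OF unit_carrier[OF u], of "mon n"] prod[OF finJ] unfolding eq by (simp add: eq)
qed

text \<open>Serves the change of the nonvanishing section, which replaces a local equation
  \<open>t i\<close> by its multiple \<open>f\<close> by a unit.\<close>

lemma mon_hom_unit_multiple:
  assumes h: "h \<in> mon_hom (log_stalk X D x) (mult_submonoid C)" and i: "i \<in> J"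
    and u: "u \<in> O\<^sub>x" "u x \<noteq> 0" and f: "f \<in> O\<^sub>x" and eq: "near (\<lambda>y. t i y = u y * f y)"
  shows "h (germ X x f) \<in> C" "h (germ X x (t i)) = h (germ X x u) * h (germ X x f)"
proof -
  have "near (\<lambda>y. y \<notin> D \<longrightarrow> f y \<noteq> 0)" using eq t_nonzero_off_D[OF i] by eventually_elim auto
  then have fc: "germ X x f \<in> carrier (log_stalk X D x)" using f by (simp add: log_carrier_iff)
  then show "h (germ X x f) \<in> C" using h by (auto simp: mon_hom_def hom_def mult_submonoid_def)
  have "germ X x (t i) = germ X x u \<otimes>\<^bsub>log_stalk X D x\<^esub> germ X x f"
    using eq by (simp add: log_mult germ_eq_iff[OF x])
  then show "h (germ X x (t i)) = h (germ X x u) * h (germ X x f)"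
    using h unit_carrier[OF u] fc by (auto simp: mon_hom_def hom_def mult_submonoid_def)
qed

lemma mon_hom_t: "h \<in> mon_hom (log_stalk X D x) (mult_submonoid C) \<Longrightarrow> i \<in> J \<Longrightarrow> h (germ X x (t i)) \<in> C"
  using t_carrier by (auto simp: mon_hom_def hom_def mult_submonoid_def)

lemma mon_hom_eqI:
  assumes h: "h \<in> mon_hom (log_stalk X D x) (mult_submonoid C)"
    "h' \<in> mon_hom (log_stalk X D x) (mult_submonoid C)"
    and units: "\<And>u. u \<in> O\<^sub>x \<Longrightarrow> u x \<noteq> 0 \<Longrightarrow> h (germ X x u) = h' (germ X x u)"
    and ts: "\<And>i. i \<in> J \<Longrightarrow> h (germ X x (t i)) = h' (germ X x (t i))"
  shows "h = h'"
proof (rule extensionalityI)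
  show "h \<in> extensional (carrier (log_stalk X D x))" "h' \<in> extensional (carrier (log_stalk X D x))"
    using h by (auto simp: mon_hom_def)
  fix a assume "a \<in> carrier (log_stalk X D x)"
  then obtain u n where u: "u \<in> O\<^sub>x" "u x \<noteq> 0" "a = germ X x (\<lambda>y. u y * mon n y)"
    by (rule log_stalk_factorization)
  show "h a = h' a"
    unfolding u(3) mon_hom_value[OF h(1) u(1,2)] mon_hom_value[OF h(2) u(1,2)]
    using units[OF u(1,2)] ts by simp
qed

text \<open>Freeness of the stalk over its units. By uniqueness of the factorization the germ
  determines the exponents and the value \<open>u x\<close>, so the intended value is well defined.
  The codomain is only a commutative monoid, since infinity has no inverse in (0, infinity].\<close>

lemma mon_hom_exists:
  fixes \<kappa> :: "complex \<Rightarrow> 'b::comm_monoid_mult"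
  assumes C: "1 \<in> C" "\<And>b c. b \<in> C \<Longrightarrow> c \<in> C \<Longrightarrow> b * c \<in> C"
    and \<kappa>: "\<And>z. z \<noteq> 0 \<Longrightarrow> \<kappa> z \<in> C" "\<And>z w. z \<noteq> 0 \<Longrightarrow> w \<noteq> 0 \<Longrightarrow> \<kappa> (z * w) = \<kappa> z * \<kappa> w" "\<kappa> 1 = 1"
    and v: "\<And>i. i \<in> J \<Longrightarrow> v i \<in> C"
  shows "\<exists>h\<in>mon_hom (log_stalk X D x) (mult_submonoid C).
    (\<forall>g. germ X x g \<in> Units (stalk X x) \<longrightarrow> h (germ X x g) = \<kappa> (g x)) \<and>
    (\<forall>i\<in>J. h (germ X x (t i)) = v i)"
proof -
  let ?M = "carrier (log_stalk X D x)"
  let ?val = "\<lambda>u n. \<kappa> (u x) * (\<Prod>i\<in>J. v i ^ n i)"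
  \<comment> \<open>The choice ranges over the values of all factorizations of \<open>a\<close>,
    which \<open>val\<close> shows to coincide. The restriction to the carrier gives the
    extensionality that \<open>mon_hom\<close> demands.\<close>
  define h where "h = (\<lambda>a\<in>?M. SOME b. \<exists>u n. u \<in> O\<^sub>x \<and> u x \<noteq> 0 \<and>
    a = germ X x (\<lambda>y. u y * mon n y) \<and> b = ?val u n)"
  have mon_carrier: "germ X x (mon n) \<in> ?M" for n
    using mon_O divisor by (auto simp: log_carrier_iff mon_def finJ elim!: eventually_mono)
  have carrier: "germ X x (\<lambda>y. u y * mon n y) \<in> ?M" if "u \<in> O\<^sub>x" "u x \<noteq> 0" for u n
    by (rule carrier_mult[OF unit_carrier[OF that] mon_carrier])
  have val: "h (germ X x (\<lambda>y. u y * mon n y)) = ?val u n" if u: "u \<in> O\<^sub>x" "u x \<noteq> 0" for u n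
  proof -
    let ?P = "\<lambda>b. \<exists>w m. w \<in> O\<^sub>x \<and> w x \<noteq> 0 \<and>
      germ X x (\<lambda>y. u y * mon n y) = germ X x (\<lambda>y. w y * mon m y) \<and> b = ?val w m"
    have "?P (?val u n)" using u by blast
    then have "?P (SOME b. ?P b)" by (rule someI[of ?P])
    then obtain w m where w: "w \<in> O\<^sub>x" "w x \<noteq> 0"
      "germ X x (\<lambda>y. u y * mon n y) = germ X x (\<lambda>y. w y * mon m y)" "(SOME b. ?P b) = ?val w m" by blast
    have "near (\<lambda>y. u y * mon n y = w y * mon m y)" using w(3) germ_eq_iff[OF x] by simp
    from factorization_unique[OF refl u w(1,2) this]
    have *: "\<forall>i\<in>J. n i = m i" "near (\<lambda>y. u y = w y)" by blast+
    have "u x = w x" using eventually_near_self[OF x *(2)] .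
    then have "?val w m = ?val u n" using *(1) by simp
    then show ?thesis using w(4) carrier[OF u] by (simp add: h_def)
  qed
  have powC: "b ^ k \<in> C" if "b \<in> C" for b k by (induction k) (auto intro: C that)
  have prodC: "(\<Prod>i\<in>J. v i ^ n i) \<in> C" for n
  proof -
    have "(\<Prod>i\<in>S. v i ^ n i) \<in> C" if "S \<subseteq> J" for S
      using that by (induction S rule: infinite_finite_induct) (auto intro: C powC v)
    then show ?thesis by blast
  qed
  have hC: "h a \<in> C" if "a \<in> ?M" for a
    using log_stalk_factorization[OF that] val C(2) \<kappa>(1) prodC by metis
  have hmult: "h (a \<otimes>\<^bsub>log_stalk X D x\<^esub> b) = h a * h b" if ab: "a \<in> ?M" "b \<in> ?M" for a b
  proof -
    obtain u n where u: "u \<in> O\<^sub>x" "u x \<noteq> 0" "a = germ X x (\<lambda>y. u y * mon n y)"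
      using log_stalk_factorization[OF ab(1)] .
    obtain w m where w: "w \<in> O\<^sub>x" "w x \<noteq> 0" "b = germ X x (\<lambda>y. w y * mon m y)"
      using log_stalk_factorization[OF ab(2)] .
    have uw: "(\<lambda>y. u y * w y) \<in> O\<^sub>x" "u x * w x \<noteq> 0" using u w O_combine(2) by auto
    have "a \<otimes>\<^bsub>log_stalk X D x\<^esub> b = germ X x (\<lambda>y. (u y * w y) * mon (\<lambda>i. n i + m i) y)"
      unfolding u(3) w(3) log_mult mon_add by (simp add: mult_ac)
    also have "h \<dots> = ?val (\<lambda>y. u y * w y) (\<lambda>i. n i + m i)" by (rule val[OF uw])
    also have "\<dots> = ?val u n * ?val w m"
      using \<kappa>(2)[OF u(2) w(2)] by (simp add: power_add prod.distrib mult_ac)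
    finally show ?thesis using val[OF u(1,2)] val[OF w(1,2)] u(3) w(3) by simp
  qed
  have hunit: "h (germ X x u) = \<kappa> (u x)" if "u \<in> O\<^sub>x" "u x \<noteq> 0" for u
    using val[OF that, of "\<lambda>_. 0"] by (simp add: mon_0)
  have ht: "h (germ X x (t i)) = v i" if i: "i \<in> J" for i
  proof -
    have "mon ((\<lambda>_. 0)(i := Suc 0)) y = t i y" for y
      using mon_Suc[OF i, of "\<lambda>_. 0" y] mon_0[of "\<lambda>_. 0" y] by simp
    moreover have "(\<Prod>j\<in>J. v j ^ ((\<lambda>_. 0)(i := Suc 0)) j) = v i"
      using finJ i by (simp add: prod.remove[of J i])
    ultimately show ?thesis
      using val[OF O_const[of 1], of "(\<lambda>_. 0)(i := Suc 0)"] \<kappa>(3) by simp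
  qed
  have "h \<in> mon_hom (log_stalk X D x) (mult_submonoid C)"
    unfolding mon_hom_def hom_def mult_submonoid_def log_one
    using hC hmult hunit[OF O_const[of 1]] \<kappa>(3) by (auto simp: h_def)
  moreover have "\<forall>g. germ X x g \<in> Units (stalk X x) \<longrightarrow> h (germ X x g) = \<kappa> (g x)"
    using hunit by (simp add: stalk_Units_iff[OF X x])
  ultimately show ?thesis using ht by blast
qed

end

section \<open>Line bundles\<close>

lemma line_bundle_fibre:
  assumes L: "line_bundle X L" and y: "y \<in> points X"
    and l: "l \<in> fibre L y" "l \<noteq> 0" and w: "w \<in> fibre L y"
  shows "\<exists>c. w = scal L c l"
proof -
  interpret vector_space "scal L" using L by (simp add: line_bundle_def)
  have dim: "subspace (fibre L y)" "dim (fibre L y) = 1" using L y by (auto simp: line_bundle_def)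
  obtain B where B: "B \<subseteq> fibre L y" "fibre L y \<subseteq> span B" "card B = 1"
    using basis_exists[of "fibre L y"] dim(2) by metis
  obtain b where b: "B = {b}" using B(3) by (auto simp: card_1_singleton_iff)
  have "l \<in> range (\<lambda>k. scal L k b)" "w \<in> range (\<lambda>k. scal L k b)"
    using l w B(2) by (auto simp: b span_singleton)
  then obtain c d where "l = scal L c b" "w = scal L d b" by blast
  then have "w = scal L (d / c) l" using l(2) by auto
  then show ?thesis ..
qed

lemma line_bundle_rules:
  assumes L: "line_bundle X L"
  shows "scal L a (scal L b w) = scal L (a * b) w" "scal L 1 w = w" "scal L 0 w = 0"
    "scal L a w = scal L b w \<longleftrightarrow> a = b \<or> w = 0" "scal L a w = 0 \<longleftrightarrow> a = 0 \<or> w = 0"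
    "y \<in> points X \<Longrightarrow> w \<in> fibre L y \<Longrightarrow> scal L a w \<in> fibre L y"
proof -
  interpret vector_space "scal L" using L by (simp add: line_bundle_def)
  show "scal L a (scal L b w) = scal L (a * b) w" "scal L 1 w = w" "scal L 0 w = 0"
    "scal L a w = scal L b w \<longleftrightarrow> a = b \<or> w = 0" "scal L a w = 0 \<longleftrightarrow> a = 0 \<or> w = 0"
    by (simp_all add: scale_cancel_right)
  show "y \<in> points X \<Longrightarrow> w \<in> fibre L y \<Longrightarrow> scal L a w \<in> fibre L y"
    using L by (auto simp: line_bundle_def intro: subspace_scale)
qed

lemma sec_quot_eqI:
  assumes "line_bundle X L" "l y \<noteq> 0" "s y = scal L c (l y)"
  shows "sec_quot L s l y = c"
  unfolding sec_quot_def using assms(2,3) line_bundle_rules(4)[OF assms(1)] by (intro the_equality) auto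

lemma sec_quot_scal:
  assumes "line_bundle X L" "y \<in> points X" "l y \<in> fibre L y" "l y \<noteq> 0" "s y \<in> fibre L y"
  shows "scal L (sec_quot L s l y) (l y) = s y"
proof -
  obtain c where "s y = scal L c (l y)" using line_bundle_fibre[OF assms] by blast
  then show ?thesis using sec_quot_eqI[of X L l y s c] assms by simp
qed

lemma frame_at:
  assumes L: "line_bundle X L" and x: "x \<in> points X"
  obtains U m where "(U, m) \<in> frames L" "openin (ztop X) U" "x \<in> U"
    "\<And>y. y \<in> U \<Longrightarrow> m y \<in> fibre L y" "\<And>y. y \<in> U \<Longrightarrow> m y \<noteq> 0" "m \<in> nonvanishing_near X L x"
proof -
  note LB = conjunct2[OF conjunct2[OF L[unfolded line_bundle_def]]]
  note fr = conjunct1[OF LB] conjunct1[OF conjunct2[OF LB]] conjunct2[OF conjunct2[OF LB]]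
  obtain U m where m: "(U, m) \<in> frames L" "x \<in> U" using fr(2) x by blast
  have U: "openin (ztop X) U" "\<And>y. y \<in> U \<Longrightarrow> m y \<in> fibre L y" "\<And>y. y \<in> U \<Longrightarrow> m y \<noteq> 0"
    using fr(1) m(1) by blast+
  have "sec_quot L m l \<in> reg X (U \<inter> V)" if "(V, l) \<in> frames L" for V l
    using fr(3) m(1) that by (fastforce simp: Int_commute)
  then have "regular_section X L U m" unfolding regular_section_def using U(2) by blast
  then have "m \<in> nonvanishing_near X L x"
    unfolding nonvanishing_near_def using U m(2) by blast
  then show thesis using that m U by blast
qed

lemma nonvanishing_nearD:
  assumes x: "x \<in> points X" and l: "l \<in> nonvanishing_near X L x"
  obtains U where "openin (ztop X) U" "x \<in> U" "regular_section X L U l"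
    "\<And>y. y \<in> U \<Longrightarrow> l y \<in> fibre L y" "\<And>y. y \<in> U \<Longrightarrow> l y \<noteq> 0"
  using l unfolding nonvanishing_near_def regular_section_def by blast

lemma sec_quot_frame_local_reg:
  assumes X: "variety X" and reg: "regular_section X L U s" and U: "openin (ztop X) U" "x \<in> U"
    and m: "(V, m) \<in> frames L" "openin (ztop X) V" "x \<in> V"
  shows "sec_quot L s m \<in> local_reg X x"
proof -
  have "sec_quot L s m \<in> reg X (U \<inter> V)" using reg m(1) unfolding regular_section_def by blast
  then show ?thesis unfolding local_reg_def using U m by blast
qed

text \<open>The atlas gives regularity only for quotients by a frame \<open>m\<close>. For an
  arbitrary nonvanishing section, \<open>s / l\<close> is \<open>(s / m) / (l / m)\<close> near
  \<open>x\<close>.\<close>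

lemma sec_quot_local_reg:
  assumes X: "variety X" and L: "line_bundle X L"
    and reg: "regular_section X L U s" and U: "openin (ztop X) U" "x \<in> U"
    and l: "l \<in> nonvanishing_near X L x"
  shows "sec_quot L s l \<in> local_reg X x"
    and "\<forall>\<^sub>F y in nhdsin (ztop X) x. l y \<noteq> 0 \<and> scal L (sec_quot L s l y) (l y) = s y"
proof -
  have x: "x \<in> points X" using openin_subset[OF U(1)] U(2) by blast
  obtain V m where m: "(V, m) \<in> frames L" "openin (ztop X) V" "x \<in> V"
    "\<And>y. y \<in> V \<Longrightarrow> m y \<in> fibre L y" "\<And>y. y \<in> V \<Longrightarrow> m y \<noteq> 0" using frame_at[OF L x] by metis
  obtain W where W: "openin (ztop X) W" "x \<in> W" "regular_section X L W l"
    "\<And>y. y \<in> W \<Longrightarrow> l y \<in> fibre L y" "\<And>y. y \<in> W \<Longrightarrow> l y \<noteq> 0" using nonvanishing_nearD[OF x l] by blast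
  have sU: "s y \<in> fibre L y" if "y \<in> U" for y using reg that by (simp add: regular_section_def)
  note R = line_bundle_rules[OF L]
  let ?a = "sec_quot L s m" and ?b = "sec_quot L l m"
  have a: "?a \<in> local_reg X x" by (rule sec_quot_frame_local_reg[OF X reg U m(1-3)])
  have b: "?b \<in> local_reg X x" by (rule sec_quot_frame_local_reg[OF X W(3) W(1,2) m(1-3)])
  have pts: "y \<in> points X" if "y \<in> U \<inter> V \<inter> W" for y using that openin_subset[OF U(1)] by blast
  have bm: "scal L (?b y) (m y) = l y" "?b y \<noteq> 0" if "y \<in> U \<inter> V \<inter> W" for y
  proof -
    show *: "scal L (?b y) (m y) = l y" using that by (intro sec_quot_scal[OF L pts] m W) auto
    show "?b y \<noteq> 0"
    proof
      assume "?b y = 0"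
      then show False using * R(3)[of "m y"] W(5)[of y] that by simp
    qed
  qed
  have am: "scal L (?a y) (m y) = s y" if "y \<in> U \<inter> V \<inter> W" for y
    using that by (intro sec_quot_scal[OF L pts] m sU) auto
  have eq: "sec_quot L s l y = ?a y / ?b y" if y: "y \<in> U \<inter> V \<inter> W" for y
  proof (rule sec_quot_eqI[OF L])
    show "l y \<noteq> 0" using W y by auto
    have "scal L (?a y / ?b y) (l y) = scal L (?a y / ?b y) (scal L (?b y) (m y))" using bm[OF y] by simp
    also have "\<dots> = scal L (?a y) (m y)" unfolding R(1) using bm(2)[OF y] by simp
    finally show "s y = scal L (?a y / ?b y) (l y)" using am[OF y] by simp
  qed
  have nbhd: "openin (ztop X) (U \<inter> V \<inter> W)" "x \<in> U \<inter> V \<inter> W" using U m W by auto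
  have near: "\<forall>\<^sub>F y in nhdsin (ztop X) x. y \<in> U \<inter> V \<inter> W"
    unfolding eventually_near_iff[OF x] using nbhd by blast
  have "(\<lambda>y. ?a y / ?b y) \<in> local_reg X x"
    by (rule local_reg_combine(3)[OF X x a b bm(2)[OF nbhd(2)]])
  moreover have "\<forall>\<^sub>F y in nhdsin (ztop X) x. ?a y / ?b y = sec_quot L s l y"
    using near by eventually_elim (simp add: eq)
  ultimately show "sec_quot L s l \<in> local_reg X x" by (rule local_reg_cong[OF X x])
  show "\<forall>\<^sub>F y in nhdsin (ztop X) x. l y \<noteq> 0 \<and> scal L (sec_quot L s l y) (l y) = s y"
    using near
  proof eventually_elim
    case (elim y)
    then show ?case using W(5) by (auto intro!: sec_quot_scal[OF L pts] W sU)
  qed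
qed

text \<open>The unit \<open>u\<close> is the quotient of \<open>l\<close> by \<open>l0\<close>. It
  controls how the formulae for the induced maps depend on the chosen section.\<close>

lemma change_of_section:
  assumes X: "variety X" and L: "line_bundle X L" and x: "x \<in> points X"
    and reg: "regular_section X L (points X) s"
    and l: "l \<in> nonvanishing_near X L x" and l0: "l0 \<in> nonvanishing_near X L x"
  obtains u where "u \<in> local_reg X x" "u x \<noteq> 0" "l x = scal L (u x) (l0 x)"
    "\<forall>\<^sub>F y in nhdsin (ztop X) x. sec_quot L s l0 y = u y * sec_quot L s l y"
proof -
  note R = line_bundle_rules[OF L]
  obtain W where W: "openin (ztop X) W" "x \<in> W" "regular_section X L W l"
    "\<And>y. y \<in> W \<Longrightarrow> l y \<in> fibre L y" "\<And>y. y \<in> W \<Longrightarrow> l y \<noteq> 0" using nonvanishing_nearD[OF x l] by blast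
  let ?u = "sec_quot L l l0"
  note U = sec_quot_local_reg[OF X L W(3,1,2) l0]
  note S = sec_quot_local_reg(2)[OF X L reg openin_topspace x l]
  have lx: "l x = scal L (?u x) (l0 x)" using eventually_near_self[OF x U(2)] by simp
  then have "?u x \<noteq> 0" using W(5)[OF W(2)] R(3)[of "l0 x"] by auto
  moreover have "\<forall>\<^sub>F y in nhdsin (ztop X) x. sec_quot L s l0 y = ?u y * sec_quot L s l y"
    using U(2) S
  proof eventually_elim
    case (elim y)
    have "scal L (?u y * sec_quot L s l y) (l0 y) = s y"
      using elim R(1)[of "sec_quot L s l y" "?u y" "l0 y"] by (simp add: mult.commute)
    then show ?case using elim by (intro sec_quot_eqI[OF L]) auto
  qed
  ultimately show thesis using that U(1) lx by blast
qed

section \<open>Coordinates on the fibres of the geometric spaces\<close>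

lemma fin_pt_eq_iff:
  assumes "line_bundle X L" shows "fin_pt L v = fin_pt L w \<longleftrightarrow> v = w"
proof
  assume "fin_pt L v = fin_pt L w"
  moreover have "(v, 1) \<in> fin_pt L v"
    unfolding fin_pt_def ray_def using line_bundle_rules(2)[OF assms] by (intro CollectI exI[of _ 1]) simp
  ultimately show "v = w" using line_bundle_rules(2)[OF assms] by (auto simp: fin_pt_def ray_def)
qed simp

lemma theta_eq_iff:
  assumes L: "line_bundle X L"
  shows "theta L v = theta L w \<longleftrightarrow> (\<exists>c>0. v = scal L (complex_of_real c) w)"
proof
  assume "theta L v = theta L w"
  moreover have "(v, 0) \<in> theta L v"
    unfolding theta_def ray_def using line_bundle_rules(2)[OF L] by (intro CollectI exI[of _ 1]) simp
  ultimately show "\<exists>c>0. v = scal L (complex_of_real c) w" by (auto simp: theta_def ray_def)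
next
  assume "\<exists>c>0. v = scal L (complex_of_real c) w"
  then obtain c where c: "c > 0" "v = scal L (complex_of_real c) w" by blast
  show "theta L v = theta L w"
  proof (intro equalityI subsetI)
    fix z assume "z \<in> theta L v"
    then obtain d where "d > 0" "z = (scal L (complex_of_real d) v, 0)" by (auto simp: theta_def ray_def)
    then show "z \<in> theta L w" using c unfolding theta_def ray_def
      by (intro CollectI exI[of _ "d * c"]) (simp add: line_bundle_rules(1)[OF L])
  next
    fix z assume "z \<in> theta L w"
    then obtain d where "d > 0" "z = (scal L (complex_of_real d) w, 0)" by (auto simp: theta_def ray_def)
    then show "z \<in> theta L v" using c unfolding theta_def ray_def
      by (intro CollectI exI[of _ "d / c"]) (simp add: line_bundle_rules(1)[OF L])
  qed
qed

lemma fin_pt_neq_theta: "line_bundle X L \<Longrightarrow> fin_pt L v \<noteq> theta L w"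
proof
  assume L: "line_bundle X L" and eq: "fin_pt L v = theta L w"
  have "(v, 1) \<in> fin_pt L v"
    unfolding fin_pt_def ray_def using line_bundle_rules(2)[OF L] by (intro CollectI exI[of _ 1]) simp
  then show False unfolding eq by (auto simp: theta_def ray_def)
qed

lemma lstar_bij:
  assumes L: "line_bundle X L" and x: "x \<in> points X" and l: "l \<in> fibre L x" "l \<noteq> 0"
  shows "bij_betw (\<lambda>c. fin_pt L (scal L c l)) (- {0}) (lstar L x)"
  unfolding bij_betw_def
proof
  note R = line_bundle_rules[OF L]
  show "inj_on (\<lambda>c. fin_pt L (scal L c l)) (- {0})"
    using l(2) by (auto simp: inj_on_def fin_pt_eq_iff[OF L] R(4))
  show "(\<lambda>c. fin_pt L (scal L c l)) ` (- {0}) = lstar L x"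
  proof (intro equalityI subsetI)
    fix q assume "q \<in> (\<lambda>c. fin_pt L (scal L c l)) ` (- {0})"
    then show "q \<in> lstar L x" using l R(5,6) x by (auto simp: lstar_def)
  next
    fix q assume "q \<in> lstar L x"
    then obtain w where w: "w \<in> fibre L x" "w \<noteq> 0" "q = fin_pt L w" by (auto simp: lstar_def)
    then obtain c where "w = scal L c l" using line_bundle_fibre[OF L x l] by blast
    then show "q \<in> (\<lambda>c. fin_pt L (scal L c l)) ` (- {0})"
      using w R(3) by (intro image_eqI[of _ _ c]) auto
  qed
qed

lemma circle_bundle_bij:
  assumes L: "line_bundle X L" and x: "x \<in> points X" and l: "l \<in> fibre L x" "l \<noteq> 0"
  shows "bij_betw (\<lambda>c. theta L (scal L c l)) {z. cmod z = 1} (circle_bundle L x)"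
  unfolding bij_betw_def
proof
  note R = line_bundle_rules[OF L]
  show "inj_on (\<lambda>c. theta L (scal L c l)) {z. cmod z = 1}"
  proof (rule inj_onI)
    fix a b assume ab: "a \<in> {z. cmod z = 1}" "b \<in> {z. cmod z = 1}"
      "theta L (scal L a l) = theta L (scal L b l)"
    then obtain c where c: "c > 0" "scal L a l = scal L (complex_of_real c * b) l"
      unfolding theta_eq_iff[OF L] R(1) by blast
    then have "a = complex_of_real c * b" using R(4) l(2) by blast
    then have "cmod a = c * cmod b" using c(1) by (simp add: norm_mult)
    then show "a = b" using ab \<open>a = complex_of_real c * b\<close> by simp
  qed
  show "(\<lambda>c. theta L (scal L c l)) ` {z. cmod z = 1} = circle_bundle L x"
  proof (intro equalityI subsetI)
    fix q assume "q \<in> (\<lambda>c. theta L (scal L c l)) ` {z. cmod z = 1}"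
    then show "q \<in> circle_bundle L x" using l R(5,6) x by (auto simp: circle_bundle_def)
  next
    fix q assume "q \<in> circle_bundle L x"
    then obtain w where w: "w \<in> fibre L x" "w \<noteq> 0" "q = theta L w" by (auto simp: circle_bundle_def)
    then obtain c where c: "w = scal L c l" using line_bundle_fibre[OF L x l] by blast
    then have "c \<noteq> 0" using w R(3) by auto
    then have "w = scal L (complex_of_real (cmod c)) (scal L (sgn c) l)"
      unfolding c R(1) by (simp add: sgn_eq)
    then have "q = theta L (scal L (sgn c) l)"
      unfolding w(3) theta_eq_iff[OF L] using \<open>c \<noteq> 0\<close> by (intro exI[of _ "cmod c"]) simp
    then show "q \<in> (\<lambda>c. theta L (scal L c l)) ` {z. cmod z = 1}"
      using \<open>c \<noteq> 0\<close> by (intro image_eqI[of _ _ "sgn c"]) (auto simp: norm_sgn)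
  qed
qed

text \<open>Polar coordinates on the fibre: \<open>z\<close> is the argument and \<open>r\<close>
  the modulus relative to the basis vector \<open>l\<close>, and infinite modulus means the circle
  at infinity. It is the local formula of \<open>clog_to_cpl\<close> with the two homomorphisms
  replaced by their values.\<close>

definition polar_point :: "('a, 'e::ab_group_add) lbundle \<Rightarrow> 'e \<Rightarrow> complex \<times> ennreal \<Rightarrow> ('e \<times> real) set" where
  "polar_point L l = (\<lambda>(z, r). if r < \<infinity> then fin_pt L (scal L (complex_of_real (enn2real r) * z) l)
     else theta L (scal L z l))"

text \<open>Finite moduli give the usual polar coordinates of nonzero complex numbers, infinite
  modulus leaves only the argument; the two images are disjoint by
  \<open>fin_pt_neq_theta\<close>.\<close>

lemma polar_point_bij:
  assumes L: "line_bundle X L" and x: "x \<in> points X" and l: "l \<in> fibre L x" "l \<noteq> 0"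
  shows "bij_betw (polar_point L l) ({z. cmod z = 1} \<times> {0<..}) (lstar L x \<union> circle_bundle L x)"
proof -
  let ?S = "{z. cmod z = 1}"
  have polar: "bij_betw (\<lambda>(z, r). complex_of_real (enn2real r) * z) (?S \<times> {0<..<\<infinity>}) (- {0})"
    unfolding bij_betw_def
  proof
    show "inj_on (\<lambda>(z, r). complex_of_real (enn2real r) * z) (?S \<times> {0<..<\<infinity>})"
    proof (rule inj_onI, clarify)
      fix z r w q assume zr: "cmod z = 1" "cmod w = 1" "r \<in> {0<..<\<infinity>}" "q \<in> {0<..<\<infinity>}"
        "complex_of_real (enn2real r) * z = complex_of_real (enn2real q) * w"
      have "enn2real r = enn2real q"
        using arg_cong[OF zr(5), of cmod] zr(1,2) by (simp add: norm_mult)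
      moreover have "enn2real r > 0" using zr(3) by (simp add: enn2real_positive_iff)
      ultimately show "z = w \<and> r = q" using zr
        by (metis ennreal_enn2real greaterThanLessThan_iff infinity_ennreal_def mult_cancel_left
            of_real_eq_0_iff order_less_irrefl)
    qed
    show "(\<lambda>(z, r). complex_of_real (enn2real r) * z) ` (?S \<times> {0<..<\<infinity>}) = - {0}"
    proof (intro equalityI subsetI)
      fix c assume "c \<in> (\<lambda>(z, r). complex_of_real (enn2real r) * z) ` (?S \<times> {0<..<\<infinity>})"
      then show "c \<in> - {0}" by (auto simp: enn2real_eq_0_iff)
    next
      fix c :: complex assume "c \<in> - {0}"
      then show "c \<in> (\<lambda>(z, r). complex_of_real (enn2real r) * z) ` (?S \<times> {0<..<\<infinity>})"
        by (intro image_eqI[of _ _ "(sgn c, ennreal (cmod c))"]) (simp_all add: sgn_eq norm_divide)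
    qed
  qed
  have "bij_betw ((\<lambda>c. fin_pt L (scal L c l)) \<circ> (\<lambda>(z, r). complex_of_real (enn2real r) * z))
    (?S \<times> {0<..<\<infinity>}) (lstar L x)"
    by (rule bij_betw_trans[OF polar lstar_bij[OF L x l]])
  then have 1: "bij_betw (polar_point L l) (?S \<times> {0<..<\<infinity>}) (lstar L x)"
    by (rule bij_betw_cong[THEN iffD1, rotated]) (auto simp: polar_point_def)
  have "bij_betw fst (?S \<times> {\<infinity>::ennreal}) ?S" by (auto simp: bij_betw_def inj_on_def)
  then have "bij_betw ((\<lambda>c. theta L (scal L c l)) \<circ> fst) (?S \<times> {\<infinity>::ennreal}) (circle_bundle L x)"
    by (rule bij_betw_trans[OF _ circle_bundle_bij[OF L x l]])
  then have 2: "bij_betw (polar_point L l) (?S \<times> {\<infinity>}) (circle_bundle L x)"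
    by (rule bij_betw_cong[THEN iffD1, rotated]) (auto simp: polar_point_def)
  have "lstar L x \<inter> circle_bundle L x = {}"
    using fin_pt_neq_theta[OF L] by (auto simp: lstar_def circle_bundle_def)
  from bij_betw_combine[OF 1 2 this]
  have "bij_betw (polar_point L l) (?S \<times> {0<..<\<infinity>} \<union> ?S \<times> {\<infinity>}) (lstar L x \<union> circle_bundle L x)" .
  moreover have "{0<..<\<infinity>} \<union> {\<infinity>} = {0::ennreal<..}"
  proof (rule Set.set_eqI)
    show "r \<in> {0<..<\<infinity>} \<union> {\<infinity>} \<longleftrightarrow> r \<in> {0<..}" for r :: ennreal by (cases r) auto
  qed
  ultimately show ?thesis by (simp only: Sigma_Un_distrib2[symmetric])
qed

section \<open>Assembling bijections from fibres and components\<close>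

lemma indep_value_eq:
  assumes "l0 \<in> A" "\<And>l. l \<in> A \<Longrightarrow> F l = F l0"
  shows "indep_value A F = F l0"
  unfolding indep_value_def
proof (rule the_equality)
  show "\<forall>l\<in>A. F l = F l0" by (intro ballI assms(2))
  show "q = F l0" if "\<forall>l\<in>A. F l = q" for q using bspec[OF that assms(1)] by (rule sym)
qed

lemma bij_betw_fibrewise:
  assumes "\<And>x. x \<in> A \<Longrightarrow> bij_betw (m x) (H x) (E x)"
  shows "bij_betw (\<lambda>(x, h). (x, m x h)) (Sigma A H) (Sigma A E)"
  unfolding bij_betw_def
proof
  show "inj_on (\<lambda>(x, h). (x, m x h)) (Sigma A H)"
    using assms by (auto simp: inj_on_def bij_betw_def)
  show "(\<lambda>(x, h). (x, m x h)) ` Sigma A H = Sigma A E"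
  proof (intro equalityI subsetI)
    fix z assume "z \<in> (\<lambda>(x, h). (x, m x h)) ` Sigma A H"
    then show "z \<in> Sigma A E" using assms by (auto simp: bij_betw_def)
  next
    fix z assume "z \<in> Sigma A E"
    then obtain x e where z: "z = (x, e)" "x \<in> A" "e \<in> E x" by blast
    then obtain h where "h \<in> H x" "e = m x h" using assms[OF z(2)] by (auto simp: bij_betw_def)
    then show "z \<in> (\<lambda>(x, h). (x, m x h)) ` Sigma A H" using z by force
  qed
qed

text \<open>The pattern of all three bijections over one point. \<open>H\<close> is the set of
  homomorphisms and \<open>ev\<close> evaluates them at the local equations; the assumptions
  \<open>inj\<close> and \<open>surj\<close> say that these values are a free choice in
  \<open>C\<close>. For \<open>i \<in> J\<close> a coordinate \<open>\<kappa> i\<close> identifies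
  \<open>C\<close> with the fibre, and for the other indices the fibre is a single point.\<close>

lemma bij_betw_family:
  assumes "J \<subseteq> I"
    and into: "\<And>h i. h \<in> H \<Longrightarrow> i \<in> J \<Longrightarrow> ev h i \<in> C"
    and inj: "\<And>h h'. h \<in> H \<Longrightarrow> h' \<in> H \<Longrightarrow> (\<And>i. i \<in> J \<Longrightarrow> ev h i = ev h' i) \<Longrightarrow> h = h'"
    and surj: "\<And>v. (\<And>i. i \<in> J \<Longrightarrow> v i \<in> C) \<Longrightarrow> \<exists>h\<in>H. \<forall>i\<in>J. ev h i = v i"
    and \<kappa>: "\<And>i. i \<in> J \<Longrightarrow> bij_betw (\<kappa> i) C (Q i)"
    and \<theta>: "\<And>i. i \<in> I \<Longrightarrow> i \<notin> J \<Longrightarrow> Q i = {\<theta> i}"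
    and m: "\<And>h. h \<in> H \<Longrightarrow> m h = (\<lambda>i\<in>I. if i \<in> J then \<kappa> i (ev h i) else \<theta> i)"
  shows "bij_betw m H {\<eta> \<in> extensional I. \<forall>i\<in>I. \<eta> i \<in> Q i}"
  unfolding bij_betw_def
proof
  show "inj_on m H"
  proof (rule inj_onI)
    fix h h' assume h: "h \<in> H" "h' \<in> H" "m h = m h'"
    have "ev h i = ev h' i" if i: "i \<in> J" for i
    proof -
      have "\<kappa> i (ev h i) = \<kappa> i (ev h' i)"
        using fun_cong[OF h(3), of i] m[OF h(1)] m[OF h(2)] i assms(1) by auto
      then show ?thesis
        using \<kappa>[OF i] into[OF h(1) i] into[OF h(2) i] by (auto simp: bij_betw_def dest: inj_onD)
    qed
    then show "h = h'" by (rule inj[OF h(1,2)])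
  qed
  show "m ` H = {\<eta> \<in> extensional I. \<forall>i\<in>I. \<eta> i \<in> Q i}"
  proof (intro equalityI subsetI)
    fix \<eta> assume "\<eta> \<in> m ` H"
    then obtain h where h: "h \<in> H" "\<eta> = m h" by blast
    have "\<eta> i \<in> Q i" if "i \<in> I" for i
      using that h m[OF h(1)] bij_betwE[OF \<kappa>] into[OF h(1)] \<theta> by auto
    moreover have "\<eta> \<in> extensional I" using h m[OF h(1)] by simp
    ultimately show "\<eta> \<in> {\<eta> \<in> extensional I. \<forall>i\<in>I. \<eta> i \<in> Q i}" by blast
  next
    fix \<eta> assume \<eta>: "\<eta> \<in> {\<eta> \<in> extensional I. \<forall>i\<in>I. \<eta> i \<in> Q i}"
    have "\<exists>b\<in>C. \<eta> i = \<kappa> i b" if "i \<in> J" for i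
    proof -
      have "\<eta> i \<in> \<kappa> i ` C" using \<kappa>[OF that] \<eta> that assms(1) by (auto simp: bij_betw_def)
      then show ?thesis by blast
    qed
    then obtain v where v: "\<And>i. i \<in> J \<Longrightarrow> v i \<in> C" "\<And>i. i \<in> J \<Longrightarrow> \<eta> i = \<kappa> i (v i)" by metis
    obtain h where h: "h \<in> H" "\<forall>i\<in>J. ev h i = v i" using surj[of v] v(1) by blast
    have "\<eta> = m h"
    proof (rule extensionalityI[of _ I])
      show "\<eta> \<in> extensional I" using \<eta> by blast
      show "m h \<in> extensional I" using m[OF h(1)] by simp
      fix i assume "i \<in> I"
      then show "\<eta> i = m h i" using m[OF h(1)] h(2) v(2) \<theta> \<eta> by auto
    qed
    then show "\<eta> \<in> m ` H" using h(1) by blast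
  qed
qed

section \<open>The induced bijections\<close>

text \<open>Independence of the section on the circle: rescaling the vector by \<open>u\<close>
  amounts to multiplying the value by the argument of \<open>u\<close>, since \<open>theta\<close>
  ignores the positive factor \<open>cmod u\<close>.\<close>

lemma theta_scal:
  assumes L: "line_bundle X L" and "u \<noteq> 0"
  shows "theta L (scal L z (scal L u l)) = theta L (scal L (u / complex_of_real (cmod u) * z) l)"
  unfolding theta_eq_iff[OF L] line_bundle_rules(1)[OF L]
  using assms(2) by (intro exI[of _ "cmod u"]) (simp add: mult.commute)

lemma polar_point_scal:
  assumes L: "line_bundle X L" and u: "u \<noteq> 0"
  shows "polar_point L (scal L u l) (z, r) =
    polar_point L l (u / complex_of_real (cmod u) * z, ennreal (cmod u) * r)"
proof (cases "r < \<infinity>")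
  case True
  then have "ennreal (cmod u) * r < \<infinity>" by (simp add: ennreal_mult_less_top)
  moreover have "complex_of_real (enn2real r) * z * u =
    complex_of_real (enn2real (ennreal (cmod u) * r)) * (u / complex_of_real (cmod u) * z)"
    using u by (simp add: enn2real_mult)
  ultimately show ?thesis using True by (simp add: polar_point_def line_bundle_rules(1)[OF L])
next
  case False
  then have "r = \<infinity>" by (cases r) auto
  moreover have "ennreal (cmod u) * r = \<infinity>" using u \<open>r = \<infinity>\<close> by (simp add: ennreal_mult_top)
  ultimately show ?thesis by (simp add: polar_point_def theta_scal[OF L u])
qed

locale snc_pair =
  fixes X :: "'a fspace" and I :: "'i set" and D :: "'i \<Rightarrow> 'a set"
    and L :: "'i \<Rightarrow> ('a, 'e::ab_group_add) lbundle" and s :: "'i \<Rightarrow> 'a \<Rightarrow> 'e"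
  assumes nonsingular: "nonsingular_variety X"
    and snc: "snc_divisor X I D"
    and L: "\<And>i. i \<in> I \<Longrightarrow> line_bundle X (L i)"
    and s: "\<And>i. i \<in> I \<Longrightarrow> regular_section X (L i) (points X) (s i)"
    and transverse: "\<And>i. i \<in> I \<Longrightarrow> transverse_to_zero X (L i) (s i)"
    and zero_locus: "\<And>i. i \<in> I \<Longrightarrow> {x \<in> points X. s i x = 0} = D i"
begin

abbreviation DD where "DD \<equiv> \<Union>i\<in>I. D i"

abbreviation J where "J x \<equiv> {i \<in> I. x \<in> D i}"

definition frame :: "'a \<Rightarrow> 'i \<Rightarrow> 'a \<Rightarrow> 'e" where
  "frame x i = (SOME l. l \<in> nonvanishing_near X (L i) x)"

abbreviation t where "t x i \<equiv> sec_quot (L i) (s i) (frame x i)"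

lemma variety_X: "variety X"
  using nonsingular by (simp add: nonsingular_variety_def)

lemma finite_I: "finite I"
  using snc by (simp add: snc_divisor_def)

lemma closed_D: "i \<in> I \<Longrightarrow> closedin (ztop X) (D i)"
  using snc by (simp add: snc_divisor_def nonsingular_hypersurface_def)

lemma frame:
  assumes "x \<in> points X" "i \<in> I"
  shows "frame x i \<in> nonvanishing_near X (L i) x" "frame x i x \<in> fibre (L i) x" "frame x i x \<noteq> 0"
proof -
  have "\<exists>l. l \<in> nonvanishing_near X (L i) x" using frame_at[OF L[OF assms(2)] assms(1)] by metis
  then show *: "frame x i \<in> nonvanishing_near X (L i) x" unfolding frame_def by (rule someI_ex)
  obtain U where "openin (ztop X) U" "x \<in> U" "regular_section X (L i) U (frame x i)"
    "\<And>y. y \<in> U \<Longrightarrow> frame x i y \<in> fibre (L i) y"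
    "\<And>y. y \<in> U \<Longrightarrow> frame x i y \<noteq> 0"
    using nonvanishing_nearD[OF assms(1) *] by blast
  then show "frame x i x \<in> fibre (L i) x" "frame x i x \<noteq> 0" by blast+
qed

lemmas t_facts = sec_quot_local_reg[OF variety_X L s openin_topspace]

text \<open>Transversality of \<open>s i\<close> gives \<open>v0\<close> with nonzero value at
  \<open>t x i\<close>. Transversality of the hypersurfaces is applied to the family that is
  \<open>v0\<close> at \<open>i\<close> and zero elsewhere. The resulting \<open>v\<close> has the
  same value at \<open>t x j\<close> as the \<open>j\<close>-th member of the family, because their
  difference is tangent to \<open>D j\<close>, where \<open>t x j\<close> vanishes.\<close>

lemma tangent_t:
  assumes x: "x \<in> points X" and i: "i \<in> J x"
  shows "\<exists>v\<in>tangent_space X x. v (t x i) \<noteq> 0 \<and> (\<forall>j\<in>J x. j \<noteq> i \<longrightarrow> v (t x j) = 0)"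
proof -
  have "s i x = 0" using zero_locus[of i] i by blast
  then obtain v0 where v0: "v0 \<in> tangent_space X x" "v0 (t x i) \<noteq> 0"
    using transverse[of i] i frame(1)[OF x, of i] x unfolding transverse_to_zero_def by blast
  define w where "w j = (if j = i then v0 else (\<lambda>_. 0))" for j
  have "(\<lambda>_. 0) \<in> tangent_space X x" by (simp add: tangent_space_def)
  then have "\<forall>j\<in>I. w j \<in> tangent_space X x" using v0(1) by (simp add: w_def)
  then obtain v where v: "v \<in> tangent_space X x"
    "\<And>j. j \<in> J x \<Longrightarrow> (\<lambda>f. v f - w j f) \<in> sub_tangent_space X (D j) x"
    using snc x unfolding snc_divisor_def meet_transversally_def by blast
  have "v (t x j) = w j (t x j)" if j: "j \<in> J x" for j
  proof -
    have jI: "j \<in> I" using j by blast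
    note T = t_facts[OF jI jI x frame(1)[OF x jI]]
    obtain U where U: "openin (ztop X) U" "x \<in> U" "t x j \<in> reg X U" using T(1) by (auto simp: local_reg_def)
    obtain V where V: "openin (ztop X) V" "x \<in> V"
      "\<forall>y\<in>V. frame x j y \<noteq> 0 \<and> scal (L j) (t x j y) (frame x j y) = s j y"
      using T(2) unfolding eventually_near_iff[OF x] by blast
    have W: "openin (ztop X) (U \<inter> V)" "x \<in> U \<inter> V" using U V by auto
    have reg: "t x j \<in> reg X (U \<inter> V)"
      by (rule function_sheafD(2)[OF variety_sheaf[OF variety_X] U(1) W(1) _ U(3)]) simp
    have zero: "\<forall>y\<in>D j \<inter> (U \<inter> V). t x j y = 0"
    proof
      fix y assume y: "y \<in> D j \<inter> (U \<inter> V)"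
      then have "s j y = 0" using zero_locus[OF jI] by blast
      then show "t x j y = 0" using V(3) y line_bundle_rules(5)[OF L[OF jI]] by auto
    qed
    have "\<forall>U g. openin (ztop X) U \<and> x \<in> U \<and> g \<in> reg X U \<and> (\<forall>y\<in>D j \<inter> U. g y = 0) \<longrightarrow> v g - w j g = 0"
      using v(2)[OF j] unfolding sub_tangent_space_def by blast
    then have "v (t x j) - w j (t x j) = 0" using W reg zero by blast
    then show ?thesis by simp
  qed
  then show ?thesis using v(1) v0(2) i by (intro bexI[of _ v]) (auto simp: w_def)
qed

text \<open>Since there are finitely many closed components, those that miss \<open>x\<close> also
  miss a whole neighbourhood of \<open>x\<close>.\<close>

lemma divisor_t:
  assumes x: "x \<in> points X"
  shows "\<forall>\<^sub>F y in nhdsin (ztop X) x. y \<in> DD \<longleftrightarrow> (\<exists>i\<in>J x. t x i y = 0)"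
proof -
  have "\<forall>\<^sub>F y in nhdsin (ztop X) x. y \<in> D i \<longleftrightarrow> i \<in> J x \<and> t x i y = 0" if i: "i \<in> I" for i
  proof (cases "x \<in> D i")
    case True
    have pts: "\<forall>\<^sub>F y in nhdsin (ztop X) x. y \<in> points X"
      unfolding eventually_near_iff[OF x] using x by (intro exI[of _ "points X"]) simp
    from t_facts(2)[OF i i x frame(1)[OF x i]] pts show ?thesis
    proof eventually_elim
      case (elim y)
      have "y \<in> D i \<longleftrightarrow> s i y = 0" using zero_locus[OF i] elim by blast
      also have "\<dots> \<longleftrightarrow> t x i y = 0" using elim line_bundle_rules(5)[OF L[OF i]] by metis
      finally show ?case using True i by simp
    qed
  next
    case False
    have "openin (ztop X) (points X - D i)" using closed_D[OF i] by (simp add: closedin_def)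
    then have "\<forall>\<^sub>F y in nhdsin (ztop X) x. y \<notin> D i"
      unfolding eventually_near_iff[OF x] using x False by blast
    then show ?thesis by eventually_elim (use False in simp)
  qed
  then have "\<forall>\<^sub>F y in nhdsin (ztop X) x. \<forall>i\<in>I. y \<in> D i \<longleftrightarrow> i \<in> J x \<and> t x i y = 0"
    by (intro eventually_ball_finite finite_I) blast
  then show ?thesis by eventually_elim blast
qed

lemma snc_point_at:
  assumes x: "x \<in> points X"
  shows "snc_point X x DD (J x) (t x)"
proof
  show "finite (J x)" using finite_I by simp
  show "closedin (ztop X) DD" using finite_I closed_D by (intro closedin_Union) auto
  show "t x i \<in> local_reg X x" if "i \<in> J x" for i
    using that by (intro t_facts(1) frame x) auto
  show "t x i x = 0" if "i \<in> J x" for i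
  proof -
    have i: "i \<in> I" and "s i x = 0" using that zero_locus by auto
    then show ?thesis
      using eventually_near_self[OF x t_facts(2)[OF i i x frame(1)[OF x i]]]
        line_bundle_rules(5)[OF L[OF i]] by auto
  qed
qed (use nonsingular x tangent_t[OF x] divisor_t[OF x] in auto)

text \<open>The common form of the fibres of the log-spaces over \<open>x\<close>. The map \<kappa>
  is \<open>z\<close>, \<open>z / cmod z\<close> or \<open>cmod z\<close>, with matching
  \<open>C\<close>; the fibre of the complete log-space is a product of two such sets.\<close>

definition unit_homs :: "'b::comm_monoid_mult set \<Rightarrow> (complex \<Rightarrow> 'b) \<Rightarrow> 'a \<Rightarrow> (('a \<Rightarrow> complex) set \<Rightarrow> 'b) set" where
  "unit_homs C \<kappa> x = {h \<in> mon_hom (log_stalk X DD x) (mult_submonoid C).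
     \<forall>g. germ X x g \<in> Units (stalk X x) \<longrightarrow> h (germ X x g) = \<kappa> (g x)}"

lemma unit_homs_eqI:
  assumes x: "x \<in> points X" and h: "h \<in> unit_homs C \<kappa> x" "h' \<in> unit_homs C \<kappa> x"
    and eq: "\<And>i. i \<in> J x \<Longrightarrow> h (germ X x (t x i)) = h' (germ X x (t x i))"
  shows "h = h'"
proof -
  interpret snc_point X x DD "J x" "t x" by (rule snc_point_at[OF x])
  show ?thesis
  proof (rule mon_hom_eqI[of h C h'])
    show "h (germ X x u) = h' (germ X x u)" if "u \<in> local_reg X x" "u x \<noteq> 0" for u
    proof -
      have "germ X x u \<in> Units (stalk X x)" using that stalk_Units_iff[OF variety_X x] by blast
      then show ?thesis using h by (simp add: unit_homs_def)
    qed
  qed (use h eq in \<open>auto simp: unit_homs_def\<close>)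
qed

text \<open>Replacing \<open>frame x i\<close> by \<open>l\<close> multiplies the vector in the
  fibre by \<open>u x\<close>, and this identity gives the opposite change of the value of
  \<open>h\<close>. The two changes compensate in all three induced maps.\<close>

lemma unit_homs_change:
  assumes x: "x \<in> points X" and i: "i \<in> J x" and l: "l \<in> nonvanishing_near X (L i) x"
    and u: "u \<in> local_reg X x" "u x \<noteq> 0"
      "\<forall>\<^sub>F y in nhdsin (ztop X) x. t x i y = u y * sec_quot (L i) (s i) l y"
    and h: "h \<in> unit_homs C \<kappa> x"
  shows "h (germ X x (t x i)) = \<kappa> (u x) * h (germ X x (sec_quot (L i) (s i) l))"
proof -
  interpret snc_point X x DD "J x" "t x" by (rule snc_point_at[OF x])
  have iI: "i \<in> I" using i by blast
  have hm: "h \<in> mon_hom (log_stalk X DD x) (mult_submonoid C)" using h by (simp add: unit_homs_def)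
  have "h (germ X x (t x i)) = h (germ X x u) * h (germ X x (sec_quot (L i) (s i) l))"
    by (rule mon_hom_unit_multiple(2)[OF hm i u(1,2) t_facts(1)[OF iI iI x l] u(3)])
  moreover have "germ X x u \<in> Units (stalk X x)" using u stalk_Units_iff[OF variety_X x] by blast
  then have "h (germ X x u) = \<kappa> (u x)" using h by (simp add: unit_homs_def)
  ultimately show ?thesis by simp
qed

lemma unit_homs_exists:
  fixes \<kappa> :: "complex \<Rightarrow> 'b::comm_monoid_mult"
  assumes x: "x \<in> points X"
    and "1 \<in> C" "\<And>b c. b \<in> C \<Longrightarrow> c \<in> C \<Longrightarrow> b * c \<in> C"
    and "\<And>z. z \<noteq> 0 \<Longrightarrow> \<kappa> z \<in> C" "\<And>z w. z \<noteq> 0 \<Longrightarrow> w \<noteq> 0 \<Longrightarrow> \<kappa> (z * w) = \<kappa> z * \<kappa> w" "\<kappa> 1 = 1"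
    and "\<And>i. i \<in> J x \<Longrightarrow> v i \<in> C"
  shows "\<exists>h\<in>unit_homs C \<kappa> x. \<forall>i\<in>J x. h (germ X x (t x i)) = v i"
proof -
  interpret snc_point X x DD "J x" "t x" by (rule snc_point_at[OF x])
  have "\<exists>h\<in>mon_hom (log_stalk X DD x) (mult_submonoid C).
    (\<forall>g. germ X x g \<in> Units (stalk X x) \<longrightarrow> h (germ X x g) = \<kappa> (g x)) \<and>
    (\<forall>i\<in>J x. h (germ X x (t x i)) = v i)"
    by (rule mon_hom_exists) (use assms(2-) in auto)
  then show ?thesis unfolding unit_homs_def by blast
qed

lemma unit_homs_t:
  assumes x: "x \<in> points X" and h: "h \<in> unit_homs C \<kappa> x" and i: "i \<in> J x"
  shows "h (germ X x (t x i)) \<in> C"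
proof -
  interpret snc_point X x DD "J x" "t x" by (rule snc_point_at[OF x])
  show ?thesis using mon_hom_t[OF _ i] h by (auto simp: unit_homs_def)
qed

lemma section_off_D:
  assumes "x \<in> points X" "i \<in> I" "x \<notin> D i"
  shows "theta (L i) (s i x) \<in> circle_bundle (L i) x"
proof -
  have "s i x \<noteq> 0" using zero_locus[OF assms(2)] assms by blast
  moreover have "s i x \<in> fibre (L i) x" using s[OF assms(2)] assms(1) by (simp add: regular_section_def)
  ultimately show ?thesis by (auto simp: circle_bundle_def)
qed

section \<open>The fibres over a point of \<open>X\<close> and the three bijections\<close>

lemma component_fibres:
  assumes x: "x \<in> points X" and i: "i \<in> I"
  shows "x \<in> D i \<Longrightarrow> {q. (x, q) \<in> top1 X (L i) (s i) (D i)} = circle_bundle (L i) x"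
    "x \<in> D i \<Longrightarrow> {q. (x, q) \<in> cpl1 X (L i) (s i) (D i)} = lstar (L i) x \<union> circle_bundle (L i) x"
    "x \<in> D i \<Longrightarrow> {q. (x, q) \<in> mot1 X (L i) (s i) (D i)} = lstar (L i) x"
    "x \<notin> D i \<Longrightarrow> {q. (x, q) \<in> top1 X (L i) (s i) (D i)} = {theta (L i) (s i x)}"
    "x \<notin> D i \<Longrightarrow> {q. (x, q) \<in> cpl1 X (L i) (s i) (D i)} = {theta (L i) (s i x)}"
    "x \<notin> D i \<Longrightarrow> {q. (x, q) \<in> mot1 X (L i) (s i) (D i)} = {theta (L i) (s i x)}"
  using x section_off_D[OF x i] fin_pt_neq_theta[OF L[OF i]]
  by (auto simp: top1_def cpl1_def mot1_def lstar_def circle_bundle_def)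

lemma fibre_product_Sigma:
  "fibre_product X I E = Sigma (points X) (\<lambda>x. {\<eta> \<in> extensional I. \<forall>i\<in>I. \<eta> i \<in> {q. (x, q) \<in> E i}})"
  by (auto simp: fibre_product_def)

text \<open>Once every nonvanishing section gives the same value \<open>G i\<close>, the definite
  description in \<open>indep_value\<close> can be evaluated at the chosen
  \<open>frame x i\<close>.\<close>

lemma induced_family_eq:
  assumes x: "x \<in> points X"
    and "\<And>i l. i \<in> J x \<Longrightarrow> l \<in> nonvanishing_near X (L i) x \<Longrightarrow> F i l = G i"
  shows "induced_family X I D L s x F = (\<lambda>i\<in>I. if i \<in> J x then G i else theta (L i) (s i x))"
  unfolding induced_family_def
proof (rule restrict_ext)
  fix i assume i: "i \<in> I"
  show "(if x \<in> D i then indep_value (nonvanishing_near X (L i) x) (F i) else theta (L i) (s i x)) =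
    (if i \<in> J x then G i else theta (L i) (s i x))"
  proof (cases "x \<in> D i")
    case True
    then have iJ: "i \<in> J x" using i by simp
    have "indep_value (nonvanishing_near X (L i) x) (F i) = F i (frame x i)"
      by (rule indep_value_eq[OF frame(1)[OF x i]]) (simp add: assms(2)[OF iJ] frame(1)[OF x i])
    then show ?thesis using True iJ assms(2)[OF iJ frame(1)[OF x i]] by simp
  qed simp
qed

lemma alog_bij: "bij_betw (alog_to_mot X I D L s) (alog_space X DD) (mot_space X I D L s)"
proof -
  have space: "alog_space X DD = Sigma (points X) (unit_homs (- {0}) (\<lambda>z. z))"
    by (auto simp: alog_space_def unit_homs_def cstar_monoid_def mult_submonoid_def)
  show ?thesis
    unfolding space mot_space_def fibre_product_Sigma alog_to_mot_def
  proof (rule bij_betw_fibrewise)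
    fix x assume x: "x \<in> points X"
    show "bij_betw (\<lambda>h. induced_family X I D L s x
        (\<lambda>i l. fin_pt (L i) (scal (L i) (h (germ X x (sec_quot (L i) (s i) l))) (l x))))
      (unit_homs (- {0}) (\<lambda>z. z) x)
      {\<eta> \<in> extensional I. \<forall>i\<in>I. \<eta> i \<in> {q. (x, q) \<in> mot1 X (L i) (s i) (D i)}}"
    proof (rule bij_betw_family[where J = "J x" and C = "- {0}" and ev = "\<lambda>h i. h (germ X x (t x i))"
          and \<kappa> = "\<lambda>i c. fin_pt (L i) (scal (L i) c (frame x i x))" and \<theta> = "\<lambda>i. theta (L i) (s i x)"])
      show "J x \<subseteq> I" by blast
      show "h (germ X x (t x i)) \<in> - {0}" if "h \<in> unit_homs (- {0}) (\<lambda>z. z) x" "i \<in> J x" for h i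
        by (rule unit_homs_t[OF x that])
      show "h = h'" if "h \<in> unit_homs (- {0}) (\<lambda>z. z) x" "h' \<in> unit_homs (- {0}) (\<lambda>z. z) x"
        "\<And>i. i \<in> J x \<Longrightarrow> h (germ X x (t x i)) = h' (germ X x (t x i))" for h h'
        by (rule unit_homs_eqI[OF x that])
      show "\<exists>h\<in>unit_homs (- {0}) (\<lambda>z. z) x. \<forall>i\<in>J x. h (germ X x (t x i)) = v i"
        if "\<And>i. i \<in> J x \<Longrightarrow> v i \<in> - {0}" for v
        by (rule unit_homs_exists[OF x]) (use that in auto)
      show "bij_betw (\<lambda>c. fin_pt (L i) (scal (L i) c (frame x i x))) (- {0})
        {q. (x, q) \<in> mot1 X (L i) (s i) (D i)}" if "i \<in> J x" for i
        using that component_fibres(3)[OF x, of i] lstar_bij[OF L x frame(2,3)[OF x], of i] by simp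
      show "{q. (x, q) \<in> mot1 X (L i) (s i) (D i)} = {theta (L i) (s i x)}" if "i \<in> I" "i \<notin> J x" for i
        using that component_fibres(6)[OF x, of i] by simp
      fix h assume h: "h \<in> unit_homs (- {0}) (\<lambda>z. z) x"
      show "induced_family X I D L s x
          (\<lambda>i l. fin_pt (L i) (scal (L i) (h (germ X x (sec_quot (L i) (s i) l))) (l x))) =
        (\<lambda>i\<in>I. if i \<in> J x then fin_pt (L i) (scal (L i) (h (germ X x (t x i))) (frame x i x))
          else theta (L i) (s i x))"
      proof (rule induced_family_eq[OF x])
        fix i l assume i: "i \<in> J x" and l: "l \<in> nonvanishing_near X (L i) x"
        have iI: "i \<in> I" using i by blast
        obtain u where u: "u \<in> local_reg X x" "u x \<noteq> 0" "l x = scal (L i) (u x) (frame x i x)"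
          "\<forall>\<^sub>F y in nhdsin (ztop X) x. t x i y = u y * sec_quot (L i) (s i) l y"
          by (rule change_of_section[OF variety_X L[OF iI] x s[OF iI] l frame(1)[OF x iI]])
        note change = unit_homs_change[OF x i l u(1,2,4)]
        show "fin_pt (L i) (scal (L i) (h (germ X x (sec_quot (L i) (s i) l))) (l x)) =
          fin_pt (L i) (scal (L i) (h (germ X x (t x i))) (frame x i x))"
          unfolding change[OF h] u(3) line_bundle_rules(1)[OF L[OF iI]] by (simp only: mult.commute)
      qed
    qed
  qed
qed

lemma log_bij: "bij_betw (log_to_top X I D L s) (log_space X DD) (top_space X I D L s)"
proof -
  let ?arg = "\<lambda>z. z / complex_of_real (cmod z)" and ?S = "{z. cmod z = 1}"
  have space: "log_space X DD = Sigma (points X) (unit_homs ?S ?arg)"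
    by (auto simp: log_space_def unit_homs_def circle_monoid_def mult_submonoid_def)
  show ?thesis
    unfolding space top_space_def fibre_product_Sigma log_to_top_def
  proof (rule bij_betw_fibrewise)
    fix x assume x: "x \<in> points X"
    show "bij_betw (\<lambda>h. induced_family X I D L s x
        (\<lambda>i l. theta (L i) (scal (L i) (h (germ X x (sec_quot (L i) (s i) l))) (l x))))
      (unit_homs ?S ?arg x)
      {\<eta> \<in> extensional I. \<forall>i\<in>I. \<eta> i \<in> {q. (x, q) \<in> top1 X (L i) (s i) (D i)}}"
    proof (rule bij_betw_family[where J = "J x" and C = ?S and ev = "\<lambda>h i. h (germ X x (t x i))"
          and \<kappa> = "\<lambda>i c. theta (L i) (scal (L i) c (frame x i x))" and \<theta> = "\<lambda>i. theta (L i) (s i x)"])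
      show "J x \<subseteq> I" by blast
      show "h (germ X x (t x i)) \<in> ?S" if "h \<in> unit_homs ?S ?arg x" "i \<in> J x" for h i
        by (rule unit_homs_t[OF x that])
      show "h = h'" if "h \<in> unit_homs ?S ?arg x" "h' \<in> unit_homs ?S ?arg x"
        "\<And>i. i \<in> J x \<Longrightarrow> h (germ X x (t x i)) = h' (germ X x (t x i))" for h h'
        by (rule unit_homs_eqI[OF x that])
      show "\<exists>h\<in>unit_homs ?S ?arg x. \<forall>i\<in>J x. h (germ X x (t x i)) = v i"
        if "\<And>i. i \<in> J x \<Longrightarrow> v i \<in> ?S" for v
        by (rule unit_homs_exists[OF x]) (use that in \<open>auto simp: norm_mult norm_divide\<close>)
      show "bij_betw (\<lambda>c. theta (L i) (scal (L i) c (frame x i x))) ?S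
        {q. (x, q) \<in> top1 X (L i) (s i) (D i)}" if "i \<in> J x" for i
        using that component_fibres(1)[OF x, of i] circle_bundle_bij[OF L x frame(2,3)[OF x], of i] by simp
      show "{q. (x, q) \<in> top1 X (L i) (s i) (D i)} = {theta (L i) (s i x)}" if "i \<in> I" "i \<notin> J x" for i
        using that component_fibres(4)[OF x, of i] by simp
      fix h assume h: "h \<in> unit_homs ?S ?arg x"
      show "induced_family X I D L s x
          (\<lambda>i l. theta (L i) (scal (L i) (h (germ X x (sec_quot (L i) (s i) l))) (l x))) =
        (\<lambda>i\<in>I. if i \<in> J x then theta (L i) (scal (L i) (h (germ X x (t x i))) (frame x i x))
          else theta (L i) (s i x))"
      proof (rule induced_family_eq[OF x])
        fix i l assume i: "i \<in> J x" and l: "l \<in> nonvanishing_near X (L i) x"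
        have iI: "i \<in> I" using i by blast
        obtain u where u: "u \<in> local_reg X x" "u x \<noteq> 0" "l x = scal (L i) (u x) (frame x i x)"
          "\<forall>\<^sub>F y in nhdsin (ztop X) x. t x i y = u y * sec_quot (L i) (s i) l y"
          by (rule change_of_section[OF variety_X L[OF iI] x s[OF iI] l frame(1)[OF x iI]])
        note change = unit_homs_change[OF x i l u(1,2,4)]
        show "theta (L i) (scal (L i) (h (germ X x (sec_quot (L i) (s i) l))) (l x)) =
          theta (L i) (scal (L i) (h (germ X x (t x i))) (frame x i x))"
          unfolding change[OF h] u(3) by (rule theta_scal[OF L[OF iI] u(2)])
      qed
    qed
  qed
qed

text \<open>The two homomorphisms over \<open>x\<close> can be chosen independently of each other,
  so their values at \<open>t x i\<close> fill the product of the circle and (0, infinity]. These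
  are the polar coordinates of \<open>polar_point_bij\<close>.\<close>

lemma clog_bij: "bij_betw (clog_to_cpl X I D L s) (clog_space X DD) (cpl_space X I D L s)"
proof -
  let ?arg = "\<lambda>z. z / complex_of_real (cmod z)" and ?S = "{z. cmod z = 1}"
  let ?abs = "\<lambda>z. ennreal (cmod z)" and ?R = "{0::ennreal<..}"
  let ?H = "\<lambda>x. unit_homs ?S ?arg x \<times> unit_homs ?R ?abs x"
  have space: "clog_space X DD = Sigma (points X) ?H"
    by (auto simp: clog_space_def log_space_def unit_homs_def circle_monoid_def pos_infinity_monoid_def
        mult_submonoid_def)
  let ?m = "\<lambda>x (\<phi>, \<psi>). induced_family X I D L s x (\<lambda>i l. let t = germ X x (sec_quot (L i) (s i) l) in
    if \<psi> t < \<infinity> then fin_pt (L i) (scal (L i) (complex_of_real (enn2real (\<psi> t)) * \<phi> t) (l x))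
    else theta (L i) (scal (L i) (\<phi> t) (l x)))"
  have map: "clog_to_cpl X I D L s = (\<lambda>(x, h). (x, ?m x h))"
    by (auto simp: clog_to_cpl_def fun_eq_iff)
  show ?thesis
    unfolding space cpl_space_def fibre_product_Sigma map
  proof (rule bij_betw_fibrewise)
    fix x assume x: "x \<in> points X"
    show "bij_betw (?m x) (?H x)
      {\<eta> \<in> extensional I. \<forall>i\<in>I. \<eta> i \<in> {q. (x, q) \<in> cpl1 X (L i) (s i) (D i)}}"
    proof (rule bij_betw_family[where J = "J x" and C = "?S \<times> ?R"
          and ev = "\<lambda>h i. (fst h (germ X x (t x i)), snd h (germ X x (t x i)))"
          and \<kappa> = "\<lambda>i. polar_point (L i) (frame x i x)" and \<theta> = "\<lambda>i. theta (L i) (s i x)"])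
      show "J x \<subseteq> I" by blast
      show "(fst h (germ X x (t x i)), snd h (germ X x (t x i))) \<in> ?S \<times> ?R"
        if h: "h \<in> ?H x" and i: "i \<in> J x" for h i
      proof (rule SigmaI)
        show "fst h (germ X x (t x i)) \<in> ?S" by (rule unit_homs_t[OF x _ i]) (use h in auto)
        show "snd h (germ X x (t x i)) \<in> ?R" by (rule unit_homs_t[OF x _ i]) (use h in auto)
      qed
      show "h = h'" if h: "h \<in> ?H x" "h' \<in> ?H x"
        and eq: "\<And>i. i \<in> J x \<Longrightarrow> (fst h (germ X x (t x i)), snd h (germ X x (t x i))) =
          (fst h' (germ X x (t x i)), snd h' (germ X x (t x i)))" for h h'
      proof (rule prod_eqI)
        show "fst h = fst h'" by (rule unit_homs_eqI[OF x]) (use h eq in \<open>auto simp: mem_Times_iff\<close>)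
        show "snd h = snd h'" by (rule unit_homs_eqI[OF x]) (use h eq in \<open>auto simp: mem_Times_iff\<close>)
      qed
      show "\<exists>h\<in>?H x. \<forall>i\<in>J x. (fst h (germ X x (t x i)), snd h (germ X x (t x i))) = v i"
        if v: "\<And>i. i \<in> J x \<Longrightarrow> v i \<in> ?S \<times> ?R" for v
      proof -
        have "\<exists>\<phi>\<in>unit_homs ?S ?arg x. \<forall>i\<in>J x. \<phi> (germ X x (t x i)) = fst (v i)"
          by (rule unit_homs_exists[OF x]) (use v in \<open>auto simp: norm_mult norm_divide mem_Times_iff\<close>)
        moreover have "\<exists>\<psi>\<in>unit_homs ?R ?abs x. \<forall>i\<in>J x. \<psi> (germ X x (t x i)) = snd (v i)"
          by (rule unit_homs_exists[OF x])
            (use v in \<open>auto simp: norm_mult ennreal_mult ennreal_zero_less_mult_iff mem_Times_iff\<close>)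
        ultimately obtain \<phi> \<psi> where "\<phi> \<in> unit_homs ?S ?arg x" "\<psi> \<in> unit_homs ?R ?abs x"
          "\<forall>i\<in>J x. \<phi> (germ X x (t x i)) = fst (v i)" "\<forall>i\<in>J x. \<psi> (germ X x (t x i)) = snd (v i)"
          by blast
        then show ?thesis by (intro bexI[of _ "(\<phi>, \<psi>)"]) auto
      qed
      show "bij_betw (polar_point (L i) (frame x i x)) (?S \<times> ?R)
        {q. (x, q) \<in> cpl1 X (L i) (s i) (D i)}" if "i \<in> J x" for i
        using that component_fibres(2)[OF x, of i] polar_point_bij[OF L x frame(2,3)[OF x], of i] by simp
      show "{q. (x, q) \<in> cpl1 X (L i) (s i) (D i)} = {theta (L i) (s i x)}" if "i \<in> I" "i \<notin> J x" for i
        using that component_fibres(5)[OF x, of i] by simp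
      fix h assume "h \<in> ?H x"
      then obtain \<phi> \<psi> where h: "h = (\<phi>, \<psi>)" "\<phi> \<in> unit_homs ?S ?arg x" "\<psi> \<in> unit_homs ?R ?abs x" by blast
      have m: "?m x h = induced_family X I D L s x (\<lambda>i l. polar_point (L i) (l x)
        (\<phi> (germ X x (sec_quot (L i) (s i) l)), \<psi> (germ X x (sec_quot (L i) (s i) l))))"
        by (simp add: h(1) polar_point_def Let_def)
      show "?m x h = (\<lambda>i\<in>I. if i \<in> J x
        then polar_point (L i) (frame x i x) (fst h (germ X x (t x i)), snd h (germ X x (t x i)))
        else theta (L i) (s i x))"
        unfolding m
      proof (rule induced_family_eq[OF x])
        fix i l assume i: "i \<in> J x" and l: "l \<in> nonvanishing_near X (L i) x"
        have iI: "i \<in> I" using i by blast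
        obtain u where u: "u \<in> local_reg X x" "u x \<noteq> 0" "l x = scal (L i) (u x) (frame x i x)"
          "\<forall>\<^sub>F y in nhdsin (ztop X) x. t x i y = u y * sec_quot (L i) (s i) l y"
          by (rule change_of_section[OF variety_X L[OF iI] x s[OF iI] l frame(1)[OF x iI]])
        note change = unit_homs_change[OF x i l u(1,2,4)]
        show "polar_point (L i) (l x)
            (\<phi> (germ X x (sec_quot (L i) (s i) l)), \<psi> (germ X x (sec_quot (L i) (s i) l))) =
          polar_point (L i) (frame x i x) (fst h (germ X x (t x i)), snd h (germ X x (t x i)))"
          unfolding h(1) fst_conv snd_conv change[OF h(2)] change[OF h(3)] u(3)
          by (rule polar_point_scal[OF L[OF iI] u(2)])
      qed
    qed
  qed
qed

end

theorem theorem4p8: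
  fixes X :: "'a fspace" and I :: "'i set" and D :: "'i \<Rightarrow> 'a set"
    and L :: "'i \<Rightarrow> ('a, 'e::ab_group_add) lbundle" and s :: "'i \<Rightarrow> 'a \<Rightarrow> 'e"
  assumes "nonsingular_variety X"
    and "snc_divisor X I D"
    and "\<And>i. i \<in> I \<Longrightarrow> line_bundle X (L i)"
    and "\<And>i. i \<in> I \<Longrightarrow> regular_section X (L i) (points X) (s i)"
    and "\<And>i. i \<in> I \<Longrightarrow> transverse_to_zero X (L i) (s i)"
    and "\<And>i. i \<in> I \<Longrightarrow> {x \<in> points X. s i x = 0} = D i"
  shows "bij_betw (alog_to_mot X I D L s) (alog_space X (\<Union>i\<in>I. D i)) (mot_space X I D L s) \<and>
         bij_betw (log_to_top X I D L s) (log_space X (\<Union>i\<in>I. D i)) (top_space X I D L s) \<and>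
         bij_betw (clog_to_cpl X I D L s) (clog_space X (\<Union>i\<in>I. D i)) (cpl_space X I D L s)"
proof -
  interpret snc_pair X I D L s
    by (rule snc_pair.intro) (fact assms)+
  show ?thesis using alog_bij log_bij clog_bij by blast
qed

end
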